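(* Let $\mu,\nu$ be symmetric Lévy measures on $\mathbb{R}^m\setminus\{0\}$ and $\mathbb{R}^n\setminus\{0\}$, each with full support, with $\Phi(x)=\int(1-\cos\langle x,s\rangle)\,\mu(ds)$ and $\Psi(y)=\int(1-\cos\langle y,t\rangle)\,\nu(dt)$. Let $X$ and $Y$ be independent random vectors in $\mathbb{R}^m$ and $\mathbb{R}^n$ such that for some $\epsilon>0$ $$\mathbb{E}[\Phi(X)+\Psi(Y)]<\infty\quad\text{and}\quad \mathbb{E}\big[\log^{1+\epsilon}(1+|X|^2)+\log^{1+\epsilon}(1+|Y|^2)\big]<\infty.$$ Let $(X_i,Y_i)_{i\in\mathbb{N}}$ be i.i.d. copies of $(X,Y)$, $\boldsymbol X=(X_1,\dots,X_N)$, $\boldsymbol Y=(Y_1,\dots,Y_N)$. Then $$N\cdot\widehat V_N^2(\boldsymbol X,\boldsymbol Y)\xrightarrow[N\to\infty]{d}\iint|\mathbb{G}(s,t)|^2\,\mu(ds)\,\nu(dt),$$ where $(\mathbb{G}(s,t))_{(s,t)\in\mathbb{R}^{m+n}}$ is a complex-valued Gaussian random field with $\mathbb{E}\,\mathbb{G}(s,t)=0$ and $$\operatorname{Cov}(\mathbb{G}(s,t),\mathbb{G}(s',t'))=\big(f_X(s-s')-f_X(s)\overline{f_X(s')}\big)\big(f_Y(t-t')-f_Y(t)\overline{f_Y(t')}\big).$$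
   Context: A symmetric Lévy measure on $\mathbb{R}^d\setminus\{0\}$ is a measure $\rho$ with $\rho(B)=\rho(-B)$ and $\int(1\wedge|r|^2)\,\rho(dr)<\infty$; full support means $\rho(G)>0$ for every nonempty open $G\subset\mathbb{R}^d\setminus\{0\}$. $f_X(s)=\mathbb{E}e^{i\langle s,X\rangle}$ denotes the characteristic function. For points $(x_1,y_1),\dots,(x_N,y_N)$ the estimator is $$\widehat V_N^2(\boldsymbol x,\boldsymbol y)=\frac1{N^4}\sum_{i,j,k,l=1}^N\big[\Phi(x_i-x_k)\Psi(y_i-y_k)-2\Phi(x_i-x_j)\Psi(y_i-y_l)+\Phi(x_i-x_j)\Psi(y_k-y_l)\big].$$
   Formalization: The field 𝔾 is also assumed to satisfy 𝔾(-s,-t) = conj 𝔾(s,t) a.s. (mean and covariance alone do not determine the law of the limit, so the claim fails without it) and to be jointly measurable, so that the double integral is a random variable. *)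

theory Defs
  imports "HOL-Probability.Probability"
begin

definition sym_levy_measure :: "'a::euclidean_space measure \<Rightarrow> bool" where
  "sym_levy_measure \<rho> \<longleftrightarrow>
     sets \<rho> = sets borel \<and> emeasure \<rho> {0} = 0 \<and>
     (\<forall>B \<in> sets borel. emeasure \<rho> B = emeasure \<rho> (uminus ` B)) \<and>
     (\<integral>\<^sup>+ r. ennreal (min 1 (norm r ^ 2)) \<partial>\<rho>) < \<infinity>"

definition full_support :: "'a::euclidean_space measure \<Rightarrow> bool" where
  "full_support \<rho> \<longleftrightarrow>
     (\<forall>G. open G \<and> G \<noteq> {} \<and> 0 \<notin> G \<longrightarrow> emeasure \<rho> G > 0)"

definition levy_fun :: "'a::euclidean_space measure \<Rightarrow> 'a \<Rightarrow> real" where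
  "levy_fun \<rho> x = (\<integral> s. (1 - cos (x \<bullet> s)) \<partial>\<rho>)"

text \<open>Independence of two random vectors with values in possibly different spaces
  (textbook definition via events; the library's indep_var needs equal types).\<close>
definition indep_rvs :: "'w measure \<Rightarrow> ('w \<Rightarrow> 'a::topological_space) \<Rightarrow> ('w \<Rightarrow> 'b::topological_space) \<Rightarrow> bool" where
  "indep_rvs M X Y \<longleftrightarrow>
     (\<forall>A \<in> sets borel. \<forall>B \<in> sets borel.
        measure M (X -` A \<inter> Y -` B \<inter> space M) = measure M (X -` A \<inter> space M) * measure M (Y -` B \<inter> space M))"

definition char_fun :: "'w measure \<Rightarrow> ('w \<Rightarrow> 'a::euclidean_space) \<Rightarrow> 'a \<Rightarrow> complex" where
  "char_fun M X s = (CLINT \<omega>|M. cis (s \<bullet> X \<omega>))"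

definition dcov_hat ::
  "('a \<Rightarrow> real) \<Rightarrow> ('b \<Rightarrow> real) \<Rightarrow> nat \<Rightarrow> (nat \<Rightarrow> 'a::ab_group_add) \<Rightarrow> (nat \<Rightarrow> 'b::ab_group_add) \<Rightarrow> real" where
  "dcov_hat \<Phi> \<Psi> N x y =
     (1 / real N ^ 4) *
     (\<Sum>i<N. \<Sum>j<N. \<Sum>k<N. \<Sum>l<N.
        \<Phi> (x i - x k) * \<Psi> (y i - y k) - 2 * \<Phi> (x i - x j) * \<Psi> (y i - y l)
        + \<Phi> (x i - x j) * \<Psi> (y k - y l))"

definition real_gaussian_rv :: "'q measure \<Rightarrow> ('q \<Rightarrow> real) \<Rightarrow> bool" where
  "real_gaussian_rv P Z \<longleftrightarrow> Z \<in> borel_measurable P \<and>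
     ((\<exists>c. AE \<omega> in P. Z \<omega> = c) \<or>
      (\<exists>m \<sigma>. \<sigma> > 0 \<and> distributed P lborel Z (normal_density m \<sigma>)))"

definition complex_gaussian_field :: "'q measure \<Rightarrow> ('a \<Rightarrow> 'b \<Rightarrow> 'q \<Rightarrow> complex) \<Rightarrow> bool" where
  "complex_gaussian_field P G \<longleftrightarrow>
     (\<forall>S :: ('a \<times> 'b) set. \<forall>a b :: 'a \<times> 'b \<Rightarrow> real. finite S \<longrightarrow>
        real_gaussian_rv P (\<lambda>\<omega>. \<Sum>p\<in>S. a p * Re (G (fst p) (snd p) \<omega>) + b p * Im (G (fst p) (snd p) \<omega>)))"

end

theory Submission
  imports Defs
begin

text \<open>
  With \<open>Z\<close> the normalized difference between the joint empirical characteristic function and the product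
  of the marginal ones, symmetry of the Levy measures gives
  \<open>N * dcov_hat = \<integral>\<integral> |Z (s, t)|\<^sup>2 d\<mu> d\<nu>\<close>. Up to a remainder of order \<open>1 / N\<close> in mean square, \<open>Z\<close> is a
  normalized sum \<open>W\<close> of i.i.d. centred fields whose covariance is exactly that of the Gaussian field, for
  every \<open>N\<close>. Hence replacing the double integral by a finite quadrature costs the same small error in mean,
  uniformly in \<open>N\<close> and also for the limit, so that only finite-dimensional laws matter. There the Laplace
  transform of a quadratic form \<open>\<Sum> c p * |W p|\<^sup>2\<close> is an average of characteristic functions of linear
  combinations, to which the one-dimensional central limit theorem applies. Convergence of the Laplace
  transforms at the natural numbers suffices for weak convergence, by polynomial approximation in
  \<open>exp (- x)\<close>.
\<close>

section \<open>Laplace transforms and Gaussian randomization\<close>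

text \<open>The Levy measures may have infinite mass near the origin, so the double integral is not
  a continuous functional for locally uniform convergence of the fields. What controls the singular
  region, in mean, is the variance (1 - |f_X(s)|^2)(1 - |f_Y(t)|^2) of the limit field, which also
  bounds that of W; its integral is finite because the expectations of \<Phi>(X) and \<Psi>(Y) are.
  The estimator centres with sample means, which destroys the i.i.d. structure. Centring with the
  true characteristic functions restores it, and the price is a product of two marginal
  fluctuations, which is small because X and Y are independent. For a complex Gaussian field the
  numbers E[G(p) * cnj (G(q))] do not determine the law; E[G(p) * G(q)] is needed as well. For
  fields built from characters it is the covariance at p and -q, owing to G(-p) = cnj (G(p)). This
  relation is therefore carried along with the covariance throughout.\<close>

lemma borel_measurable_cis [measurable]: "cis \<in> borel_measurable borel"
  by (rule borel_measurable_continuous_onI) (intro continuous_intros)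

lemma (in prob_space) norm_integral_le_const:
  fixes f :: "'a \<Rightarrow> 'b::{banach, second_countable_topology}"
  assumes "f \<in> borel_measurable M" "\<And>x. norm (f x) \<le> B"
  shows "norm (\<integral>x. f x \<partial>M) \<le> B"
proof -
  have "norm (\<integral>x. f x \<partial>M) \<le> (\<integral>x. norm (f x) \<partial>M)" by simp
  also have "\<dots> \<le> (\<integral>x. B \<partial>M)"
    using assms order_trans[OF norm_ge_zero assms(2)]
    by (intro integral_mono integrable_norm integrable_const_bound[of _ B] AE_I2) auto
  finally show ?thesis by (simp add: prob_space)
qed

text \<open>Nonnegativity places the laws in the unit interval under \<open>u = exp (- z)\<close>,
  where the Laplace transforms at natural numbers become moments. Continuous steps vanish for large
  arguments, so they extend continuously to \<open>u = 0\<close> and Weierstrass approximation works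
  on the whole compact interval; no separate tightness argument arises.\<close>

lemma laplace_convergence_imp_weak_conv:
  fixes T :: "nat \<Rightarrow> 'w \<Rightarrow> real" and U :: "'q \<Rightarrow> real"
  assumes M: "prob_space M" and P: "prob_space P"
    and T: "\<And>n. T n \<in> borel_measurable M" and U: "U \<in> borel_measurable P"
    and T0: "\<And>n \<omega>. 0 \<le> T n \<omega>" and U0: "\<And>\<omega>. 0 \<le> U \<omega>"
    and lap: "\<And>k::nat. (\<lambda>n. \<integral>\<omega>. exp (- real k * T n \<omega>) \<partial>M) \<longlonglongrightarrow> (\<integral>\<omega>. exp (- real k * U \<omega>) \<partial>P)"
  shows "weak_conv_m (\<lambda>n. distr M borel (T n)) (distr P borel U)"
proof (rule integral_cts_step_conv_imp_weak_conv)
  interpret M: prob_space M by fact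
  interpret P: prob_space P by fact
  note [measurable] = T U
  show "real_distribution (distr M borel (T n))" for n
    by (rule M.real_distribution_distr) measurable
  show "real_distribution (distr P borel U)"
    by (rule P.real_distribution_distr) measurable
  fix x y :: real assume xy: "x < y"
  have cts_cont: "continuous_on A (cts_step x y)" for A
    using uniformly_continuous_imp_continuous[OF cts_step_uniformly_continuous[OF xy]]
      continuous_on_subset by blast
  have [measurable]: "cts_step x y \<in> borel_measurable borel"
    by (rule borel_measurable_continuous_onI[OF cts_cont])
  \<comment> \<open>The step function, read in the variable \<open>u = exp (-z)\<close>; the maximum keeps the
    logarithm away from its pole without changing the value.\<close>
  define h where "h u = cts_step x y (- ln (max u (exp (- y))))" for u
  have pos: "max u (exp (- y)) > 0" for u by (simp add: less_max_iff_disj)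
  have h_cont: "continuous_on {0..1} h"
    unfolding h_def
    by (rule continuous_on_compose2[OF cts_cont[of UNIV]])
       (use pos in \<open>auto intro!: continuous_intros simp: less_imp_neq[THEN not_sym]\<close>)
  have h_exp: "h (exp (- z)) = cts_step x y z" for z
    using xy by (auto simp: h_def cts_step_def max_def)
  have int_h: "integrable N (\<lambda>\<omega>. cts_step x y (Z \<omega>))"
    if "prob_space N" "Z \<in> borel_measurable N" for N :: "'z measure" and Z
  proof -
    interpret prob_space N by fact
    note [measurable] = that(2)
    show ?thesis
      using xy by (intro integrable_const_bound[of _ 1]) (auto simp: cts_step_def)
  qed
  have int_p: "integrable N (\<lambda>\<omega>. exp (- real k * Z \<omega>))"
    if "prob_space N" "Z \<in> borel_measurable N" "\<And>\<omega>. 0 \<le> Z \<omega>" for N :: "'z measure" and Z and k :: nat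
  proof -
    interpret prob_space N by fact
    note [measurable] = that(2)
    show ?thesis
      using that(3) by (intro integrable_const_bound[of _ 1]) auto
  qed
  have "(\<lambda>n. \<integral>\<omega>. cts_step x y (T n \<omega>) \<partial>M) \<longlonglongrightarrow> (\<integral>\<omega>. cts_step x y (U \<omega>) \<partial>P)"
  proof (rule LIMSEQ_I)
    fix e :: real assume e: "0 < e"
    obtain g where g: "real_polynomial_function g" "\<And>u. u \<in> {0..1} \<Longrightarrow> \<bar>h u - g u\<bar> < e / 3"
      using Stone_Weierstrass_real_polynomial_function[OF compact_Icc h_cont, of "e / 3"] e
      by auto
    obtain a d where gd: "g = (\<lambda>u. \<Sum>i\<le>d. a i * u ^ i)"
      using g(1) by (auto simp: real_polynomial_function_iff_sum)
    have gexp: "g (exp (- z)) = (\<Sum>i\<le>d. a i * exp (- real i * z))" for z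
      by (simp add: gd exp_of_nat_mult[symmetric])
    have g_int: "integrable N (\<lambda>\<omega>. g (exp (- Z \<omega>)))"
      "(\<integral>\<omega>. g (exp (- Z \<omega>)) \<partial>N) = (\<Sum>i\<le>d. a i * (\<integral>\<omega>. exp (- real i * Z \<omega>) \<partial>N))"
      if "prob_space N" "Z \<in> borel_measurable N" "\<And>\<omega>. 0 \<le> Z \<omega>" for N :: "'z measure" and Z
      unfolding gexp using int_p[OF that] by auto
    have near: "\<bar>(\<integral>\<omega>. cts_step x y (Z \<omega>) \<partial>N) - (\<integral>\<omega>. g (exp (- Z \<omega>)) \<partial>N)\<bar> \<le> e / 3"
      if Z: "prob_space N" "Z \<in> borel_measurable N" "\<And>\<omega>. 0 \<le> Z \<omega>" for N :: "'z measure" and Z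
    proof -
      interpret prob_space N by fact
      have "\<bar>(\<integral>\<omega>. cts_step x y (Z \<omega>) \<partial>N) - (\<integral>\<omega>. g (exp (- Z \<omega>)) \<partial>N)\<bar>
        = \<bar>\<integral>\<omega>. cts_step x y (Z \<omega>) - g (exp (- Z \<omega>)) \<partial>N\<bar>"
        using int_h[OF Z(1,2)] g_int(1)[OF Z] by simp
      also have "\<dots> \<le> (\<integral>\<omega>. \<bar>cts_step x y (Z \<omega>) - g (exp (- Z \<omega>))\<bar> \<partial>N)"
        by (rule integral_abs_bound)
      also have "\<dots> \<le> (\<integral>\<omega>. e / 3 \<partial>N)"
        using int_h[OF Z(1,2)] g_int(1)[OF Z] g(2)[of "exp (- Z _)"] Z(3)
        by (intro integral_mono) (auto simp: h_exp less_imp_le)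
      finally show ?thesis by (simp add: prob_space)
    qed
    have "(\<lambda>n. \<integral>\<omega>. g (exp (- T n \<omega>)) \<partial>M) \<longlonglongrightarrow> (\<integral>\<omega>. g (exp (- U \<omega>)) \<partial>P)"
      unfolding g_int(2)[OF M T T0] g_int(2)[OF P U U0]
      by (intro tendsto_sum tendsto_mult tendsto_const lap)
    then obtain n0 where n0: "\<And>n. n \<ge> n0 \<Longrightarrow>
        \<bar>(\<integral>\<omega>. g (exp (- T n \<omega>)) \<partial>M) - (\<integral>\<omega>. g (exp (- U \<omega>)) \<partial>P)\<bar> < e / 3"
      using e LIMSEQ_D[where r = "e/3"] by (metis real_norm_def zero_less_divide_iff zero_less_numeral)
    show "\<exists>n0. \<forall>n\<ge>n0. norm ((\<integral>\<omega>. cts_step x y (T n \<omega>) \<partial>M) - (\<integral>\<omega>. cts_step x y (U \<omega>) \<partial>P)) < e"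
    proof (intro exI allI impI)
      fix n assume "n \<ge> n0"
      then show "norm ((\<integral>\<omega>. cts_step x y (T n \<omega>) \<partial>M) - (\<integral>\<omega>. cts_step x y (U \<omega>) \<partial>P)) < e"
        using n0[of n] near[OF M T[of n] T0[of n]] near[OF P U U0] unfolding real_norm_def by linarith
    qed
  qed
  then show "(\<lambda>n. integral\<^sup>L (distr M borel (T n)) (cts_step x y)) \<longlonglongrightarrow> integral\<^sup>L (distr P borel U) (cts_step x y)"
    by (simp add: integral_distr)
qed

text \<open>Since \<open>exp (- u\<^sup>2 / 2)\<close> is the characteristic function of a standard normal variable at \<open>u\<close>,
  each quadratic factor can be traded for an average over characters.\<close>

definition char_quad :: "'i set \<Rightarrow> 'z measure \<Rightarrow> ('i \<Rightarrow> 'z \<Rightarrow> real) \<Rightarrow> 'i set \<Rightarrow> ('i \<Rightarrow> real) \<Rightarrow> complex" where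
  "char_quad S Q Z F a =
    (CLINT \<omega>|Q. cis (\<Sum>i\<in>S. a i * Z i \<omega>) * of_real (exp (- (\<Sum>i\<in>F. (Z i \<omega>)\<^sup>2 / 2))))"

context prob_space
begin

lemma norm_char_quad_le:
  assumes [measurable]: "\<And>i. Z i \<in> borel_measurable M"
  shows "cmod (char_quad S M Z F a) \<le> 1"
  unfolding char_quad_def
  by (rule norm_integral_le_const) (auto simp: norm_mult intro!: sum_nonneg)

lemma char_quad_upd:
  assumes "finite S" "j \<in> S"
  shows "char_quad S M Z F (a(j := a j + g)) =
    (CLINT \<omega>|M. cis ((\<Sum>i\<in>S. a i * Z i \<omega>) + g * Z j \<omega>) * of_real (exp (- (\<Sum>i\<in>F. (Z i \<omega>)\<^sup>2 / 2))))"
proof -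
  have "(\<Sum>i\<in>S. (a(j := a j + g)) i * Z i \<omega>) = (\<Sum>i\<in>S. a i * Z i \<omega>) + g * Z j \<omega>" for \<omega>
    using assms by (simp add: sum.remove[OF assms] algebra_simps)
  then show ?thesis unfolding char_quad_def by simp
qed

lemma borel_measurable_char_quad_upd:
  assumes [measurable]: "\<And>i. Z i \<in> borel_measurable M" and "finite S" "j \<in> S"
  shows "(\<lambda>g. char_quad S M Z F (a(j := a j + g))) \<in> borel_measurable borel"
  unfolding char_quad_upd[OF assms(2,3)] by measurable

lemma char_quad_insert:
  assumes [measurable]: "\<And>i. Z i \<in> borel_measurable M"
    and S: "finite S" "j \<in> S" and F: "finite F" "j \<notin> F"
  shows "char_quad S M Z (insert j F) a
    = (CLINT g|std_normal_distribution. char_quad S M Z F (a(j := a j + g)))"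
proof -
  interpret N: real_distribution std_normal_distribution by (rule real_dist_normal_dist)
  interpret QN: pair_prob_space std_normal_distribution M ..
  let ?L = "\<lambda>\<omega>. \<Sum>i\<in>S. a i * Z i \<omega>" and ?E = "\<lambda>F \<omega>. of_real (exp (- (\<Sum>i\<in>F. (Z i \<omega>)\<^sup>2 / 2)))"
  let ?f = "\<lambda>g \<omega>. cis (?L \<omega> + g * Z j \<omega>) * ?E F \<omega>"
  have bound: "cmod (?f g \<omega>) \<le> 1" for g \<omega>
    by (auto simp: norm_mult intro!: sum_nonneg)
  have "integrable (std_normal_distribution \<Otimes>\<^sub>M M) (\<lambda>(g, \<omega>). ?f g \<omega>)"
    using bound by (intro QN.P.integrable_const_bound[of _ 1] AE_I2) (simp_all only: split_beta, measurable)
  then have "(CLINT g|std_normal_distribution. CLINT \<omega>|M. ?f g \<omega>)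
    = (CLINT \<omega>|M. CLINT g|std_normal_distribution. ?f g \<omega>)"
    by (rule QN.Fubini_integral[symmetric])
  also have "\<dots> = char_quad S M Z (insert j F) a"
    unfolding char_quad_def
  proof (rule Bochner_Integration.integral_cong[OF refl])
    fix \<omega>
    have "(CLINT g|std_normal_distribution. ?f g \<omega>)
      = cis (?L \<omega>) * ?E F \<omega> * char std_normal_distribution (Z j \<omega>)"
      unfolding char_def integral_mult_right_zero[symmetric]
      by (rule Bochner_Integration.integral_cong[OF refl])
        (subst cis_mult[symmetric], simp only: cis_conv_exp mult_ac)
    also have "\<dots> = cis (?L \<omega>) * ?E (insert j F) \<omega>"
      using F by (simp add: char_std_normal_distribution mult_exp_exp add.commute flip: of_real_mult)
    finally show "(CLINT g|std_normal_distribution. ?f g \<omega>) = cis (?L \<omega>) * ?E (insert j F) \<omega>" .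
  qed
  finally show ?thesis
    unfolding char_quad_upd[OF S] by simp
qed

end

text \<open>Induction on the set \<open>F\<close> of quadratic factors, with the linear part
  \<open>a\<close> kept arbitrary: adding a factor averages over shifts of one coefficient, and the
  bound 1 allows dominated convergence under that average. The case \<open>F = {}\<close> is the
  hypothesis on characters; the claim is \<open>F = S\<close> with \<open>a = 0\<close>.\<close>

lemma gaussian_randomization:
  fixes U :: "nat \<Rightarrow> 'i \<Rightarrow> 'w \<Rightarrow> real" and V :: "'i \<Rightarrow> 'q \<Rightarrow> real"
  assumes M: "prob_space M" and P: "prob_space P" and S: "finite S"
    and U: "\<And>n i. U n i \<in> borel_measurable M" and V: "\<And>i. V i \<in> borel_measurable P"
    and lin: "\<And>a. (\<lambda>n. CLINT \<omega>|M. cis (\<Sum>i\<in>S. a i * U n i \<omega>))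
                 \<longlonglongrightarrow> (CLINT \<omega>|P. cis (\<Sum>i\<in>S. a i * V i \<omega>))"
  shows "(\<lambda>n. \<integral>\<omega>. exp (- (\<Sum>i\<in>S. (U n i \<omega>)\<^sup>2 / 2)) \<partial>M) \<longlonglongrightarrow> (\<integral>\<omega>. exp (- (\<Sum>i\<in>S. (V i \<omega>)\<^sup>2 / 2)) \<partial>P)"
proof -
  interpret M: prob_space M by fact
  interpret P: prob_space P by fact
  interpret N: real_distribution std_normal_distribution by (rule real_dist_normal_dist)
  have "(\<lambda>n. char_quad S M (U n) F a) \<longlonglongrightarrow> char_quad S P V F a" if "F \<subseteq> S" for F a
    using finite_subset[OF that S] that
  proof (induction F arbitrary: a rule: finite_induct)
    case empty
    then show ?case using lin by (simp add: char_quad_def)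
  next
    case (insert j F)
    then have j: "j \<in> S" and F: "F \<subseteq> S" by auto
    show ?case
      unfolding M.char_quad_insert[OF U S j insert.hyps(1,2)] P.char_quad_insert[OF V S j insert.hyps(1,2)]
    proof (rule integral_dominated_convergence[where w = "\<lambda>_. 1"])
      show "AE g in std_normal_distribution.
          (\<lambda>n. char_quad S M (U n) F (a(j := a j + g))) \<longlonglongrightarrow> char_quad S P V F (a(j := a j + g))"
        using insert.IH[OF F] by simp
      show "(\<lambda>g. char_quad S P V F (a(j := a j + g))) \<in> borel_measurable std_normal_distribution"
        using P.borel_measurable_char_quad_upd[OF V S j] by simp
      show "(\<lambda>g. char_quad S M (U n) F (a(j := a j + g))) \<in> borel_measurable std_normal_distribution" for n
        using M.borel_measurable_char_quad_upd[OF U S j] by simp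
    qed (simp_all add: M.norm_char_quad_le[OF U])
  qed
  from this[of S "\<lambda>_. 0"]
  show ?thesis
    by (simp add: char_quad_def tendsto_of_real_iff del: of_real_exp)
qed

section \<open>Second moments and characteristic functions of real Gaussian variables\<close>

lemma real_gaussian_rv_square_integrable:
  assumes P: "prob_space P" and Z: "real_gaussian_rv P Z"
  shows "integrable P (\<lambda>\<omega>. (Z \<omega>)\<^sup>2)"
proof -
  interpret prob_space P by fact
  have [measurable]: "Z \<in> borel_measurable P" using Z by (simp add: real_gaussian_rv_def)
  consider c where "AE \<omega> in P. Z \<omega> = c"
    | m \<sigma> where "\<sigma> > 0" "distributed P lborel Z (normal_density m \<sigma>)"
    using Z by (auto simp: real_gaussian_rv_def)
  then show ?thesis
  proof cases
    case 1
    then have "integrable P (\<lambda>\<omega>. (Z \<omega>)\<^sup>2) \<longleftrightarrow> integrable P (\<lambda>_. c\<^sup>2)"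
      by (intro integrable_cong_AE) auto
    then show ?thesis by simp
  next
    case 2
    \<comment> \<open>This is \<open>x\<^sup>2\<close> expanded around the mean, because the known
      moments of the normal density are the central ones; the powers 1 and 0 are written out to
      match them.\<close>
    have "integrable lborel (\<lambda>x. normal_density m \<sigma> x * ((x - m)\<^sup>2 + 2 * m * (x - m) ^ 1 + m\<^sup>2 * (x - m) ^ 0))"
      unfolding distrib_left mult.left_commute[of "normal_density m \<sigma> _" "2 * m"] mult.left_commute[of "normal_density m \<sigma> _" "m\<^sup>2"]
      using 2(1) by (intro Bochner_Integration.integrable_add integrable_mult_right integrable_normal_moment)
    then have "integrable lborel (\<lambda>x. normal_density m \<sigma> x * x\<^sup>2)"
      by (simp add: power2_eq_square algebra_simps)
    then show ?thesis
      using distributed_integrable[OF 2(2), of "\<lambda>x. x\<^sup>2"] by simp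
  qed
qed

lemma char_centered_real_gaussian_rv:
  assumes P: "prob_space P" and Z: "real_gaussian_rv P Z" and mean: "(\<integral>\<omega>. Z \<omega> \<partial>P) = 0"
  shows "(CLINT \<omega>|P. cis (Z \<omega>)) = exp (- (\<integral>\<omega>. (Z \<omega>)\<^sup>2 \<partial>P) / 2)"
proof -
  interpret prob_space P by fact
  have [measurable]: "Z \<in> borel_measurable P" using Z by (simp add: real_gaussian_rv_def)
  consider c where "AE \<omega> in P. Z \<omega> = c"
    | m \<sigma> where "\<sigma> > 0" "distributed P lborel Z (normal_density m \<sigma>)"
    using Z by (auto simp: real_gaussian_rv_def)
  then show ?thesis
  proof cases
    case 1
    have "c = (\<integral>\<omega>. Z \<omega> \<partial>P)"
      using 1 by (subst integral_cong_AE[where g = "\<lambda>_. c"]) (auto simp: prob_space)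
    then have Z0: "AE \<omega> in P. Z \<omega> = 0" using 1 mean by simp
    have "(CLINT \<omega>|P. cis (Z \<omega>)) = (CLINT \<omega>|P. 1)"
      using Z0 by (intro integral_cong_AE) auto
    moreover have "(\<integral>\<omega>. (Z \<omega>)\<^sup>2 \<partial>P) = (\<integral>\<omega>. 0 \<partial>P)"
      using Z0 by (intro integral_cong_AE) auto
    ultimately show ?thesis by (simp add: prob_space)
  next
    case 2
    have m0: "m = 0"
      using normal_distributed_expectation[OF 2] mean by simp
    have var: "(\<integral>\<omega>. (Z \<omega>)\<^sup>2 \<partial>P) = \<sigma>\<^sup>2"
      using normal_distributed_variance[OF 2] mean by simp
    have "distributed P lborel (\<lambda>\<omega>. (Z \<omega> - m) / \<sigma>) std_normal_density"
      using normal_standard_normal_convert[OF 2(1)] 2(2) by simp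
    then have "distr P lborel (\<lambda>\<omega>. Z \<omega> / \<sigma>) = std_normal_distribution"
      by (simp add: distributed_def m0)
    then have D: "distr P borel (\<lambda>\<omega>. Z \<omega> / \<sigma>) = std_normal_distribution"
      by (metis distr_cong sets_lborel)
    have "(CLINT \<omega>|P. cis (Z \<omega>)) = (CLINT \<omega>|P. cis (\<sigma> * (Z \<omega> / \<sigma>)))"
      using 2(1) by simp
    also have "\<dots> = (CLINT x|distr P borel (\<lambda>\<omega>. Z \<omega> / \<sigma>). cis (\<sigma> * x))"
      by (rule integral_distr[symmetric]) auto
    also have "\<dots> = char std_normal_distribution \<sigma>"
      unfolding D char_def by (simp add: cis_conv_exp)
    finally show ?thesis by (simp add: char_std_normal_distribution var)
  qed
qed

section \<open>Quadrature of square-integrable fields\<close>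

text \<open>Young's inequality applied to \<open>2 * a * d\<close>. The form is asymmetric on
  purpose: only the size of \<open>z\<close> appears, with a factor that can be made small, while
  \<open>w\<close> enters only through the difference. In the quadrature \<open>w\<close> is the
  field at the approximating point, whose second moment has no integrable bound there.\<close>

lemma abs_cmod_square_diff_le:
  fixes z w :: complex
  assumes "\<delta> > 0"
  shows "\<bar>(cmod z)\<^sup>2 - (cmod w)\<^sup>2\<bar> \<le> (1 + 1 / \<delta>) * (cmod (z - w))\<^sup>2 + \<delta> * (cmod z)\<^sup>2"
proof -
  define a b d where "a = cmod z" and "b = cmod w" and "d = cmod (z - w)"
  have ab: "\<bar>a - b\<bar> \<le> d" "0 \<le> a" "0 \<le> b" "0 \<le> d"
    unfolding a_def b_def d_def by (auto intro: norm_triangle_ineq3)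
  have "\<bar>a\<^sup>2 - b\<^sup>2\<bar> = \<bar>a - b\<bar> * (a + b)"
    using ab by (simp add: power2_eq_square abs_mult[symmetric] square_diff_square_factored abs_mult)
  also have "\<dots> \<le> d * (2 * a + d)"
    using ab by (intro mult_mono) auto
  also have "\<dots> = d\<^sup>2 + 2 * a * d" by (simp add: power2_eq_square algebra_simps)
  also have "2 * a * d \<le> d\<^sup>2 / \<delta> + \<delta> * a\<^sup>2"
  proof -
    have "0 \<le> (d - \<delta> * a)\<^sup>2 / \<delta>" using assms by simp
    also have "\<dots> = d\<^sup>2 / \<delta> + \<delta> * a\<^sup>2 - 2 * a * d"
      using assms by (simp add: power2_eq_square field_simps)
    finally show ?thesis by simp
  qed
  finally show ?thesis unfolding a_def b_def d_def by (simp add: algebra_simps)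
qed

text \<open>Since \<open>enn2real\<close> maps infinity to 0, the danger is that exactly one
  integral is infinite. As the integral of \<open>g\<close> is finite, an infinite integral of
  \<open>f\<close> forces the right-hand side to be infinite too.\<close>

lemma abs_enn2real_nn_integral_diff_le:
  fixes f g :: "'c \<Rightarrow> real"
  assumes [measurable]: "f \<in> borel_measurable m" "g \<in> borel_measurable m"
    and f: "\<And>x. 0 \<le> f x" and g: "\<And>x. 0 \<le> g x"
    and fin: "(\<integral>\<^sup>+x. ennreal (g x) \<partial>m) < \<infinity>"
  shows "ennreal \<bar>enn2real (\<integral>\<^sup>+x. ennreal (f x) \<partial>m) - enn2real (\<integral>\<^sup>+x. ennreal (g x) \<partial>m)\<bar>
    \<le> (\<integral>\<^sup>+x. ennreal \<bar>f x - g x\<bar> \<partial>m)"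
    (is "ennreal \<bar>enn2real ?a - enn2real ?b\<bar> \<le> ?d")
proof (cases "?d = \<infinity>")
  case False
  have "?a \<le> (\<integral>\<^sup>+x. ennreal (g x) + ennreal \<bar>f x - g x\<bar> \<partial>m)"
    using f g by (intro nn_integral_mono) (simp flip: ennreal_plus)
  also have "\<dots> = ?b + ?d" by (rule nn_integral_add) auto
  finally have ab: "?a \<le> ?b + ?d" .
  have "?b \<le> (\<integral>\<^sup>+x. ennreal (f x) + ennreal \<bar>f x - g x\<bar> \<partial>m)"
    using f g by (intro nn_integral_mono) (simp flip: ennreal_plus)
  also have "\<dots> = ?a + ?d" by (rule nn_integral_add) auto
  finally have ba: "?b \<le> ?a + ?d" .
  have b: "?b < top" using fin by simp
  have d: "?d < top" using False by (simp add: top.not_eq_extremum)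
  have "?b + ?d < top" using b d by simp
  with ab have a: "?a < top" by (rule le_less_trans)
  obtain ra where ra: "?a = ennreal ra" "0 \<le> ra" using a by (cases ?a) auto
  obtain rb where rb: "?b = ennreal rb" "0 \<le> rb" using b by (cases ?b) auto
  obtain rd where rd: "?d = ennreal rd" "0 \<le> rd" using d by (cases ?d) auto
  from ab ba show ?thesis
    unfolding ra(1) rb(1) rd(1) using ra(2) rb(2) rd(2)
    by (simp flip: ennreal_plus add: abs_le_iff)
qed (simp add: infinity_ennreal_def)

lemma (in sigma_finite_measure) measurable_nn_integral_complex_square:
  assumes "(\<lambda>(p, \<omega>). F p \<omega>) \<in> borel_measurable (M \<Otimes>\<^sub>M N)"
  shows "(\<lambda>\<omega>. \<integral>\<^sup>+p. ennreal ((cmod (F p \<omega>))\<^sup>2) \<partial>M) \<in> borel_measurable N"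
proof -
  have "(\<lambda>(p, \<omega>). F p \<omega>) \<circ> prod.swap \<in> borel_measurable (N \<Otimes>\<^sub>M M)"
    using assms unfolding comp_def prod.swap_def by (intro measurable_compose[OF _ assms]) simp
  then have [measurable]: "(\<lambda>(\<omega>, p). F p \<omega>) \<in> borel_measurable (N \<Otimes>\<^sub>M M)"
    by (simp add: comp_def split_beta')
  show ?thesis by measurable
qed

lemma quadrature_sum:
  fixes r :: "'c \<Rightarrow> 'd" and f :: "'d \<Rightarrow> real"
  assumes r: "simple_function m r" and C: "C \<in> sets m" "emeasure m C < \<infinity>" and f: "\<And>x. 0 \<le> f x"
  shows "(\<integral>\<^sup>+p. ennreal (indicator C p * f (r p)) \<partial>m) =
    ennreal (\<Sum>q\<in>r ` space m. measure m (r -` {q} \<inter> space m \<inter> C) * f q)"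
proof -
  have fin: "finite (r ` space m)" and sets: "\<And>q. r -` {q} \<inter> space m \<in> sets m"
    using simple_functionD[OF r] by auto
  have "(\<integral>\<^sup>+p. ennreal (indicator C p * f (r p)) \<partial>m) =
    (\<integral>\<^sup>+p. (\<Sum>q\<in>r ` space m. ennreal (f q) * indicator (r -` {q} \<inter> space m \<inter> C) p) \<partial>m)"
  proof (rule nn_integral_cong)
    fix p assume p: "p \<in> space m"
    have "(\<Sum>q\<in>r ` space m. ennreal (f q) * indicator (r -` {q} \<inter> space m \<inter> C) p)
      = (\<Sum>q\<in>r ` space m. if q = r p then ennreal (indicator C p * f (r p)) else 0)"
      using p by (intro sum.cong) (auto split: split_indicator)
    then show "ennreal (indicator C p * f (r p)) =
      (\<Sum>q\<in>r ` space m. ennreal (f q) * indicator (r -` {q} \<inter> space m \<inter> C) p)"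
      using fin p by simp
  qed
  also have "\<dots> = (\<Sum>q\<in>r ` space m. ennreal (f q) * emeasure m (r -` {q} \<inter> space m \<inter> C))"
    using sets C by (subst nn_integral_sum) (auto intro!: sum.cong nn_integral_cmult_indicator)
  also have "\<dots> = (\<Sum>q\<in>r ` space m. ennreal (measure m (r -` {q} \<inter> space m \<inter> C) * f q))"
  proof (intro sum.cong refl)
    fix q
    have "emeasure m (r -` {q} \<inter> space m \<inter> C) \<le> emeasure m C"
      using C by (intro emeasure_mono) auto
    then have "emeasure m (r -` {q} \<inter> space m \<inter> C) = measure m (r -` {q} \<inter> space m \<inter> C)"
      using C by (intro emeasure_eq_ennreal_measure) (auto simp: top_unique)
    then show "ennreal (f q) * emeasure m (r -` {q} \<inter> space m \<inter> C) =
        ennreal (measure m (r -` {q} \<inter> space m \<inter> C) * f q)"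
      using f by (simp add: ennreal_mult mult.commute)
  qed
  also have "\<dots> = ennreal (\<Sum>q\<in>r ` space m. measure m (r -` {q} \<inter> space m \<inter> C) * f q)"
    using f by (intro sum_ennreal) auto
  finally show ?thesis .
qed

text \<open>Replacing the argument by a finitely valued approximation \<open>r\<close> inside \<open>C\<close> costs an amount
  that depends on the field only through its second moments.\<close>

lemma quadrature_error:
  fixes F :: "'c::euclidean_space \<Rightarrow> 'w \<Rightarrow> complex" and r :: "'c \<Rightarrow> 'c"
  assumes m: "sigma_finite_measure m" "sets m = sets borel" and M: "sigma_finite_measure M"
    and F: "(\<lambda>(p, \<omega>). F p \<omega>) \<in> borel_measurable (borel \<Otimes>\<^sub>M M)"
    and r: "simple_function m r" and C: "C \<in> sets m" "emeasure m C < \<infinity>"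
    and k: "k \<in> borel_measurable borel" "\<And>p. (\<integral>\<^sup>+\<omega>. ennreal ((cmod (F p \<omega>))\<^sup>2) \<partial>M) \<le> k p"
    and D: "(\<lambda>p. D p (r p)) \<in> borel_measurable borel" "\<And>p q. (\<integral>\<^sup>+\<omega>. ennreal ((cmod (F p \<omega> - F q \<omega>))\<^sup>2) \<partial>M) \<le> D p q"
    and \<delta>: "\<delta> > 0"
  shows "(\<integral>\<^sup>+\<omega>. ennreal \<bar>enn2real (\<integral>\<^sup>+p. ennreal ((cmod (F p \<omega>))\<^sup>2) \<partial>m)
        - (\<Sum>q\<in>r ` space m. measure m (r -` {q} \<inter> space m \<inter> C) * (cmod (F q \<omega>))\<^sup>2)\<bar> \<partial>M)
    \<le> (\<integral>\<^sup>+p. indicator (- C) p * k p \<partial>m) + ennreal (1 + 1 / \<delta>) * (\<integral>\<^sup>+p. indicator C p * D p (r p) \<partial>m)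
      + ennreal \<delta> * (\<integral>\<^sup>+p. k p \<partial>m)"
proof -
  interpret m: sigma_finite_measure m by fact
  interpret M: sigma_finite_measure M by fact
  interpret mM: pair_sigma_finite m M ..
  note [measurable_cong] = m(2)
  note [measurable] = F C(1) k(1) D(1)
  have r_meas [measurable]: "r \<in> borel \<rightarrow>\<^sub>M borel"
    using borel_measurable_simple_function[OF r] m(2) by (simp cong: measurable_cong_sets)
  have Fr [measurable]: "(\<lambda>(p, \<omega>). F (r p) \<omega>) \<in> borel_measurable (borel \<Otimes>\<^sub>M M)"
    using measurable_compose[OF _ F, of "\<lambda>(p, \<omega>). (r p, \<omega>)" "borel \<Otimes>\<^sub>M M"]
    by (simp add: split_beta')
  have sp: "space m = UNIV" using sets_eq_imp_space_eq[OF m(2)] by simp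
  have Fp [measurable]: "F p \<in> borel_measurable M" for p
    using measurable_Pair2[OF F, of p] by simp
  have Fw [measurable]: "(\<lambda>p. F p \<omega>) \<in> borel_measurable borel" if "\<omega> \<in> space M" for \<omega>
    using measurable_Pair1[OF F that] by simp
  let ?h = "\<lambda>p \<omega>. ennreal \<bar>(cmod (F p \<omega>))\<^sup>2 - indicator C p * (cmod (F (r p) \<omega>))\<^sup>2\<bar>"
  have "(\<integral>\<^sup>+\<omega>. ennreal \<bar>enn2real (\<integral>\<^sup>+p. ennreal ((cmod (F p \<omega>))\<^sup>2) \<partial>m)
        - (\<Sum>q\<in>r ` space m. measure m (r -` {q} \<inter> space m \<inter> C) * (cmod (F q \<omega>))\<^sup>2)\<bar> \<partial>M)
    \<le> (\<integral>\<^sup>+\<omega>. \<integral>\<^sup>+p. ?h p \<omega> \<partial>m \<partial>M)"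
  proof (rule nn_integral_mono)
    fix \<omega> assume \<omega>: "\<omega> \<in> space M"
    note [measurable] = Fw[OF \<omega>]
    \<comment> \<open>The quadrature is itself an integral, of a field that vanishes outside
      \<open>C\<close>, and it is always finite. Hence the comparison of integrals applies at every
      \<open>\<omega>\<close>, even where the integral of the field itself diverges.\<close>
    note qs = quadrature_sum[OF r C, of "\<lambda>q. (cmod (F q \<omega>))\<^sup>2"]
    show "ennreal \<bar>enn2real (\<integral>\<^sup>+p. ennreal ((cmod (F p \<omega>))\<^sup>2) \<partial>m)
        - (\<Sum>q\<in>r ` space m. measure m (r -` {q} \<inter> space m \<inter> C) * (cmod (F q \<omega>))\<^sup>2)\<bar> \<le> (\<integral>\<^sup>+p. ?h p \<omega> \<partial>m)"
      using abs_enn2real_nn_integral_diff_le[of "\<lambda>p. (cmod (F p \<omega>))\<^sup>2" m "\<lambda>p. indicator C p * (cmod (F (r p) \<omega>))\<^sup>2"]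
      by (simp add: qs sum_nonneg)
  qed
  also have "\<dots> = (\<integral>\<^sup>+p. \<integral>\<^sup>+\<omega>. ?h p \<omega> \<partial>M \<partial>m)"
    by (rule mM.Fubini') measurable
  also have "\<dots> \<le> (\<integral>\<^sup>+p. indicator (- C) p * k p + (ennreal (1 + 1 / \<delta>) * (indicator C p * D p (r p)) + ennreal \<delta> * k p) \<partial>m)"
  proof (rule nn_integral_mono)
    fix p
    show "(\<integral>\<^sup>+\<omega>. ?h p \<omega> \<partial>M) \<le> indicator (- C) p * k p + (ennreal (1 + 1 / \<delta>) * (indicator C p * D p (r p)) + ennreal \<delta> * k p)"
    \<comment> \<open>Outside \<open>C\<close> the quadrature contributes nothing and the whole
      second moment is lost; inside, the loss is split into an increment and a small multiple of the
      second moment.\<close>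
    proof (cases "p \<in> C")
      case True
      have "(\<integral>\<^sup>+\<omega>. ?h p \<omega> \<partial>M) \<le> (\<integral>\<^sup>+\<omega>. ennreal (1 + 1 / \<delta>) * ennreal ((cmod (F p \<omega> - F (r p) \<omega>))\<^sup>2)
          + ennreal \<delta> * ennreal ((cmod (F p \<omega>))\<^sup>2) \<partial>M)"
        using True abs_cmod_square_diff_le[OF \<delta>] \<delta>
        by (intro nn_integral_mono) (simp flip: ennreal_mult ennreal_plus)
      also have "\<dots> = ennreal (1 + 1 / \<delta>) * (\<integral>\<^sup>+\<omega>. ennreal ((cmod (F p \<omega> - F (r p) \<omega>))\<^sup>2) \<partial>M)
          + ennreal \<delta> * (\<integral>\<^sup>+\<omega>. ennreal ((cmod (F p \<omega>))\<^sup>2) \<partial>M)"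
        by (subst nn_integral_add) (auto simp: nn_integral_cmult)
      also have "\<dots> \<le> ennreal (1 + 1 / \<delta>) * D p (r p) + ennreal \<delta> * k p"
        by (intro add_mono mult_left_mono k D) auto
      finally show ?thesis using True by simp
    next
      case False
      then show ?thesis using k(2)[of p] by (simp add: add_increasing2)
    qed
  qed
  also have "\<dots> = (\<integral>\<^sup>+p. indicator (- C) p * k p \<partial>m) + ennreal (1 + 1 / \<delta>) * (\<integral>\<^sup>+p. indicator C p * D p (r p) \<partial>m)
      + ennreal \<delta> * (\<integral>\<^sup>+p. k p \<partial>m)"
    by (subst nn_integral_add, measurable, subst nn_integral_add, measurable)
      (simp add: nn_integral_cmult add.assoc)
  finally show ?thesis .
qed

section \<open>From closeness in mean to closeness of Laplace transforms\<close>

lemma integral_exp_minus_diff_le: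
  fixes A B :: "'w \<Rightarrow> real"
  assumes "prob_space M" and [measurable]: "A \<in> borel_measurable M" "B \<in> borel_measurable M"
    and A: "\<And>\<omega>. 0 \<le> A \<omega>" and B: "\<And>\<omega>. 0 \<le> B \<omega>"
    and AB: "(\<integral>\<^sup>+\<omega>. ennreal \<bar>A \<omega> - B \<omega>\<bar> \<partial>M) \<le> ennreal e" and "0 \<le> e" "0 \<le> \<theta>"
  shows "\<bar>(\<integral>\<omega>. exp (- \<theta> * A \<omega>) \<partial>M) - (\<integral>\<omega>. exp (- \<theta> * B \<omega>) \<partial>M)\<bar> \<le> \<theta> * e"
proof -
  interpret prob_space M by fact
  have Lip: "\<bar>exp (- \<theta> * a) - exp (- \<theta> * b)\<bar> \<le> \<theta> * \<bar>a - b\<bar>" if "0 \<le> a" "0 \<le> b" for a b :: real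
  proof -
    have *: "exp (- \<theta> * a) - exp (- \<theta> * b) \<le> \<theta> * (b - a)" if "0 \<le> a" "a \<le> b" for a b :: real
    proof -
      have "exp (- \<theta> * a) - exp (- \<theta> * b) = exp (- \<theta> * a) * (1 - exp (- (\<theta> * (b - a))))"
        by (simp add: algebra_simps exp_diff exp_minus divide_inverse)
      also have "\<dots> \<le> 1 * (\<theta> * (b - a))"
        using that \<open>0 \<le> \<theta>\<close> exp_ge_add_one_self[of "- (\<theta> * (b - a))"]
        by (intro mult_mono) auto
      finally show ?thesis by simp
    qed
    have mono: "exp (- \<theta> * b) \<le> exp (- \<theta> * a)" if "a \<le> b" for a b :: real
      using that \<open>0 \<le> \<theta>\<close> by (simp add: mult_left_mono)
    show ?thesis
      using *[of a b] *[of b a] mono[of a b] mono[of b a] that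
      by (cases "a \<le> b") (simp_all add: abs_if)
  qed
  have int: "integrable M (\<lambda>\<omega>. exp (- \<theta> * A \<omega>))" "integrable M (\<lambda>\<omega>. exp (- \<theta> * B \<omega>))"
    using A B \<open>0 \<le> \<theta>\<close> by (auto intro!: integrable_const_bound[of _ 1])
  have fin: "(\<integral>\<^sup>+\<omega>. ennreal \<bar>A \<omega> - B \<omega>\<bar> \<partial>M) < \<infinity>"
    using AB by (rule le_less_trans) simp
  have intAB: "integrable M (\<lambda>\<omega>. \<bar>A \<omega> - B \<omega>\<bar>)"
    using fin by (intro integrableI_bounded) auto
  have "\<bar>(\<integral>\<omega>. exp (- \<theta> * A \<omega>) \<partial>M) - (\<integral>\<omega>. exp (- \<theta> * B \<omega>) \<partial>M)\<bar>
    \<le> (\<integral>\<omega>. \<bar>exp (- \<theta> * A \<omega>) - exp (- \<theta> * B \<omega>)\<bar> \<partial>M)"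
    using int integral_abs_bound[of M "\<lambda>\<omega>. exp (- \<theta> * A \<omega>) - exp (- \<theta> * B \<omega>)"] by simp
  also have "\<dots> \<le> (\<integral>\<omega>. \<theta> * \<bar>A \<omega> - B \<omega>\<bar> \<partial>M)"
    using int intAB Lip[OF A B] by (intro integral_mono) auto
  also have "\<dots> = \<theta> * (\<integral>\<omega>. \<bar>A \<omega> - B \<omega>\<bar> \<partial>M)" by simp
  also have "(\<integral>\<omega>. \<bar>A \<omega> - B \<omega>\<bar> \<partial>M) \<le> e"
  proof -
    have "ennreal (\<integral>\<omega>. \<bar>A \<omega> - B \<omega>\<bar> \<partial>M) = (\<integral>\<^sup>+\<omega>. ennreal \<bar>A \<omega> - B \<omega>\<bar> \<partial>M)"
      using intAB by (intro nn_integral_eq_integral[symmetric]) auto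
    from ord_eq_le_trans[OF this AB] show ?thesis using \<open>0 \<le> e\<close> by (simp add: ennreal_le_iff)
  qed
  finally show ?thesis using \<open>0 \<le> \<theta>\<close> by (simp add: mult_left_mono)
qed

text \<open>Finite quadratures approximate the integral uniformly over all fields with the given second
  moments, so no path regularity and no functional limit theorem is needed.\<close>

lemma field_laplace_convergence:
  fixes W :: "nat \<Rightarrow> 'c::euclidean_space \<Rightarrow> 'w \<Rightarrow> complex" and G :: "'c \<Rightarrow> 'q \<Rightarrow> complex"
    and D :: "'c \<Rightarrow> 'c \<Rightarrow> real"
  assumes m: "sigma_finite_measure m" "sets m = sets borel" and M: "prob_space M" and P: "prob_space P"
    and W: "\<And>n. (\<lambda>(p, \<omega>). W n p \<omega>) \<in> borel_measurable (borel \<Otimes>\<^sub>M M)"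
    and G: "(\<lambda>(p, \<omega>). G p \<omega>) \<in> borel_measurable (borel \<Otimes>\<^sub>M P)"
    and k: "k \<in> borel_measurable borel" "(\<integral>\<^sup>+p. k p \<partial>m) < \<infinity>"
    and D: "continuous_on UNIV (\<lambda>(p, q). D p q)" "\<And>p. D p p = 0" "\<And>p q. D p q \<le> B"
    and Wk: "\<And>n p. (\<integral>\<^sup>+\<omega>. ennreal ((cmod (W n p \<omega>))\<^sup>2) \<partial>M) \<le> k p"
    and Gk: "\<And>p. (\<integral>\<^sup>+\<omega>. ennreal ((cmod (G p \<omega>))\<^sup>2) \<partial>P) \<le> k p"
    and WD: "\<And>n p q. (\<integral>\<^sup>+\<omega>. ennreal ((cmod (W n p \<omega> - W n q \<omega>))\<^sup>2) \<partial>M) \<le> ennreal (D p q)"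
    and GD: "\<And>p q. (\<integral>\<^sup>+\<omega>. ennreal ((cmod (G p \<omega> - G q \<omega>))\<^sup>2) \<partial>P) \<le> ennreal (D p q)"
    and fidi: "\<And>S c. finite S \<Longrightarrow> (\<And>p. 0 \<le> c p) \<Longrightarrow>
        (\<lambda>n. \<integral>\<omega>. exp (- (\<Sum>p\<in>S. c p * (cmod (W n p \<omega>))\<^sup>2)) \<partial>M) \<longlonglongrightarrow>
        (\<integral>\<omega>. exp (- (\<Sum>p\<in>S. c p * (cmod (G p \<omega>))\<^sup>2)) \<partial>P)"
    and \<theta>: "0 \<le> \<theta>"
  shows "(\<lambda>n. \<integral>\<omega>. exp (- \<theta> * enn2real (\<integral>\<^sup>+p. ennreal ((cmod (W n p \<omega>))\<^sup>2) \<partial>m)) \<partial>M) \<longlonglongrightarrow>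
    (\<integral>\<omega>. exp (- \<theta> * enn2real (\<integral>\<^sup>+p. ennreal ((cmod (G p \<omega>))\<^sup>2) \<partial>m)) \<partial>P)"
proof -
  interpret m: sigma_finite_measure m by fact
  interpret M: prob_space M by fact
  interpret P: prob_space P by fact
  note [measurable_cong] = m(2)
  note [measurable] = k(1)
  have sp: "space m = UNIV" using sets_eq_imp_space_eq[OF m(2)] by simp
  have D_meas: "(\<lambda>p. D (f p) (g p)) \<in> borel_measurable borel"
    if "f \<in> borel \<rightarrow>\<^sub>M borel" "g \<in> borel \<rightarrow>\<^sub>M borel" for f g :: "'c \<Rightarrow> 'c"
  proof -
    have "(\<lambda>(p, q). D p q) \<in> borel_measurable (borel \<Otimes>\<^sub>M borel)"
      using borel_measurable_continuous_onI[OF D(1)] by (simp add: borel_prod)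
    from measurable_compose[OF measurable_Pair[OF that] this] show ?thesis by simp
  qed
  \<comment> \<open>One pair of nodes and weights has to serve all \<open>n\<close> and the limit at
    once; otherwise the convergence at finitely many points could not be used after the error has
    been fixed.\<close>
  define good where "good e S c \<longleftrightarrow> finite S \<and> (\<forall>p. 0 \<le> c p) \<and>
      (\<forall>n. (\<integral>\<^sup>+\<omega>. ennreal \<bar>enn2real (\<integral>\<^sup>+p. ennreal ((cmod (W n p \<omega>))\<^sup>2) \<partial>m)
        - (\<Sum>p\<in>S. c p * (cmod (W n p \<omega>))\<^sup>2)\<bar> \<partial>M) \<le> ennreal e) \<and>
      (\<integral>\<^sup>+\<omega>. ennreal \<bar>enn2real (\<integral>\<^sup>+p. ennreal ((cmod (G p \<omega>))\<^sup>2) \<partial>m)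
        - (\<Sum>p\<in>S. c p * (cmod (G p \<omega>))\<^sup>2)\<bar> \<partial>P) \<le> ennreal e" for e S c
  have quadrature: "\<exists>S c. good e S c" if e: "0 < e" for e
  proof -
    obtain A where A: "range A \<subseteq> sets m" "(\<Union>i. A i) = space m" "\<And>i. emeasure m (A i) \<noteq> \<infinity>" "incseq A"
      using m.sigma_finite_incseq by metis
    have [measurable]: "A i \<in> sets borel" for i using A(1) m(2) by auto
    have "(\<lambda>i. \<integral>\<^sup>+p. indicator (- A i) p * k p \<partial>m) \<longlonglongrightarrow> (\<integral>\<^sup>+p. 0 \<partial>m)"
    proof (rule nn_integral_dominated_convergence[where w = k])
      show "AE p in m. (\<lambda>i. indicator (- A i) p * k p) \<longlonglongrightarrow> 0"
      proof (rule AE_I2)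
        fix p assume "p \<in> space m"
        then obtain i0 where "p \<in> A i0" using A(2) by auto
        then have "p \<in> A i" if "i \<ge> i0" for i using incseqD[OF A(4) that] by auto
        then show "(\<lambda>i. indicator (- A i) p * k p) \<longlonglongrightarrow> 0"
          by (intro tendsto_eventually) (auto simp: eventually_sequentially intro!: exI[of _ i0])
      qed
    qed (use k(2) in \<open>auto split: split_indicator\<close>)
    then have "\<forall>\<^sub>F i in sequentially. (\<integral>\<^sup>+p. indicator (- A i) p * k p \<partial>m) < ennreal (e / 3)"
      using e by (intro order_tendstoD(2)[where y = 0]) auto
    then obtain i where i: "(\<integral>\<^sup>+p. indicator (- A i) p * k p \<partial>m) < ennreal (e / 3)"
      by (auto simp: eventually_sequentially)
    define C where "C = A i"
    have C: "C \<in> sets m" "emeasure m C < \<infinity>" and Cb [measurable]: "C \<in> sets borel"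
      using A(1) A(3)[of i] m(2) by (auto simp: C_def less_top)
    define K where "K = enn2real (\<integral>\<^sup>+p. k p \<partial>m)"
    have K: "(\<integral>\<^sup>+p. k p \<partial>m) = ennreal K" "0 \<le> K" using k(2) by (auto simp: K_def)
    \<comment> \<open>The increment error carries the factor \<open>1 + 1 / \<delta>\<close>, so
      \<open>\<delta>\<close> is fixed before the approximation \<open>r\<close>, and against the
      total mass \<open>K\<close> of the second moments. Using \<open>K + 1\<close> keeps the
      denominator positive.\<close>
    define \<delta> where "\<delta> = e / (3 * (K + 1))"
    have \<delta>: "\<delta> > 0" using e K by (simp add: \<delta>_def)
    have \<delta>K: "ennreal \<delta> * (\<integral>\<^sup>+p. k p \<partial>m) \<le> ennreal (e / 3)"
    proof -
      have "\<delta> * K \<le> \<delta> * (K + 1)" using \<delta> by simp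
      also have "\<dots> = e / 3" using K(2) by (simp add: \<delta>_def field_simps)
      finally have "ennreal (\<delta> * K) \<le> ennreal (e / 3)" by (rule ennreal_leI)
      then show ?thesis using K \<delta> by (simp add: ennreal_mult)
    qed
    \<comment> \<open>Simple functions approximating the identity provide the nodes:
      \<open>D p (R j p)\<close> tends to \<open>D p p = 0\<close> by continuity, and the constant
      \<open>B\<close> dominates because \<open>C\<close> has finite measure.\<close>
    have "id \<in> borel_measurable m" unfolding id_def by measurable
    then obtain R where R: "\<And>i. simple_function m (R i)" "\<And>p. p \<in> space m \<Longrightarrow> (\<lambda>i. R i p) \<longlonglongrightarrow> id p"
      using borel_measurable_implies_sequence_metric[of id m 0] by metis
    have R_meas: "R j \<in> borel \<rightarrow>\<^sub>M borel" for j
      using borel_measurable_simple_function[OF R(1)] m(2) by (simp cong: measurable_cong_sets)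
    note [measurable] = D_meas[OF measurable_ident R_meas, simplified]
    have "(\<lambda>j. \<integral>\<^sup>+p. indicator C p * ennreal (D p (R j p)) \<partial>m) \<longlonglongrightarrow> (\<integral>\<^sup>+p. 0 \<partial>m)"
    proof (rule nn_integral_dominated_convergence[where w = "\<lambda>p. ennreal B * indicator C p"])
      show "AE p in m. (\<lambda>j. indicator C p * ennreal (D p (R j p))) \<longlonglongrightarrow> 0"
      proof (rule AE_I2)
        fix p
        have "(\<lambda>j. (p, R j p)) \<longlonglongrightarrow> (p, p)"
          using R(2)[of p] by (intro tendsto_Pair) (auto simp: sp)
        then have "(\<lambda>j. (\<lambda>(p, q). D p q) (p, R j p)) \<longlonglongrightarrow> (\<lambda>(p, q). D p q) (p, p)"
          by (rule continuous_on_tendsto_compose[OF D(1)]) auto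
        then have "(\<lambda>j. ennreal (D p (R j p))) \<longlonglongrightarrow> ennreal 0"
          by (intro tendsto_ennrealI) (simp add: D(2))
        then show "(\<lambda>j. indicator C p * ennreal (D p (R j p))) \<longlonglongrightarrow> 0"
          by (cases "p \<in> C") auto
      qed
      show "(\<integral>\<^sup>+p. ennreal B * indicator C p \<partial>m) < \<infinity>"
        using C by (simp add: nn_integral_cmult ennreal_mult_less_top)
    qed (auto split: split_indicator intro: D(3) ennreal_leI)
    then have "\<forall>\<^sub>F j in sequentially. (\<integral>\<^sup>+p. indicator C p * ennreal (D p (R j p)) \<partial>m) < ennreal (e / 3 / (1 + 1 / \<delta>))"
      using e \<delta> by (intro order_tendstoD(2)[where y = 0]) (auto simp: add_pos_pos)
    then obtain j where j: "(\<integral>\<^sup>+p. indicator C p * ennreal (D p (R j p)) \<partial>m) < ennreal (e / 3 / (1 + 1 / \<delta>))"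
      by (auto simp: eventually_sequentially)
    define r where "r = R j"
    have pos: "0 < 1 + 1 / \<delta>" using \<delta> by (simp add: add_pos_pos)
    have "ennreal (1 + 1 / \<delta>) * (\<integral>\<^sup>+p. indicator C p * ennreal (D p (r p)) \<partial>m)
      \<le> ennreal (1 + 1 / \<delta>) * ennreal (e / 3 / (1 + 1 / \<delta>))"
      using j unfolding r_def by (intro mult_left_mono) auto
    also have "\<dots> = ennreal ((1 + 1 / \<delta>) * (e / 3 / (1 + 1 / \<delta>)))"
      using pos e by (intro ennreal_mult[symmetric]) auto
    also have "(1 + 1 / \<delta>) * (e / 3 / (1 + 1 / \<delta>)) = e / 3"
      using pos by (subst times_divide_eq_right, subst nonzero_mult_div_cancel_left) auto
    finally have err2: "ennreal (1 + 1 / \<delta>) * (\<integral>\<^sup>+p. indicator C p * ennreal (D p (r p)) \<partial>m) \<le> ennreal (e / 3)" .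
    have total: "(\<integral>\<^sup>+p. indicator (- C) p * k p \<partial>m)
        + ennreal (1 + 1 / \<delta>) * (\<integral>\<^sup>+p. indicator C p * ennreal (D p (r p)) \<partial>m)
        + ennreal \<delta> * (\<integral>\<^sup>+p. k p \<partial>m) \<le> ennreal e"
    proof -
      have "(\<integral>\<^sup>+p. indicator (- C) p * k p \<partial>m)
        + ennreal (1 + 1 / \<delta>) * (\<integral>\<^sup>+p. indicator C p * ennreal (D p (r p)) \<partial>m)
        + ennreal \<delta> * (\<integral>\<^sup>+p. k p \<partial>m) \<le> ennreal (e / 3) + ennreal (e / 3) + ennreal (e / 3)"
        using i err2 \<delta>K unfolding C_def by (intro add_mono) auto
      also have "\<dots> = ennreal e" using e by (simp flip: ennreal_plus)
      finally show ?thesis .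
    qed
    have Dr: "(\<lambda>p. ennreal (D p (r p))) \<in> borel_measurable borel" unfolding r_def by measurable
    have r: "simple_function m r" unfolding r_def by (rule R(1))
    show ?thesis
      unfolding good_def
    proof (intro exI conjI allI)
      show "finite (r ` space m)" using simple_functionD(1)[OF r] .
      show "0 \<le> measure m (r -` {p} \<inter> space m \<inter> C)" for p by simp
      show "(\<integral>\<^sup>+\<omega>. ennreal \<bar>enn2real (\<integral>\<^sup>+p. ennreal ((cmod (W n p \<omega>))\<^sup>2) \<partial>m)
        - (\<Sum>q\<in>r ` space m. measure m (r -` {q} \<inter> space m \<inter> C) * (cmod (W n q \<omega>))\<^sup>2)\<bar> \<partial>M) \<le> ennreal e" for n
        by (rule order_trans[OF quadrature_error[where k = k and D = "\<lambda>p q. ennreal (D p q)" and \<delta> = \<delta>] total])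
          (use m M.sigma_finite_measure_axioms W r C k(1) Wk Dr WD \<delta> in auto)
      show "(\<integral>\<^sup>+\<omega>. ennreal \<bar>enn2real (\<integral>\<^sup>+p. ennreal ((cmod (G p \<omega>))\<^sup>2) \<partial>m)
        - (\<Sum>q\<in>r ` space m. measure m (r -` {q} \<inter> space m \<inter> C) * (cmod (G q \<omega>))\<^sup>2)\<bar> \<partial>P) \<le> ennreal e"
        by (rule order_trans[OF quadrature_error[where k = k and D = "\<lambda>p q. ennreal (D p q)" and \<delta> = \<delta>] total])
          (use m P.sigma_finite_measure_axioms G r C k(1) Gk Dr GD \<delta> in auto)
    qed
  qed
  have W_meas [measurable]: "(\<lambda>\<omega>. \<integral>\<^sup>+p. ennreal ((cmod (W n p \<omega>))\<^sup>2) \<partial>m) \<in> borel_measurable M" for n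
    using W by (intro m.measurable_nn_integral_complex_square) (simp add: m(2) cong: measurable_cong_sets)
  have G_meas [measurable]: "(\<lambda>\<omega>. \<integral>\<^sup>+p. ennreal ((cmod (G p \<omega>))\<^sup>2) \<partial>m) \<in> borel_measurable P"
    using G by (intro m.measurable_nn_integral_complex_square) (simp add: m(2) cong: measurable_cong_sets)
  have [measurable]: "W n p \<in> borel_measurable M" "G p \<in> borel_measurable P" for n p
    using measurable_Pair2[OF W, of p] measurable_Pair2[OF G, of p] by simp_all
  show ?thesis
  proof (rule LIMSEQ_I)
    fix e :: real assume e: "0 < e"
    \<comment> \<open>The added 1 makes \<open>\<theta> * e' < e / 3\<close> strict and covers
      \<open>\<theta> = 0\<close>.\<close>
    define e' where "e' = e / (3 * (\<theta> + 1))"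
    have e': "0 < e'" "\<theta> * e' < e / 3"
      using e \<theta> by (auto simp: e'_def field_simps)
    obtain S c where Sc: "good e' S c"
      using quadrature[OF e'(1)] by blast
    have S: "finite S" and c: "\<And>p. 0 \<le> c p"
      and Wq: "\<And>n. (\<integral>\<^sup>+\<omega>. ennreal \<bar>enn2real (\<integral>\<^sup>+p. ennreal ((cmod (W n p \<omega>))\<^sup>2) \<partial>m)
        - (\<Sum>p\<in>S. c p * (cmod (W n p \<omega>))\<^sup>2)\<bar> \<partial>M) \<le> ennreal e'"
      and Gq: "(\<integral>\<^sup>+\<omega>. ennreal \<bar>enn2real (\<integral>\<^sup>+p. ennreal ((cmod (G p \<omega>))\<^sup>2) \<partial>m)
        - (\<Sum>p\<in>S. c p * (cmod (G p \<omega>))\<^sup>2)\<bar> \<partial>P) \<le> ennreal e'"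
      using Sc unfolding good_def by simp_all
    have "(\<lambda>n. \<integral>\<omega>. exp (- \<theta> * (\<Sum>p\<in>S. c p * (cmod (W n p \<omega>))\<^sup>2)) \<partial>M) \<longlonglongrightarrow>
        (\<integral>\<omega>. exp (- \<theta> * (\<Sum>p\<in>S. c p * (cmod (G p \<omega>))\<^sup>2)) \<partial>P)"
      using fidi[OF S, of "\<lambda>p. \<theta> * c p"] c \<theta> by (simp add: sum_distrib_left mult.assoc sum_negf)
    from LIMSEQ_D[OF this, of "e / 3"] e obtain n0 where n0: "\<And>n. n \<ge> n0 \<Longrightarrow>
        \<bar>(\<integral>\<omega>. exp (- \<theta> * (\<Sum>p\<in>S. c p * (cmod (W n p \<omega>))\<^sup>2)) \<partial>M)
        - (\<integral>\<omega>. exp (- \<theta> * (\<Sum>p\<in>S. c p * (cmod (G p \<omega>))\<^sup>2)) \<partial>P)\<bar> < e / 3"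
      by auto
    have nearW: "\<bar>(\<integral>\<omega>. exp (- \<theta> * enn2real (\<integral>\<^sup>+p. ennreal ((cmod (W n p \<omega>))\<^sup>2) \<partial>m)) \<partial>M)
        - (\<integral>\<omega>. exp (- \<theta> * (\<Sum>p\<in>S. c p * (cmod (W n p \<omega>))\<^sup>2)) \<partial>M)\<bar> \<le> \<theta> * e'" for n
      using Wq e' \<theta> c by (intro integral_exp_minus_diff_le[OF M]) (auto intro!: sum_nonneg)
    have nearG: "\<bar>(\<integral>\<omega>. exp (- \<theta> * enn2real (\<integral>\<^sup>+p. ennreal ((cmod (G p \<omega>))\<^sup>2) \<partial>m)) \<partial>P)
        - (\<integral>\<omega>. exp (- \<theta> * (\<Sum>p\<in>S. c p * (cmod (G p \<omega>))\<^sup>2)) \<partial>P)\<bar> \<le> \<theta> * e'"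
      using Gq e' \<theta> c by (intro integral_exp_minus_diff_le[OF P]) (auto intro!: sum_nonneg)
    show "\<exists>n0. \<forall>n\<ge>n0. norm ((\<integral>\<omega>. exp (- \<theta> * enn2real (\<integral>\<^sup>+p. ennreal ((cmod (W n p \<omega>))\<^sup>2) \<partial>m)) \<partial>M)
        - (\<integral>\<omega>. exp (- \<theta> * enn2real (\<integral>\<^sup>+p. ennreal ((cmod (G p \<omega>))\<^sup>2) \<partial>m)) \<partial>P)) < e"
    proof (intro exI[of _ n0] allI impI)
      fix n assume "n \<ge> n0"
      from n0[OF this] nearW[of n] nearG e'(2)
      show "norm ((\<integral>\<omega>. exp (- \<theta> * enn2real (\<integral>\<^sup>+p. ennreal ((cmod (W n p \<omega>))\<^sup>2) \<partial>m)) \<partial>M)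
        - (\<integral>\<omega>. exp (- \<theta> * enn2real (\<integral>\<^sup>+p. ennreal ((cmod (G p \<omega>))\<^sup>2) \<partial>m)) \<partial>P)) < e"
        unfolding real_norm_def by linarith
    qed
  qed
qed

section \<open>Hermitian fields and i.i.d. pairs\<close>

lemma integrable_mult_cnj:
  fixes f g :: "'z \<Rightarrow> complex"
  assumes [measurable]: "f \<in> borel_measurable Q" "g \<in> borel_measurable Q"
    and "integrable Q (\<lambda>z. (cmod (f z))\<^sup>2)" "integrable Q (\<lambda>z. (cmod (g z))\<^sup>2)"
  shows "integrable Q (\<lambda>z. f z * cnj (g z))"
proof (rule Bochner_Integration.integrable_bound)
  show "integrable Q (\<lambda>z. (cmod (f z))\<^sup>2 + (cmod (g z))\<^sup>2)"
    using assms by simp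
  have "cmod (f z) * cmod (g z) \<le> (cmod (f z))\<^sup>2 + (cmod (g z))\<^sup>2" for z
    using sum_squares_bound[of "cmod (f z)" "cmod (g z)"]
      mult_nonneg_nonneg[OF norm_ge_zero[of "f z"] norm_ge_zero[of "g z"]] by linarith
  then show "AE z in Q. norm (f z * cnj (g z)) \<le> norm ((cmod (f z))\<^sup>2 + (cmod (g z))\<^sup>2)"
    by (simp add: norm_mult)
  show "(\<lambda>z. f z * cnj (g z)) \<in> borel_measurable Q"
    by (intro borel_measurable_times borel_measurable_continuous_on[of cnj])
      (auto intro: continuous_intros)
qed

text \<open>Centred Hermitian fields: the covariance alone determines the second moments of all real linear
  combinations, because \<open>E[F p * F q] = E[F p * cnj (F (- q))]\<close>.\<close>

locale hermitian_field =
  fixes Q :: "'z measure" and F :: "'p::group_add \<Rightarrow> 'z \<Rightarrow> complex" and K :: "'p \<Rightarrow> 'p \<Rightarrow> complex"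
  assumes F_meas [measurable]: "\<And>p. F p \<in> borel_measurable Q"
    and F_sq: "\<And>p. integrable Q (\<lambda>z. (cmod (F p z))\<^sup>2)"
    and F_cov: "\<And>p q. (CLINT z|Q. F p z * cnj (F q z)) = K p q"
    and F_herm: "\<And>p. AE z in Q. F (- p) z = cnj (F p z)"
begin

lemma F_cov_integrable: "integrable Q (\<lambda>z. F p z * cnj (F q z))"
  by (intro integrable_mult_cnj F_sq) auto

lemma F_pseudo_cov:
  shows "integrable Q (\<lambda>z. F p z * F q z)" "(CLINT z|Q. F p z * F q z) = K p (- q)"
proof -
  have eq: "AE z in Q. F p z * cnj (F (- q) z) = F p z * F q z"
    using F_herm[of q] by eventually_elim simp
  have m: "(\<lambda>z. F p z * cnj (F (- q) z)) \<in> borel_measurable Q"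
    by (rule borel_measurable_integrable[OF F_cov_integrable])
  show "integrable Q (\<lambda>z. F p z * F q z)"
    using F_cov_integrable[of p "- q"] by (rule integrable_cong_AE_imp) (use eq in auto)
  show "(CLINT z|Q. F p z * F q z) = K p (- q)"
    unfolding F_cov[symmetric] using eq m by (intro integral_cong_AE) auto
qed

lemma second_moment:
  shows "(\<integral>z. (cmod (F p z))\<^sup>2 \<partial>Q) = Re (K p p)"
proof -
  have "complex_of_real (\<integral>z. (cmod (F p z))\<^sup>2 \<partial>Q) = (CLINT z|Q. F p z * cnj (F p z))"
    by (simp add: complex_norm_square[symmetric] flip: integral_complex_of_real)
  then show ?thesis using F_cov[of p p] by (metis Re_complex_of_real)
qed

lemma increment:
  shows "integrable Q (\<lambda>z. (cmod (F p z - F q z))\<^sup>2)"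
    and "(\<integral>z. (cmod (F p z - F q z))\<^sup>2 \<partial>Q) = Re (K p p - K p q - K q p + K q q)"
proof -
  have eq: "complex_of_real ((cmod (F p z - F q z))\<^sup>2) =
      F p z * cnj (F p z) - F p z * cnj (F q z) - F q z * cnj (F p z) + F q z * cnj (F q z)" for z
    by (simp only: complex_norm_square) (simp add: algebra_simps)
  have int: "integrable Q (\<lambda>z. complex_of_real ((cmod (F p z - F q z))\<^sup>2))"
    unfolding eq by (intro Bochner_Integration.integrable_add Bochner_Integration.integrable_diff F_cov_integrable)
  then show "integrable Q (\<lambda>z. (cmod (F p z - F q z))\<^sup>2)"
    by (simp only: complex_of_real_integrable_eq)
  have "complex_of_real (\<integral>z. (cmod (F p z - F q z))\<^sup>2 \<partial>Q) = (CLINT z|Q. complex_of_real ((cmod (F p z - F q z))\<^sup>2))"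
    by (simp only: integral_complex_of_real)
  also have "\<dots> = K p p - K p q - K q p + K q q"
    unfolding eq by (simp add: F_cov_integrable F_cov)
  finally show "(\<integral>z. (cmod (F p z - F q z))\<^sup>2 \<partial>Q) = Re (K p p - K p q - K q p + K q q)"
    by (metis Re_complex_of_real)
qed

text \<open>A real linear combination of real and imaginary parts is the real part of a complex one,
  and \<open>(Re w)\<^sup>2\<close> is half the real part of \<open>w * cnj w + w * w\<close>. The
  last product brings in the pseudo-covariance, which is again a value of \<open>K\<close>. The
  right-hand side no longer mentions the field, so two Hermitian fields with the same
  \<open>K\<close> can be compared.\<close>

lemma linear_combination_second_moment:
  fixes a b :: "'p \<Rightarrow> real"
  assumes S: "finite S"
  defines "c \<equiv> \<lambda>p. Complex (a p) (- b p)"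
  shows "(\<integral>z. (\<Sum>p\<in>S. a p * Re (F p z) + b p * Im (F p z))\<^sup>2 \<partial>Q) =
    Re (\<Sum>p\<in>S. \<Sum>q\<in>S. c p * cnj (c q) * K p q + c p * c q * K p (- q)) / 2"
proof -
  let ?z = "\<lambda>z. \<Sum>p\<in>S. c p * F p z"
  have L: "(\<Sum>p\<in>S. a p * Re (F p z) + b p * Im (F p z)) = Re (?z z)" for z
    by (simp add: c_def)
  have Re_sq: "(Re w)\<^sup>2 = Re (w * cnj w + w * w) / 2" for w
    by (simp add: power2_eq_square)
  have "?z z * cnj (?z z) + ?z z * ?z z =
    (\<Sum>p\<in>S. \<Sum>q\<in>S. c p * cnj (c q) * (F p z * cnj (F q z)) + c p * c q * (F p z * F q z))" for z
    by (simp add: sum_product sum.distrib mult_ac)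
  then have sq: "(\<Sum>p\<in>S. a p * Re (F p z) + b p * Im (F p z))\<^sup>2 =
    Re (\<Sum>p\<in>S. \<Sum>q\<in>S. c p * cnj (c q) * (F p z * cnj (F q z)) + c p * c q * (F p z * F q z)) / 2" for z
    unfolding L Re_sq by simp
  have int: "integrable Q (\<lambda>z. \<Sum>p\<in>S. \<Sum>q\<in>S. c p * cnj (c q) * (F p z * cnj (F q z)) + c p * c q * (F p z * F q z))"
    by (intro Bochner_Integration.integrable_sum Bochner_Integration.integrable_add integrable_mult_right
        F_cov_integrable F_pseudo_cov)
  have "(\<integral>z. (\<Sum>p\<in>S. a p * Re (F p z) + b p * Im (F p z))\<^sup>2 \<partial>Q) =
    Re (CLINT z|Q. \<Sum>p\<in>S. \<Sum>q\<in>S. c p * cnj (c q) * (F p z * cnj (F q z)) + c p * c q * (F p z * F q z)) / 2"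
    unfolding sq by (simp only: integral_divide_zero integral_Re[OF int])
  also have "(CLINT z|Q. \<Sum>p\<in>S. \<Sum>q\<in>S. c p * cnj (c q) * (F p z * cnj (F q z)) + c p * c q * (F p z * F q z)) =
    (\<Sum>p\<in>S. \<Sum>q\<in>S. c p * cnj (c q) * K p q + c p * c q * K p (- q))"
    using F_cov_integrable F_pseudo_cov F_cov by (simp add: integrable_mult_right)
  finally show ?thesis .
qed

end

text \<open>The classical theorem normalizes by a positive standard deviation. Evaluating the
  characteristic functions at \<open>\<sigma>\<close> undoes this normalization; with variance zero
  all summands vanish almost surely and both sides are 1.\<close>

lemma (in prob_space) clt_char:
  fixes Z :: "nat \<Rightarrow> 'a \<Rightarrow> real"
  assumes indep: "indep_vars (\<lambda>_. borel) Z UNIV"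
    and distr: "\<And>i. distr M borel (Z i) = distr M borel (Z 0)"
    and sq: "integrable M (\<lambda>\<omega>. (Z 0 \<omega>)\<^sup>2)" and mean: "(\<integral>\<omega>. Z 0 \<omega> \<partial>M) = 0"
  shows "(\<lambda>n. CLINT \<omega>|M. cis ((\<Sum>i<n. Z i \<omega>) / sqrt n)) \<longlonglongrightarrow> exp (- (\<integral>\<omega>. (Z 0 \<omega>)\<^sup>2 \<partial>M) / 2)"
proof -
  have Z [measurable]: "Z i \<in> borel_measurable M" for i
    using indep unfolding indep_vars_def2 by simp
  have transfer: "integrable M (\<lambda>\<omega>. h (Z i \<omega>)) \<longleftrightarrow> integrable M (\<lambda>\<omega>. h (Z 0 \<omega>))"
    "(\<integral>\<omega>. h (Z i \<omega>) \<partial>M) = (\<integral>\<omega>. h (Z 0 \<omega>) \<partial>M)" if "h \<in> borel_measurable borel" for h :: "real \<Rightarrow> real" and i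
    using integrable_distr_eq[OF Z, of h i] integrable_distr_eq[OF Z, of h 0]
      integral_distr[OF Z, of h i] integral_distr[OF Z, of h 0] distr[of i] that by auto
  note sq' = transfer[of "\<lambda>x. x\<^sup>2", simplified] and mean' = transfer[of "\<lambda>x. x", simplified]
  define v where "v = (\<integral>\<omega>. (Z 0 \<omega>)\<^sup>2 \<partial>M)"
  show ?thesis
  proof (cases "v = 0")
    case True
    have "AE \<omega> in M. Z i \<omega> = 0" for i
      using True sq sq'[of i] integral_nonneg_eq_0_iff_AE[of M "\<lambda>\<omega>. (Z i \<omega>)\<^sup>2"] by (simp add: v_def)
    then have "AE \<omega> in M. \<forall>i. Z i \<omega> = 0" by (simp add: AE_all_countable)
    then have "(CLINT \<omega>|M. cis ((\<Sum>i<n. Z i \<omega>) / sqrt n)) = (CLINT \<omega>|M. 1)" for n :: nat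
      by (intro integral_cong_AE) auto
    then show ?thesis using True by (simp add: v_def prob_space)
  next
    case False
    define \<sigma> where "\<sigma> = sqrt v"
    have v0: "v \<ge> 0" unfolding v_def by simp
    have \<sigma>: "\<sigma> > 0" "\<sigma>\<^sup>2 = v" using False v0 by (auto simp: \<sigma>_def)
    have "weak_conv_m (\<lambda>n. distr M borel (\<lambda>\<omega>. (\<Sum>i<n. Z i \<omega>) / sqrt (n * \<sigma>\<^sup>2))) std_normal_distribution"
      by (rule central_limit_theorem_zero_mean[where \<mu> = "distr M borel (Z 0)"])
        (use indep mean mean'(2) sq sq' \<sigma> distr in \<open>auto simp: v_def\<close>)
    then have "(\<lambda>n. char (distr M borel (\<lambda>\<omega>. (\<Sum>i<n. Z i \<omega>) / sqrt (n * \<sigma>\<^sup>2))) \<sigma>)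
        \<longlonglongrightarrow> char std_normal_distribution \<sigma>"
      by (intro levy_continuity1 real_distribution_distr real_dist_normal_dist) auto
    moreover have "char (distr M borel (\<lambda>\<omega>. (\<Sum>i<n. Z i \<omega>) / sqrt (n * \<sigma>\<^sup>2))) \<sigma>
        = (CLINT \<omega>|M. cis ((\<Sum>i<n. Z i \<omega>) / sqrt n))" for n :: nat
    proof -
      have "char (distr M borel (\<lambda>\<omega>. (\<Sum>i<n. Z i \<omega>) / sqrt (n * \<sigma>\<^sup>2))) \<sigma>
        = (CLINT \<omega>|M. cis (\<sigma> * ((\<Sum>i<n. Z i \<omega>) / sqrt (n * \<sigma>\<^sup>2))))"
        unfolding char_def cis_conv_exp by (rule integral_distr) auto
      also have "\<dots> = (CLINT \<omega>|M. cis ((\<Sum>i<n. Z i \<omega>) / sqrt n))"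
        using \<sigma>(1) by (simp add: real_sqrt_mult)
      finally show ?thesis .
    qed
    ultimately show ?thesis by (simp add: char_std_normal_distribution \<sigma> v_def)
  qed
qed

section \<open>Expectations over independent copies of a pair with independent components\<close>

locale iid_pairs = prob_space M for M :: "'w measure" +
  fixes X :: "'w \<Rightarrow> 'a::euclidean_space" and Y :: "'w \<Rightarrow> 'b::euclidean_space"
    and Xs :: "nat \<Rightarrow> 'w \<Rightarrow> 'a" and Ys :: "nat \<Rightarrow> 'w \<Rightarrow> 'b"
  assumes X [measurable]: "X \<in> borel_measurable M" and Y [measurable]: "Y \<in> borel_measurable M"
    and indep_XY: "indep_rvs M X Y"
    and iid_indep: "indep_vars (\<lambda>_. borel) (\<lambda>i \<omega>. (Xs i \<omega>, Ys i \<omega>)) UNIV"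
    and iid_distr: "\<And>i. distr M borel (\<lambda>\<omega>. (Xs i \<omega>, Ys i \<omega>)) = distr M borel (\<lambda>\<omega>. (X \<omega>, Y \<omega>))"
begin

lemma sample_meas: "(\<lambda>\<omega>. (Xs i \<omega>, Ys i \<omega>)) \<in> borel_measurable M"
  using iid_indep unfolding indep_vars_def2 by simp

lemma Xs_meas [measurable]: "Xs i \<in> borel_measurable M"
  and Ys_meas [measurable]: "Ys i \<in> borel_measurable M"
  using measurable_compose[OF sample_meas borel_measurable_continuous_onI[OF continuous_on_fst[OF continuous_on_id]], of i]
    measurable_compose[OF sample_meas borel_measurable_continuous_onI[OF continuous_on_snd[OF continuous_on_id]], of i]
  by simp_all

lemma integral_sample:
  fixes h :: "'a \<times> 'b \<Rightarrow> 'c::{banach, second_countable_topology}"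
  assumes [measurable]: "h \<in> borel_measurable borel"
  shows "(\<integral>\<omega>. h (Xs i \<omega>, Ys i \<omega>) \<partial>M) = (\<integral>\<omega>. h (X \<omega>, Y \<omega>) \<partial>M)"
proof -
  have "(\<lambda>\<omega>. (X \<omega>, Y \<omega>)) \<in> borel_measurable M" by measurable
  then show ?thesis
    using integral_distr[OF sample_meas assms, of i] integral_distr[of "\<lambda>\<omega>. (X \<omega>, Y \<omega>)" M borel h] iid_distr[of i]
    by simp
qed

lemma distr_XY: "distr M borel (\<lambda>\<omega>. (X \<omega>, Y \<omega>)) = distr M borel X \<Otimes>\<^sub>M distr M borel Y"
proof (rule pair_measure_eqI[symmetric])
  interpret DX: prob_space "distr M borel X" by (rule prob_space_distr) simp
  interpret DY: prob_space "distr M borel Y" by (rule prob_space_distr) simp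
  show "sigma_finite_measure (distr M borel X)" "sigma_finite_measure (distr M borel Y)" ..
  show "sets (distr M borel X \<Otimes>\<^sub>M distr M borel Y) = sets (distr M borel (\<lambda>\<omega>. (X \<omega>, Y \<omega>)))"
    by (simp add: borel_prod[symmetric] cong: sets_pair_measure_cong)
  fix A B assume "A \<in> sets (distr M borel X)" "B \<in> sets (distr M borel Y)"
  then have [measurable]: "A \<in> sets borel" "B \<in> sets borel" by simp_all
  have "(\<lambda>\<omega>. (X \<omega>, Y \<omega>)) -` (A \<times> B) \<inter> space M = X -` A \<inter> Y -` B \<inter> space M" by auto
  then have "emeasure (distr M borel (\<lambda>\<omega>. (X \<omega>, Y \<omega>))) (A \<times> B) = ennreal (prob (X -` A \<inter> Y -` B \<inter> space M))"
    by (subst emeasure_distr) (auto simp: emeasure_eq_measure borel_Times)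
  also have "\<dots> = ennreal (prob (X -` A \<inter> space M) * prob (Y -` B \<inter> space M))"
    using indep_XY by (simp add: indep_rvs_def)
  also have "\<dots> = emeasure (distr M borel X) A * emeasure (distr M borel Y) B"
    by (simp add: emeasure_distr emeasure_eq_measure ennreal_mult)
  finally show "emeasure (distr M borel X) A * emeasure (distr M borel Y) B
    = emeasure (distr M borel (\<lambda>\<omega>. (X \<omega>, Y \<omega>))) (A \<times> B)" by simp
qed

lemma integral_mult_XY:
  fixes f :: "'a \<Rightarrow> complex" and g :: "'b \<Rightarrow> complex"
  assumes [measurable]: "f \<in> borel_measurable borel" "g \<in> borel_measurable borel"
    and f: "\<And>x. cmod (f x) \<le> B" and g: "\<And>x. cmod (g x) \<le> B'"
  shows "(CLINT \<omega>|M. f (X \<omega>) * g (Y \<omega>)) = (CLINT \<omega>|M. f (X \<omega>)) * (CLINT \<omega>|M. g (Y \<omega>))"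
proof -
  interpret DX: prob_space "distr M borel X" by (rule prob_space_distr) simp
  interpret DY: prob_space "distr M borel Y" by (rule prob_space_distr) simp
  interpret D: pair_prob_space "distr M borel X" "distr M borel Y" ..
  have B: "0 \<le> B" using f order_trans[OF norm_ge_zero] by blast
  have bnd: "cmod (f x * g y) \<le> B * B'" for x y
    unfolding norm_mult using f g B by (intro mult_mono) auto
  have "(CLINT \<omega>|M. f (X \<omega>) * g (Y \<omega>)) = (CLINT z|distr M borel (\<lambda>\<omega>. (X \<omega>, Y \<omega>)). f (fst z) * g (snd z))"
    by (subst integral_distr) (auto simp flip: borel_prod)
  also have "\<dots> = (CLINT x|distr M borel X. CLINT y|distr M borel Y. f x * g y)"
    unfolding distr_XY
    by (subst D.integral_fst'[symmetric])
      (auto intro!: D.P.integrable_const_bound[of _ "B * B'"] simp: bnd)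
  also have "\<dots> = (CLINT x|distr M borel X. f x) * (CLINT y|distr M borel Y. g y)"
    by simp
  also have "\<dots> = (CLINT \<omega>|M. f (X \<omega>)) * (CLINT \<omega>|M. g (Y \<omega>))"
    by (simp add: integral_distr)
  finally show ?thesis .
qed

text \<open>The functions may vary with the index, so that a product in which an index occurs
  several times can still be written with one factor per index.\<close>

lemma integral_prod_sample:
  fixes h :: "nat \<Rightarrow> 'a \<times> 'b \<Rightarrow> complex"
  assumes I: "finite I" and [measurable]: "\<And>i. h i \<in> borel_measurable borel" and h: "\<And>i z. cmod (h i z) \<le> B"
  shows "(CLINT \<omega>|M. \<Prod>i\<in>I. h i (Xs i \<omega>, Ys i \<omega>)) = (\<Prod>i\<in>I. CLINT \<omega>|M. h i (X \<omega>, Y \<omega>))"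
proof -
  have "indep_vars (\<lambda>_. borel) (\<lambda>i \<omega>. (Xs i \<omega>, Ys i \<omega>)) I"
    by (rule indep_vars_subset[OF iid_indep]) simp
  then have "indep_vars (\<lambda>_. borel) (\<lambda>i \<omega>. h i (Xs i \<omega>, Ys i \<omega>)) I"
    by (rule indep_vars_compose2) simp
  moreover have "integrable M (\<lambda>\<omega>. h i (Xs i \<omega>, Ys i \<omega>))" for i
    using h measurable_compose[OF sample_meas, of "h i" borel i]
    by (intro integrable_const_bound[of _ B]) auto
  ultimately have "(CLINT \<omega>|M. \<Prod>i\<in>I. h i (Xs i \<omega>, Ys i \<omega>)) = (\<Prod>i\<in>I. CLINT \<omega>|M. h i (Xs i \<omega>, Ys i \<omega>))"
    by (intro indep_vars_lebesgue_integral I)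
  then show ?thesis by (simp add: integral_sample)
qed

end

section \<open>The normalized empirical field\<close>

context prob_space
begin

context
  fixes X :: "'a \<Rightarrow> 'd::euclidean_space"
  assumes X_meas [measurable]: "X \<in> borel_measurable M"
begin

lemma integrable_cis: "integrable M (\<lambda>\<omega>. cis (s \<bullet> X \<omega>))"
  by (rule integrable_const_bound[of _ 1]) auto

lemma cmod_char_fun_le: "cmod (char_fun M X s) \<le> 1"
  unfolding char_fun_def by (rule norm_integral_le_const) auto

lemma char_fun_uminus: "char_fun M X (- s) = cnj (char_fun M X s)"
proof -
  have "char_fun M X (- s) = (CLINT \<omega>|M. cnj (cis (s \<bullet> X \<omega>)))"
    unfolding char_fun_def by (simp add: cis_cnj)
  also have "\<dots> = cnj (char_fun M X s)"
    unfolding char_fun_def by (rule integral_bounded_linear[OF bounded_linear_cnj integrable_cis])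
  finally show ?thesis .
qed

lemma continuous_on_char_fun: "continuous_on A (char_fun M X)"
proof (rule continuous_on_subset[OF _ subset_UNIV], unfold continuous_on_sequentially, intro allI ballI impI, elim conjE)
  fix u :: "nat \<Rightarrow> 'd" and s assume u: "u \<longlonglongrightarrow> s"
  show "(char_fun M X \<circ> u) \<longlonglongrightarrow> char_fun M X s"
    unfolding comp_def char_fun_def
  proof (rule integral_dominated_convergence[where w = "\<lambda>_. 1"])
    show "AE \<omega> in M. (\<lambda>n. cis (u n \<bullet> X \<omega>)) \<longlonglongrightarrow> cis (s \<bullet> X \<omega>)"
      using u by (intro AE_I2 continuous_on_tendsto_compose[where f = cis and s = UNIV] tendsto_intros)
        (auto intro: continuous_intros)
  qed auto
qed

lemma borel_measurable_char_fun: "char_fun M X \<in> borel_measurable borel"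
  by (rule borel_measurable_continuous_onI) (rule continuous_on_char_fun)

lemma centred_character_mean: "(CLINT \<omega>|M. cis (s \<bullet> X \<omega>) - char_fun M X s) = 0"
  by (simp add: integrable_cis char_fun_def prob_space)

lemma centred_character_cov:
  "(CLINT \<omega>|M. (cis (s \<bullet> X \<omega>) - char_fun M X s) * cnj (cis (s' \<bullet> X \<omega>) - char_fun M X s'))
    = char_fun M X (s - s') - char_fun M X s * cnj (char_fun M X s')"
proof -
  have "(CLINT \<omega>|M. (cis (s \<bullet> X \<omega>) - char_fun M X s) * cnj (cis (s' \<bullet> X \<omega>) - char_fun M X s'))
    = (CLINT \<omega>|M. cis ((s - s') \<bullet> X \<omega>) - cnj (char_fun M X s') * cis (s \<bullet> X \<omega>)
        - char_fun M X s * cis ((- s') \<bullet> X \<omega>) + char_fun M X s * cnj (char_fun M X s'))"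
    by (rule Bochner_Integration.integral_cong)
      (simp_all add: cis_cnj cis_mult inner_diff_left algebra_simps)
  also have "\<dots> = char_fun M X (s - s') - cnj (char_fun M X s') * char_fun M X s
        - char_fun M X s * char_fun M X (- s') + char_fun M X s * cnj (char_fun M X s')"
    using integrable_cis[of "s - s'"] integrable_cis[of s] integrable_cis[of "- s'"]
    unfolding char_fun_def by (simp add: prob_space del: inner_minus_left)
  finally show ?thesis by (simp add: char_fun_uminus mult.commute)
qed

lemma cmod_centred_character_le: "cmod (cis r - char_fun M X s) \<le> 2"
  using norm_triangle_ineq4[of "cis r" "char_fun M X s"] cmod_char_fun_le[of s] by simp

lemma centred_character_second_moment:
  "(\<integral>\<^sup>+\<omega>. ennreal ((cmod (cis (s \<bullet> X \<omega>) - char_fun M X s))\<^sup>2) \<partial>M) = ennreal (1 - (cmod (char_fun M X s))\<^sup>2)"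
proof -
  note [measurable] = borel_measurable_char_fun
  have bnd: "(cmod (cis (s \<bullet> X \<omega>) - char_fun M X s))\<^sup>2 \<le> 4" for \<omega>
    using power_mono[OF cmod_centred_character_le norm_ge_zero, where n = 2] by simp
  have int: "integrable M (\<lambda>\<omega>. (cmod (cis (s \<bullet> X \<omega>) - char_fun M X s))\<^sup>2)"
    using bnd by (intro integrable_const_bound[of _ 4]) auto
  have "complex_of_real (\<integral>\<omega>. (cmod (cis (s \<bullet> X \<omega>) - char_fun M X s))\<^sup>2 \<partial>M)
    = (CLINT \<omega>|M. (cis (s \<bullet> X \<omega>) - char_fun M X s) * cnj (cis (s \<bullet> X \<omega>) - char_fun M X s))"
    by (simp only: complex_norm_square flip: integral_complex_of_real)
  also have "\<dots> = complex_of_real (1 - (cmod (char_fun M X s))\<^sup>2)"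
    unfolding centred_character_cov of_real_diff complex_norm_square
    by (simp add: char_fun_def prob_space)
  finally have "(\<integral>\<omega>. (cmod (cis (s \<bullet> X \<omega>) - char_fun M X s))\<^sup>2 \<partial>M) = 1 - (cmod (char_fun M X s))\<^sup>2"
    by (simp only: of_real_eq_iff)
  then show ?thesis
    using nn_integral_eq_integral[OF int] by simp
qed

end

end

context iid_pairs
begin

lemmas [measurable] = borel_measurable_char_fun[OF X] borel_measurable_char_fun[OF Y]

text \<open>A product of centred characters, not a centred product. By independence its mean is zero
  and its covariance is the product of the two marginal covariances, which is the covariance
  prescribed for the limit.\<close>

definition feature :: "'a \<times> 'b \<Rightarrow> 'a \<times> 'b \<Rightarrow> complex" where
  "feature p z = (cis (fst p \<bullet> fst z) - char_fun M X (fst p)) * (cis (snd p \<bullet> snd z) - char_fun M Y (snd p))"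

definition kernel :: "'a \<times> 'b \<Rightarrow> 'a \<times> 'b \<Rightarrow> complex" where
  "kernel p q =
    (char_fun M X (fst p - fst q) - char_fun M X (fst p) * cnj (char_fun M X (fst q))) *
    (char_fun M Y (snd p - snd q) - char_fun M Y (snd p) * cnj (char_fun M Y (snd q)))"

text \<open>The field W of the overview, centred with the true characteristic functions.\<close>

definition empirical :: "nat \<Rightarrow> 'a \<times> 'b \<Rightarrow> 'w \<Rightarrow> complex" where
  "empirical n p \<omega> = (\<Sum>i<n. feature p (Xs i \<omega>, Ys i \<omega>)) / of_real (sqrt n)"

lemma borel_measurable_cnj: "cnj \<in> borel_measurable borel"
  by (rule borel_measurable_continuous_onI) (intro continuous_intros)

lemmas [measurable] = measurable_compose[OF _ borel_measurable_cnj]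

lemma feature_meas2: "(\<lambda>(p, z). feature p z) \<in> borel_measurable (borel \<Otimes>\<^sub>M borel)"
  unfolding feature_def split_beta borel_prod[symmetric] by measurable

lemma feature_meas [measurable]: "feature p \<in> borel_measurable borel"
  using measurable_Pair2[OF feature_meas2, of p] by simp

lemma cmod_feature_le: "cmod (feature p z) \<le> 4"
  using mult_mono[OF cmod_centred_character_le[OF X] cmod_centred_character_le[OF Y]]
  by (simp add: feature_def norm_mult)

lemma feature_mean: "(CLINT \<omega>|M. feature p (X \<omega>, Y \<omega>)) = 0"
  unfolding feature_def fst_conv snd_conv
  by (subst integral_mult_XY[where B = 2 and B' = 2])
    (auto simp: cmod_centred_character_le[OF X] cmod_centred_character_le[OF Y] centred_character_mean[OF X])

lemma feature_cov: "(CLINT \<omega>|M. feature p (X \<omega>, Y \<omega>) * cnj (feature q (X \<omega>, Y \<omega>))) = kernel p q"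
proof -
  let ?f = "\<lambda>x. (cis (fst p \<bullet> x) - char_fun M X (fst p)) * cnj (cis (fst q \<bullet> x) - char_fun M X (fst q))"
  let ?g = "\<lambda>y. (cis (snd p \<bullet> y) - char_fun M Y (snd p)) * cnj (cis (snd q \<bullet> y) - char_fun M Y (snd q))"
  have f: "cmod (?f x) \<le> 2 * 2" and g: "cmod (?g y) \<le> 2 * 2" for x y
    unfolding norm_mult complex_mod_cnj
    by (intro mult_mono cmod_centred_character_le X Y; simp)+
  have "(CLINT \<omega>|M. feature p (X \<omega>, Y \<omega>) * cnj (feature q (X \<omega>, Y \<omega>))) = (CLINT \<omega>|M. ?f (X \<omega>) * ?g (Y \<omega>))"
    by (simp add: feature_def mult_ac)
  also have "\<dots> = (CLINT \<omega>|M. ?f (X \<omega>)) * (CLINT \<omega>|M. ?g (Y \<omega>))"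
    using f g by (intro integral_mult_XY) auto
  finally show ?thesis
    unfolding centred_character_cov[OF X] centred_character_cov[OF Y] kernel_def .
qed

lemma feature_uminus: "feature (- p) z = cnj (feature p z)"
  by (simp add: feature_def char_fun_uminus[OF X] char_fun_uminus[OF Y] cis_cnj)

sublocale feature: hermitian_field M "\<lambda>p \<omega>. feature p (X \<omega>, Y \<omega>)" kernel
proof
  show *: "(\<lambda>\<omega>. feature p (X \<omega>, Y \<omega>)) \<in> borel_measurable M" for p
    by measurable
  show "integrable M (\<lambda>\<omega>. (cmod (feature p (X \<omega>, Y \<omega>)))\<^sup>2)" for p
    using power_mono[OF cmod_feature_le norm_ge_zero, where n = 2] *
    by (intro integrable_const_bound[of _ 16]) auto
qed (auto simp: feature_cov feature_uminus)

lemma empirical_meas2: "(\<lambda>(p, \<omega>). empirical n p \<omega>) \<in> borel_measurable (borel \<Otimes>\<^sub>M M)"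
proof -
  have "(\<lambda>z. (fst z, (Xs i (snd z), Ys i (snd z)))) \<in> borel \<Otimes>\<^sub>M M \<rightarrow>\<^sub>M borel \<Otimes>\<^sub>M borel" for i
    by (intro measurable_Pair measurable_fst measurable_compose[OF measurable_snd sample_meas])
  from measurable_compose[OF this feature_meas2]
  have "(\<lambda>(p, \<omega>). feature p (Xs i \<omega>, Ys i \<omega>)) \<in> borel_measurable (borel \<Otimes>\<^sub>M M)" for i
    by (simp add: split_beta')
  note [measurable] = this
  show ?thesis unfolding empirical_def split_beta' by (simp add: split_beta'[symmetric])
qed

text \<open>Off the diagonal the expectations factorize over the two indices and vanish because
  \<open>h\<close> has mean zero, leaving \<open>n\<close> equal diagonal terms.\<close>

lemma sum_sample_second_moment:
  fixes h :: "'a \<times> 'b \<Rightarrow> complex"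
  assumes [measurable]: "h \<in> borel_measurable borel" and h: "\<And>z. cmod (h z) \<le> B"
    and mean: "(CLINT \<omega>|M. h (X \<omega>, Y \<omega>)) = 0"
  shows "integrable M (\<lambda>\<omega>. (cmod (\<Sum>i<n. h (Xs i \<omega>, Ys i \<omega>)))\<^sup>2)"
    and "(\<integral>\<omega>. (cmod (\<Sum>i<n. h (Xs i \<omega>, Ys i \<omega>)))\<^sup>2 \<partial>M) = n * (\<integral>\<omega>. (cmod (h (X \<omega>, Y \<omega>)))\<^sup>2 \<partial>M)"
proof -
  let ?h = "\<lambda>i \<omega>. h (Xs i \<omega>, Ys i \<omega>)"
  have h_meas [measurable]: "?h i \<in> borel_measurable M" for i
    using measurable_compose[OF sample_meas, of h borel i] by simp
  have B: "0 \<le> B" using h order_trans[OF norm_ge_zero] by blast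
  have int: "integrable M (\<lambda>\<omega>. ?h i \<omega> * cnj (?h j \<omega>))" for i j
    using h B by (intro integrable_const_bound[of _ "B * B"]) (auto simp: norm_mult intro!: mult_mono)
  have cross: "(CLINT \<omega>|M. ?h i \<omega> * cnj (?h j \<omega>)) = (if i = j then of_real (\<integral>\<omega>. (cmod (h (X \<omega>, Y \<omega>)))\<^sup>2 \<partial>M) else 0)" for i j
  proof (cases "i = j")
    case True
    have "(CLINT \<omega>|M. ?h i \<omega> * cnj (?h i \<omega>)) = (CLINT \<omega>|M. of_real ((cmod (?h i \<omega>))\<^sup>2))"
      by (simp only: complex_norm_square)
    also have "\<dots> = of_real (\<integral>\<omega>. (cmod (h (X \<omega>, Y \<omega>)))\<^sup>2 \<partial>M)"
      unfolding integral_complex_of_real by (subst integral_sample[of "\<lambda>z. (cmod (h z))\<^sup>2"]) auto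
    finally show ?thesis using True by simp
  next
    case False
    let ?g = "\<lambda>n z. if n = i then h z else cnj (h z)"
    have "(CLINT \<omega>|M. \<Prod>n\<in>{i, j}. ?g n (Xs n \<omega>, Ys n \<omega>)) = (\<Prod>n\<in>{i, j}. CLINT \<omega>|M. ?g n (X \<omega>, Y \<omega>))"
      by (rule integral_prod_sample[where B = B]) (use h in auto)
    then show ?thesis using False mean by (simp split: if_splits)
  qed
  let ?S = "\<lambda>\<omega>. \<Sum>i<n. ?h i \<omega>"
  have S_bnd: "cmod (?S \<omega>) \<le> n * B" for \<omega>
    using sum_norm_bound[of "{..<n}" "\<lambda>i. ?h i \<omega>" B] h by simp
  show "integrable M (\<lambda>\<omega>. (cmod (?S \<omega>))\<^sup>2)"
    using power_mono[OF S_bnd norm_ge_zero, where n = 2]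
    by (intro integrable_const_bound[of _ "(n * B)\<^sup>2"]) auto
  have "complex_of_real (\<integral>\<omega>. (cmod (?S \<omega>))\<^sup>2 \<partial>M) = (CLINT \<omega>|M. ?S \<omega> * cnj (?S \<omega>))"
    by (simp only: complex_norm_square flip: integral_complex_of_real)
  also have "\<dots> = (CLINT \<omega>|M. \<Sum>i<n. \<Sum>j<n. ?h i \<omega> * cnj (?h j \<omega>))"
    by (simp add: sum_product)
  also have "\<dots> = (\<Sum>i<n. \<Sum>j<n. CLINT \<omega>|M. ?h i \<omega> * cnj (?h j \<omega>))"
    using int by simp
  also have "\<dots> = of_real (n * (\<integral>\<omega>. (cmod (h (X \<omega>, Y \<omega>)))\<^sup>2 \<partial>M))"
    unfolding cross by simp
  finally show "(\<integral>\<omega>. (cmod (?S \<omega>))\<^sup>2 \<partial>M) = n * (\<integral>\<omega>. (cmod (h (X \<omega>, Y \<omega>)))\<^sup>2 \<partial>M)"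
    by (simp only: of_real_eq_iff)
qed

text \<open>For positive \<open>n\<close> this is an equality. The inequality also covers the empty
  sum at \<open>n = 0\<close>, so that the moment bounds hold for every index of the
  sequence.\<close>

lemma normalized_sum_second_moment_le:
  fixes h :: "'a \<times> 'b \<Rightarrow> complex"
  assumes [measurable]: "h \<in> borel_measurable borel" and h: "\<And>z. cmod (h z) \<le> B"
    and mean: "(CLINT \<omega>|M. h (X \<omega>, Y \<omega>)) = 0"
  shows "(\<integral>\<^sup>+\<omega>. ennreal ((cmod ((\<Sum>i<n. h (Xs i \<omega>, Ys i \<omega>)) / of_real (sqrt n)))\<^sup>2) \<partial>M)
    \<le> ennreal (\<integral>\<omega>. (cmod (h (X \<omega>, Y \<omega>)))\<^sup>2 \<partial>M)"
proof (cases "n = 0")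
  case False
  have [measurable]: "(\<lambda>\<omega>. h (Xs i \<omega>, Ys i \<omega>)) \<in> borel_measurable M" for i
    using measurable_compose[OF sample_meas, of h borel i] by simp
  have "(\<integral>\<^sup>+\<omega>. ennreal ((cmod ((\<Sum>i<n. h (Xs i \<omega>, Ys i \<omega>)) / of_real (sqrt n)))\<^sup>2) \<partial>M)
    = (\<integral>\<^sup>+\<omega>. ennreal (1 / n) * ennreal ((cmod (\<Sum>i<n. h (Xs i \<omega>, Ys i \<omega>)))\<^sup>2) \<partial>M)"
    by (simp add: norm_divide power_divide flip: ennreal_mult)
  also have "\<dots> = ennreal (1 / n) * ennreal (n * (\<integral>\<omega>. (cmod (h (X \<omega>, Y \<omega>)))\<^sup>2 \<partial>M))"
    using nn_integral_eq_integral[OF sum_sample_second_moment(1)[OF assms]]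
    by (subst nn_integral_cmult) (auto simp: sum_sample_second_moment(2)[OF assms])
  also have "\<dots> = ennreal (\<integral>\<omega>. (cmod (h (X \<omega>, Y \<omega>)))\<^sup>2 \<partial>M)"
    using False by (simp flip: ennreal_mult)
  finally show ?thesis by simp
qed simp

lemma empirical_second_moment_le:
  "(\<integral>\<^sup>+\<omega>. ennreal ((cmod (empirical n p \<omega>))\<^sup>2) \<partial>M) \<le> ennreal (Re (kernel p p))"
  unfolding empirical_def feature.second_moment[symmetric]
  by (rule normalized_sum_second_moment_le[OF _ cmod_feature_le feature_mean]) measurable

lemma empirical_increment_le:
  "(\<integral>\<^sup>+\<omega>. ennreal ((cmod (empirical n p \<omega> - empirical n q \<omega>))\<^sup>2) \<partial>M)
    \<le> ennreal (Re (kernel p p - kernel p q - kernel q p + kernel q q))"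
proof -
  have "empirical n p \<omega> - empirical n q \<omega> =
      (\<Sum>i<n. feature p (Xs i \<omega>, Ys i \<omega>) - feature q (Xs i \<omega>, Ys i \<omega>)) / of_real (sqrt n)" for \<omega>
    by (simp add: empirical_def diff_divide_distrib sum_subtractf)
  moreover have "integrable M (\<lambda>\<omega>. feature p (X \<omega>, Y \<omega>))" for p
    by (rule integrable_const_bound[of _ 4]) (auto simp: cmod_feature_le)
  then have "(CLINT \<omega>|M. feature p (X \<omega>, Y \<omega>) - feature q (X \<omega>, Y \<omega>)) = 0"
    by (simp add: feature_mean)
  moreover have "cmod (feature p z - feature q z) \<le> 8" for z
    using norm_triangle_ineq4[of "feature p z" "feature q z"] cmod_feature_le[of p z] cmod_feature_le[of q z] by simp
  ultimately show ?thesis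
    using normalized_sum_second_moment_le[of "\<lambda>z. feature p z - feature q z" 8 n]
    by (simp add: feature.increment(2))
qed

lemma continuous_on_kernel: "continuous_on A (\<lambda>(p, q). kernel p q)"
  unfolding kernel_def split_beta'
  by (intro continuous_intros continuous_on_compose2[OF continuous_on_char_fun[OF X, of UNIV]]
      continuous_on_compose2[OF continuous_on_char_fun[OF Y, of UNIV]]; simp)

lemma cmod_kernel_le: "cmod (kernel p q) \<le> 4"
proof -
  have 1: "cmod (a - b * cnj c) \<le> 2" if "cmod a \<le> 1" "cmod b \<le> 1" "cmod c \<le> 1" for a b c
    using norm_triangle_ineq4[of a "b * cnj c"] mult_mono[of "cmod b" 1 "cmod c" 1] that
    by (simp add: norm_mult)
  show ?thesis
    unfolding kernel_def norm_mult
    using mult_mono[OF 1[OF cmod_char_fun_le[OF X] cmod_char_fun_le[OF X] cmod_char_fun_le[OF X]]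
        1[OF cmod_char_fun_le[OF Y] cmod_char_fun_le[OF Y] cmod_char_fun_le[OF Y]]] by simp
qed

lemma kernel_diag: "Re (kernel p p) = (1 - (cmod (char_fun M X (fst p)))\<^sup>2) * (1 - (cmod (char_fun M Y (snd p)))\<^sup>2)"
proof -
  have "kernel p p = of_real ((1 - (cmod (char_fun M X (fst p)))\<^sup>2) * (1 - (cmod (char_fun M Y (snd p)))\<^sup>2))"
    unfolding of_real_mult of_real_diff complex_norm_square kernel_def by (simp add: char_fun_def prob_space)
  then show ?thesis by (metis Re_complex_of_real)
qed

text \<open>Although the vectors \<open>Xs\<close> and \<open>Ys\<close> enter jointly, each index factorizes by the independence
  of \<open>X\<close> and \<open>Y\<close>, so the two sums behave as if they came from independent samples.\<close>

lemma integral_four_fold: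
  fixes a :: "'a \<Rightarrow> complex" and b :: "'b \<Rightarrow> complex"
  assumes [measurable]: "a \<in> borel_measurable borel" "b \<in> borel_measurable borel"
    and a: "\<And>x. cmod (a x) \<le> B" and b: "\<And>y. cmod (b y) \<le> B" and B: "1 \<le> B"
  shows "(CLINT \<omega>|M. a (Xs i \<omega>) * cnj (a (Xs j \<omega>)) * (b (Ys k \<omega>) * cnj (b (Ys l \<omega>)))) =
    (CLINT \<omega>|M. a (Xs i \<omega>) * cnj (a (Xs j \<omega>))) * (CLINT \<omega>|M. b (Ys k \<omega>) * cnj (b (Ys l \<omega>)))"
proof -
  let ?I = "{i, j, k, l}"
  \<comment> \<open>Each index of \<open>?I\<close> collects whatever factors fall on it and carries
    1 otherwise. Coincidences among \<open>i\<close>, \<open>j\<close>, \<open>k\<close>,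
    \<open>l\<close> then need no case distinction.\<close>
  let ?f = "\<lambda>n x. (if n = i then a x else 1) * (if n = j then cnj (a x) else 1)"
  let ?g = "\<lambda>n y. (if n = k then b y else 1) * (if n = l then cnj (b y) else 1)"
  have f: "(\<Prod>n\<in>?I. ?f n (Xs n \<omega>)) = a (Xs i \<omega>) * cnj (a (Xs j \<omega>))" for \<omega>
    by (simp only: prod.distrib) (simp add: prod.delta)
  have g: "(\<Prod>n\<in>?I. ?g n (Ys n \<omega>)) = b (Ys k \<omega>) * cnj (b (Ys l \<omega>))" for \<omega>
    by (simp only: prod.distrib) (simp add: prod.delta)
  have bb: "cmod (u * v) \<le> B * B" if "cmod u \<le> B" "cmod v \<le> B" for u v
    using that B by (auto simp: norm_mult intro!: mult_mono)
  \<comment> \<open>The condition \<open>1 \<le> B\<close> lets the same bound cover the factors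
    that are equal to 1.\<close>
  have fb: "cmod (?f n x) \<le> B * B" and gb: "cmod (?g n y) \<le> B * B" for n x y
    using a b B by (intro bb; auto)+
  have BB: "1 \<le> B * B" using B mult_mono[of 1 B 1 B] by simp
  have fgb: "cmod (?f n x * ?g m y) \<le> (B * B) * (B * B)" for n m x y
    unfolding norm_mult[of "?f n x" "?g m y"] by (intro mult_mono fb gb) (use B in auto)
  have fb': "cmod (?f n x) \<le> (B * B) * (B * B)" and gb': "cmod (?g n y) \<le> (B * B) * (B * B)" for n x y
    using order_trans[OF fb] order_trans[OF gb] BB mult_mono[of 1 "B * B" "B * B" "B * B"] by fastforce+
  have [measurable]: "?f n \<in> borel_measurable borel" "?g n \<in> borel_measurable borel" for n
    by measurable
  have meas: "(\<lambda>z::'a \<times> 'b. ?f n (fst z)) \<in> borel_measurable borel" "(\<lambda>z::'a \<times> 'b. ?g n (snd z)) \<in> borel_measurable borel" for n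
    unfolding borel_prod[symmetric] by measurable
  have "(CLINT \<omega>|M. \<Prod>n\<in>?I. ?f n (fst (Xs n \<omega>, Ys n \<omega>))) = (\<Prod>n\<in>?I. CLINT \<omega>|M. ?f n (fst (X \<omega>, Y \<omega>)))"
    by (rule integral_prod_sample[where h = "\<lambda>n z. ?f n (fst z)", OF _ meas(1) fb']) simp
  then have fX: "(\<Prod>n\<in>?I. CLINT \<omega>|M. ?f n (X \<omega>)) = (CLINT \<omega>|M. a (Xs i \<omega>) * cnj (a (Xs j \<omega>)))"
    by (simp only: fst_conv f)
  have "(CLINT \<omega>|M. \<Prod>n\<in>?I. ?g n (snd (Xs n \<omega>, Ys n \<omega>))) = (\<Prod>n\<in>?I. CLINT \<omega>|M. ?g n (snd (X \<omega>, Y \<omega>)))"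
    by (rule integral_prod_sample[where h = "\<lambda>n z. ?g n (snd z)", OF _ meas(2) gb']) simp
  then have gY: "(\<Prod>n\<in>?I. CLINT \<omega>|M. ?g n (Y \<omega>)) = (CLINT \<omega>|M. b (Ys k \<omega>) * cnj (b (Ys l \<omega>)))"
    by (simp only: snd_conv g)
  have "(CLINT \<omega>|M. a (Xs i \<omega>) * cnj (a (Xs j \<omega>)) * (b (Ys k \<omega>) * cnj (b (Ys l \<omega>)))) =
    (CLINT \<omega>|M. \<Prod>n\<in>?I. ?f n (fst (Xs n \<omega>, Ys n \<omega>)) * ?g n (snd (Xs n \<omega>, Ys n \<omega>)))"
    unfolding f[symmetric] g[symmetric] prod.distrib fst_conv snd_conv ..
  also have "\<dots> = (\<Prod>n\<in>?I. CLINT \<omega>|M. ?f n (fst (X \<omega>, Y \<omega>)) * ?g n (snd (X \<omega>, Y \<omega>)))"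
    by (rule integral_prod_sample[where h = "\<lambda>n z. ?f n (fst z) * ?g n (snd z)", OF _ borel_measurable_times[OF meas] fgb]) simp
  also have "\<dots> = (\<Prod>n\<in>?I. CLINT \<omega>|M. ?f n (X \<omega>) * ?g n (Y \<omega>))"
    by (simp only: fst_conv snd_conv)
  also have "\<dots> = (\<Prod>n\<in>?I. (CLINT \<omega>|M. ?f n (X \<omega>)) * (CLINT \<omega>|M. ?g n (Y \<omega>)))"
    by (intro prod.cong refl integral_mult_XY[OF _ _ fb gb]) measurable
  also have "\<dots> = (CLINT \<omega>|M. a (Xs i \<omega>) * cnj (a (Xs j \<omega>))) * (CLINT \<omega>|M. b (Ys k \<omega>) * cnj (b (Ys l \<omega>)))"
    unfolding prod.distrib[of "\<lambda>n. CLINT \<omega>|M. ?f n (X \<omega>)"] fX gY ..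
  finally show ?thesis .
qed

text \<open>Expanding the squared modulus gives four-fold terms that split one by one, so the second
  moment of the product is the product of the second moments although both sums run over the same
  sample. The growth is only \<open>n * n\<close>, which after division by the square of
  \<open>n * sqrt n\<close> leaves the order \<open>1 / n\<close>.\<close>

lemma product_sum_second_moment:
  fixes a :: "'a \<Rightarrow> complex" and b :: "'b \<Rightarrow> complex"
  assumes [measurable]: "a \<in> borel_measurable borel" "b \<in> borel_measurable borel"
    and a: "\<And>x. cmod (a x) \<le> B" and b: "\<And>y. cmod (b y) \<le> B" and B: "1 \<le> B"
    and a0: "(CLINT \<omega>|M. a (X \<omega>)) = 0" and b0: "(CLINT \<omega>|M. b (Y \<omega>)) = 0"
  shows "(\<integral>\<^sup>+\<omega>. ennreal ((cmod ((\<Sum>i<n. a (Xs i \<omega>)) * (\<Sum>i<n. b (Ys i \<omega>))))\<^sup>2) \<partial>M) =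
    ennreal (n * n * ((\<integral>\<omega>. (cmod (a (X \<omega>)))\<^sup>2 \<partial>M) * (\<integral>\<omega>. (cmod (b (Y \<omega>)))\<^sup>2 \<partial>M)))"
proof -
  let ?S = "\<lambda>\<omega>. \<Sum>i<n. a (Xs i \<omega>)" and ?T = "\<lambda>\<omega>. \<Sum>i<n. b (Ys i \<omega>)"
  have B0: "0 \<le> B" using B by simp
  have ST_bnd: "cmod (?S \<omega> * ?T \<omega>) \<le> (n * B) * (n * B)" for \<omega>
    unfolding norm_mult
    using sum_norm_bound[of "{..<n}" "\<lambda>i. a (Xs i \<omega>)" B] sum_norm_bound[of "{..<n}" "\<lambda>i. b (Ys i \<omega>)" B] a b B0
    by (intro mult_mono) auto
  have ST_int: "integrable M (\<lambda>\<omega>. (cmod (?S \<omega> * ?T \<omega>))\<^sup>2)"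
    using power_mono[OF ST_bnd norm_ge_zero, where n = 2]
    by (intro integrable_const_bound[of _ "((n * B) * (n * B))\<^sup>2"]) auto
  have aa: "integrable M (\<lambda>\<omega>. a (Xs i \<omega>) * cnj (a (Xs j \<omega>)))" for i j
    using a B0 by (intro integrable_const_bound[of _ "B * B"]) (auto simp: norm_mult intro!: mult_mono)
  have bb: "integrable M (\<lambda>\<omega>. b (Ys i \<omega>) * cnj (b (Ys j \<omega>)))" for i j
    using b B0 by (intro integrable_const_bound[of _ "B * B"]) (auto simp: norm_mult intro!: mult_mono)
  have aabb: "integrable M (\<lambda>\<omega>. a (Xs i \<omega>) * cnj (a (Xs j \<omega>)) * (b (Ys k \<omega>) * cnj (b (Ys l \<omega>))))" for i j k l
    using a b B0 by (intro integrable_const_bound[of _ "(B * B) * (B * B)"]) (auto simp: norm_mult intro!: mult_mono)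
  have "complex_of_real (\<integral>\<omega>. (cmod (?S \<omega> * ?T \<omega>))\<^sup>2 \<partial>M) = (CLINT \<omega>|M. (?S \<omega> * cnj (?S \<omega>)) * (?T \<omega> * cnj (?T \<omega>)))"
    by (simp only: complex_norm_square complex_cnj_mult mult_ac flip: integral_complex_of_real)
  also have "\<dots> = (CLINT \<omega>|M. \<Sum>i<n. \<Sum>k<n. \<Sum>j<n. \<Sum>l<n. a (Xs i \<omega>) * cnj (a (Xs j \<omega>)) * (b (Ys k \<omega>) * cnj (b (Ys l \<omega>))))"
    by (simp only: cnj_sum sum_product)
  also have "\<dots> = (\<Sum>i<n. \<Sum>k<n. \<Sum>j<n. \<Sum>l<n. (CLINT \<omega>|M. a (Xs i \<omega>) * cnj (a (Xs j \<omega>))) * (CLINT \<omega>|M. b (Ys k \<omega>) * cnj (b (Ys l \<omega>))))"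
    using aabb integral_four_fold[OF assms(1-5)] by simp
  also have "\<dots> = (\<Sum>i<n. \<Sum>j<n. CLINT \<omega>|M. a (Xs i \<omega>) * cnj (a (Xs j \<omega>))) * (\<Sum>k<n. \<Sum>l<n. CLINT \<omega>|M. b (Ys k \<omega>) * cnj (b (Ys l \<omega>)))"
    by (simp only: sum_product)
  also have "(\<Sum>i<n. \<Sum>j<n. CLINT \<omega>|M. a (Xs i \<omega>) * cnj (a (Xs j \<omega>))) = (CLINT \<omega>|M. ?S \<omega> * cnj (?S \<omega>))"
    using aa by (simp add: sum_product)
  also have "(\<Sum>k<n. \<Sum>l<n. CLINT \<omega>|M. b (Ys k \<omega>) * cnj (b (Ys l \<omega>))) = (CLINT \<omega>|M. ?T \<omega> * cnj (?T \<omega>))"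
    using bb by (simp add: sum_product)
  also have "(CLINT \<omega>|M. ?S \<omega> * cnj (?S \<omega>)) * (CLINT \<omega>|M. ?T \<omega> * cnj (?T \<omega>)) =
      complex_of_real ((\<integral>\<omega>. (cmod (?S \<omega>))\<^sup>2 \<partial>M) * (\<integral>\<omega>. (cmod (?T \<omega>))\<^sup>2 \<partial>M))"
    by (simp only: complex_norm_square of_real_mult flip: integral_complex_of_real)
  finally have "(\<integral>\<omega>. (cmod (?S \<omega> * ?T \<omega>))\<^sup>2 \<partial>M) = (\<integral>\<omega>. (cmod (?S \<omega>))\<^sup>2 \<partial>M) * (\<integral>\<omega>. (cmod (?T \<omega>))\<^sup>2 \<partial>M)"
    by (simp only: of_real_eq_iff)
  also have "(\<integral>\<omega>. (cmod (?S \<omega>))\<^sup>2 \<partial>M) = n * (\<integral>\<omega>. (cmod (a (X \<omega>)))\<^sup>2 \<partial>M)"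
    using sum_sample_second_moment(2)[of "\<lambda>z. a (fst z)" B n] a a0 by (simp add: borel_prod[symmetric])
  also have "(\<integral>\<omega>. (cmod (?T \<omega>))\<^sup>2 \<partial>M) = n * (\<integral>\<omega>. (cmod (b (Y \<omega>)))\<^sup>2 \<partial>M)"
    using sum_sample_second_moment(2)[of "\<lambda>z. b (snd z)" B n] b b0 by (simp add: borel_prod[symmetric])
  finally show ?thesis using nn_integral_eq_integral[OF ST_int] by (simp add: mult_ac)
qed

end

section \<open>Levy measures and the estimator as an integral\<close>

text \<open>Combines \<open>1 - cos u \<le> u\<^sup>2 / 2\<close> with
  \<open>1 - cos u \<le> 2\<close>. It is phrased for \<open>u = x \<bullet> s\<close>, where
  Cauchy-Schwarz gives the hypothesis with the squared norms of \<open>x\<close> and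
  \<open>s\<close> as \<open>c\<close> and \<open>d\<close>; the factor \<open>min 1 d\<close> is
  then the function that a Levy measure integrates.\<close>

lemma one_minus_cos_le: "1 - cos u \<le> 2 * max 1 c * min 1 d" if "u\<^sup>2 \<le> c * d" "0 \<le> d" for u c d :: real
proof -
  have "1 - cos u = 2 * (sin (u / 2))\<^sup>2"
    using cos_double_sin[of "u / 2"] by simp
  also have "(sin (u / 2))\<^sup>2 \<le> (u / 2)\<^sup>2"
    using power_mono[OF abs_sin_x_le_abs_x[of "u / 2"], of 2] by (simp add: power_divide)
  finally have 1: "1 - cos u \<le> u\<^sup>2 / 2" by (simp add: power_divide)
  have 2: "1 - cos u \<le> 2" using cos_ge_minus_one[of u] by linarith
  show ?thesis
  proof (cases "d \<le> 1")
    case True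
    have "c * d \<le> max 1 c * d" using that by (intro mult_right_mono) auto
    moreover have "0 \<le> max 1 c * d" using that by simp
    ultimately have "1 - cos u \<le> 2 * (max 1 c * d)" using 1 that(1) by linarith
    then show ?thesis using True by (simp add: min_def)
  next
    case False
    then have "2 * max 1 c * min 1 d = 2 * max 1 c" by simp
    then show ?thesis using 2 max.cobounded1[of 1 c] by linarith
  qed
qed

section \<open>Integrability, exhaustion and symmetry of a Levy measure\<close>

context
  fixes \<rho> :: "'d::euclidean_space measure"
  assumes levy: "sym_levy_measure \<rho>"
begin

lemma levy_sets: "sets \<rho> = sets borel"
  using levy by (simp add: sym_levy_measure_def)

lemma levy_integrable: "integrable \<rho> (\<lambda>s. 1 - cos (x \<bullet> s))"
proof (rule integrableI_bounded)
  note [measurable_cong] = levy_sets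
  show "(\<lambda>s. 1 - cos (x \<bullet> s)) \<in> borel_measurable \<rho>" by measurable
  have "(\<integral>\<^sup>+ s. ennreal (norm (1 - cos (x \<bullet> s))) \<partial>\<rho>) \<le>
      (\<integral>\<^sup>+ s. ennreal (2 * max 1 ((norm x)\<^sup>2)) * ennreal (min 1 ((norm s)\<^sup>2)) \<partial>\<rho>)"
  proof (rule nn_integral_mono)
    fix s
    have "(x \<bullet> s)\<^sup>2 \<le> (norm x)\<^sup>2 * (norm s)\<^sup>2"
      using power_mono[OF Cauchy_Schwarz_ineq2[of x s], of 2] by (simp add: power_mult_distrib)
    from one_minus_cos_le[OF this]
    show "ennreal (norm (1 - cos (x \<bullet> s))) \<le> ennreal (2 * max 1 ((norm x)\<^sup>2)) * ennreal (min 1 ((norm s)\<^sup>2))"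
      by (simp flip: ennreal_mult)
  qed
  also have "\<dots> = ennreal (2 * max 1 ((norm x)\<^sup>2)) * (\<integral>\<^sup>+ s. ennreal (min 1 ((norm s)\<^sup>2)) \<partial>\<rho>)"
    by (rule nn_integral_cmult) measurable
  also have "\<dots> < \<infinity>"
    using levy by (simp add: sym_levy_measure_def ennreal_mult_less_top)
  finally show "(\<integral>\<^sup>+ s. ennreal (norm (1 - cos (x \<bullet> s))) \<partial>\<rho>) < \<infinity>" .
qed

lemma levy_fun_nonneg: "0 \<le> levy_fun \<rho> x"
  unfolding levy_fun_def by (intro Bochner_Integration.integral_nonneg) simp

text \<open>The complements of small balls around the origin have finite mass by Markov's inequality
  for \<open>min 1 ((norm s)\<^sup>2)\<close>. The origin lies in none of them and is added as a
  null set.\<close>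

lemma levy_sigma_finite: "sigma_finite_measure \<rho>"
proof
  note [measurable_cong] = levy_sets
  let ?A = "\<lambda>n::nat. {s::'d. 1 / real (Suc n) \<le> norm s}"
  have meas: "?A n \<in> sets \<rho>" for n
    unfolding levy_sets by (auto intro!: borel_closed closed_Collect_le continuous_intros)
  have "emeasure \<rho> (?A n) < \<infinity>" for n
  proof -
    have "emeasure \<rho> (?A n) = (\<integral>\<^sup>+ s. indicator (?A n) s \<partial>\<rho>)" using meas by simp
    also have "\<dots> \<le> (\<integral>\<^sup>+ s. ennreal ((real (Suc n))\<^sup>2) * ennreal (min 1 ((norm s)\<^sup>2)) \<partial>\<rho>)"
    proof (rule nn_integral_mono)
      fix s :: 'd
      have "1 \<le> (real (Suc n))\<^sup>2 * min 1 ((norm s)\<^sup>2)" if "s \<in> ?A n"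
      proof -
        have "1 / real (Suc n) \<le> min 1 (norm s)" using that by simp
        then have "(1 / real (Suc n))\<^sup>2 \<le> (min 1 (norm s))\<^sup>2" by (intro power_mono) auto
        also have "\<dots> = min 1 ((norm s)\<^sup>2)" by (cases "norm s \<le> 1") (simp_all add: min_absorb1 min_absorb2 power_le_one one_le_power)
        finally have "(real (Suc n))\<^sup>2 * (1 / real (Suc n))\<^sup>2 \<le> (real (Suc n))\<^sup>2 * min 1 ((norm s)\<^sup>2)"
          by (rule mult_left_mono) simp
        then show ?thesis by (simp add: power_divide del: of_nat_Suc)
      qed
      then show "indicator (?A n) s \<le> ennreal ((real (Suc n))\<^sup>2) * ennreal (min 1 ((norm s)\<^sup>2))"
        by (auto split: split_indicator simp flip: ennreal_mult simp del: of_nat_Suc)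
    qed
    also have "\<dots> = ennreal ((real (Suc n))\<^sup>2) * (\<integral>\<^sup>+ s. ennreal (min 1 ((norm s)\<^sup>2)) \<partial>\<rho>)"
      by (rule nn_integral_cmult) measurable
    also have "\<dots> < \<infinity>"
      using levy by (simp add: sym_levy_measure_def ennreal_mult_less_top)
    finally show ?thesis .
  qed
  then have fin: "emeasure \<rho> (?A n) \<noteq> \<infinity>" for n by (simp add: less_top)
  have zero: "{0} \<in> sets \<rho>" "emeasure \<rho> {0} \<noteq> \<infinity>"
    using levy by (simp_all add: sym_levy_measure_def)
  have "\<exists>n. 1 / real (Suc n) \<le> norm s" if "s \<noteq> 0" for s :: 'd
    using that reals_Archimedean[of "norm s"] by (auto simp: inverse_eq_divide intro: less_imp_le)
  then have "\<Union> (insert {0} (range ?A)) = space \<rho>"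
    unfolding sets_eq_imp_space_eq[OF levy_sets] by auto
  moreover have "countable (insert {0} (range ?A))" by simp
  moreover have "insert {0} (range ?A) \<subseteq> sets \<rho>" using meas zero(1) by blast
  moreover have "\<forall>a\<in>insert {0} (range ?A). emeasure \<rho> a \<noteq> \<infinity>" using fin zero(2) by blast
  ultimately show "\<exists>A. countable A \<and> A \<subseteq> sets \<rho> \<and> \<Union> A = space \<rho> \<and> (\<forall>a\<in>A. emeasure \<rho> a \<noteq> \<infinity>)"
    by blast
qed

lemma levy_symmetric: "distr \<rho> borel uminus = \<rho>"
proof (rule measure_eqI)
  note [measurable_cong] = levy_sets
  fix B assume "B \<in> sets (distr \<rho> borel uminus)"
  then have B: "B \<in> sets borel" by simp
  have "uminus -` B \<inter> space \<rho> = uminus ` B"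
    using sets_eq_imp_space_eq[OF levy_sets] by (auto intro: image_eqI[of _ _ "- _"])
  then show "emeasure (distr \<rho> borel uminus) B = emeasure \<rho> B"
    using B levy by (subst emeasure_distr) (auto simp: sym_levy_measure_def)
qed (simp add: levy_sets)

lemma nn_integral_levy_uminus:
  assumes [measurable]: "f \<in> borel_measurable borel"
  shows "(\<integral>\<^sup>+ s. f (- s) \<partial>\<rho>) = (\<integral>\<^sup>+ s. f s \<partial>\<rho>)"
proof -
  note [measurable_cong] = levy_sets
  have "(\<integral>\<^sup>+ s. f s \<partial>\<rho>) = (\<integral>\<^sup>+ s. f s \<partial>distr \<rho> borel uminus)" by (simp add: levy_symmetric)
  also have "\<dots> = (\<integral>\<^sup>+ s. f (- s) \<partial>\<rho>)" by (rule nn_integral_distr) auto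
  finally show ?thesis by simp
qed

lemma borel_measurable_levy_fun: "levy_fun \<rho> \<in> borel_measurable borel"
proof -
  interpret sigma_finite_measure \<rho> by (rule levy_sigma_finite)
  note [measurable_cong] = levy_sets
  show ?thesis unfolding levy_fun_def by measurable
qed

end

text \<open>With \<open>c\<close> the characteristic function, 1 - |c|^2 = (1 - |c|)(1 + |c|) is at
  most 2(1 - Re c). Tonelli turns the integral of 1 - Re c against \<open>\<rho>\<close> into the
  expectation of \<open>levy_fun \<rho> (X \<omega>)\<close>. This is how the first moment condition
  yields an integrable variance.\<close>

lemma (in prob_space) char_fun_deficit_integrable:
  fixes X :: "'a \<Rightarrow> 'd::euclidean_space"
  assumes levy: "sym_levy_measure \<rho>"
    and [measurable]: "X \<in> borel_measurable M" and fin: "(\<integral>\<^sup>+\<omega>. ennreal (levy_fun \<rho> (X \<omega>)) \<partial>M) < \<infinity>"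
  shows "(\<integral>\<^sup>+ s. ennreal (1 - (cmod (char_fun M X s))\<^sup>2) \<partial>\<rho>) < \<infinity>"
proof -
  interpret \<rho>: sigma_finite_measure \<rho> by (rule levy_sigma_finite[OF levy])
  interpret pair_sigma_finite \<rho> M ..
  note [measurable_cong] = levy_sets[OF levy]
  have "ennreal (1 - (cmod (char_fun M X s))\<^sup>2) \<le> 2 * (\<integral>\<^sup>+\<omega>. ennreal (1 - cos (X \<omega> \<bullet> s)) \<partial>M)" for s
  proof -
    let ?c = "char_fun M X s"
    have c: "cmod ?c \<le> 1" by (rule cmod_char_fun_le) simp
    have bnd: "norm (1 - cos u) \<le> 2" for u :: real
      using cos_ge_minus_one[of u] cos_le_one[of u] unfolding real_norm_def by linarith
    have int: "integrable M (\<lambda>\<omega>. 1 - cos (X \<omega> \<bullet> s))"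
      using bnd by (intro integrable_const_bound[of _ 2]) auto
    have int': "integrable M (\<lambda>\<omega>. cos (X \<omega> \<bullet> s))"
      by (rule integrable_const_bound[of _ 1]) auto
    have "Re ?c = (\<integral>\<omega>. Re (cis (s \<bullet> X \<omega>)) \<partial>M)"
      unfolding char_fun_def by (rule integral_Re[symmetric]) (rule integrable_cis, simp)
    then have Re: "1 - Re ?c = (\<integral>\<omega>. 1 - cos (X \<omega> \<bullet> s) \<partial>M)"
      using int' by (simp add: prob_space inner_commute)
    have "1 - (cmod ?c)\<^sup>2 = (1 - cmod ?c) * (1 + cmod ?c)"
      by (simp add: power2_eq_square algebra_simps)
    also have "\<dots> \<le> (1 - Re ?c) * 2"
      using c complex_Re_le_cmod[of ?c] by (intro mult_mono) auto
    finally have "ennreal (1 - (cmod ?c)\<^sup>2) \<le> ennreal (2 * (\<integral>\<omega>. 1 - cos (X \<omega> \<bullet> s) \<partial>M))"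
      unfolding Re by (intro ennreal_leI) simp
    also have "\<dots> = 2 * (\<integral>\<^sup>+\<omega>. ennreal (1 - cos (X \<omega> \<bullet> s)) \<partial>M)"
      using nn_integral_eq_integral[OF int] by (simp add: ennreal_mult')
    finally show ?thesis .
  qed
  then have "(\<integral>\<^sup>+ s. ennreal (1 - (cmod (char_fun M X s))\<^sup>2) \<partial>\<rho>)
    \<le> (\<integral>\<^sup>+ s. 2 * (\<integral>\<^sup>+\<omega>. ennreal (1 - cos (X \<omega> \<bullet> s)) \<partial>M) \<partial>\<rho>)"
    by (rule nn_integral_mono)
  also have "\<dots> = 2 * (\<integral>\<^sup>+ s. \<integral>\<^sup>+\<omega>. ennreal (1 - cos (X \<omega> \<bullet> s)) \<partial>M \<partial>\<rho>)"
    by (rule nn_integral_cmult) measurable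
  also have "(\<integral>\<^sup>+ s. \<integral>\<^sup>+\<omega>. ennreal (1 - cos (X \<omega> \<bullet> s)) \<partial>M \<partial>\<rho>) = (\<integral>\<^sup>+\<omega>. \<integral>\<^sup>+ s. ennreal (1 - cos (X \<omega> \<bullet> s)) \<partial>\<rho> \<partial>M)"
    by (rule Fubini'[symmetric]) measurable
  also have "\<dots> = (\<integral>\<^sup>+\<omega>. ennreal (levy_fun \<rho> (X \<omega>)) \<partial>M)"
    unfolding levy_fun_def by (intro nn_integral_cong nn_integral_eq_integral levy_integrable levy) simp
  also have "2 * \<dots> < \<infinity>" using fin by (simp add: ennreal_mult_less_top)
  finally show ?thesis .
qed

section \<open>From the four-fold sum to an integral over the product measure\<close>

lemma (in pair_sigma_finite) integral_product:
  fixes f :: "'a \<Rightarrow> real" and g :: "'b \<Rightarrow> real"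
  assumes f: "integrable M1 f" and g: "integrable M2 g"
  shows "integrable (M1 \<Otimes>\<^sub>M M2) (\<lambda>p. f (fst p) * g (snd p))"
    and "(\<integral>p. f (fst p) * g (snd p) \<partial>(M1 \<Otimes>\<^sub>M M2)) = (\<integral>x. f x \<partial>M1) * (\<integral>y. g y \<partial>M2)"
proof -
  note [measurable] = borel_measurable_integrable[OF f] borel_measurable_integrable[OF g]
  show int: "integrable (M1 \<Otimes>\<^sub>M M2) (\<lambda>p. f (fst p) * g (snd p))"
  proof (rule Fubini_integrable)
    show "integrable M1 (\<lambda>x. \<integral>y. norm (f (fst (x, y)) * g (snd (x, y))) \<partial>M2)"
      using f by (simp add: abs_mult)
  qed (use g in auto)
  show "(\<integral>p. f (fst p) * g (snd p) \<partial>(M1 \<Otimes>\<^sub>M M2)) = (\<integral>x. f x \<partial>M1) * (\<integral>y. g y \<partial>M2)"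
    using integral_fst'[OF int] by simp
qed

text \<open>For distance kernels of rank one, the numerator of the estimator is a perfect square:
  the expression under the square is \<open>n\<^sup>2\<close> times the empirical covariance of
  \<open>a\<close> and \<open>b\<close>. Cosine kernels are sums of two rank-one kernels.\<close>

lemma four_fold_rank_one:
  fixes a b :: "nat \<Rightarrow> real"
  shows "(\<Sum>i<n. \<Sum>j<n. \<Sum>k<n. \<Sum>l<n. (a i * a k) * (b i * b k) - 2 * (a i * a j) * (b i * b l) + (a i * a j) * (b k * b l))
    = (real n * (\<Sum>i<n. a i * b i) - (\<Sum>i<n. a i) * (\<Sum>i<n. b i))\<^sup>2"
proof -
  let ?A = "\<Sum>i<n. a i" and ?B = "\<Sum>i<n. b i" and ?C = "\<Sum>i<n. a i * b i"
  note collect = sum_constant card_lessThan sum_distrib_left[symmetric] sum_distrib_right[symmetric]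
  have perm: "(a i * a j) * (b i * b l) = (a i * b i) * (a j * b l)" for i j l by (simp only: mult_ac)
  have 1: "(\<Sum>i<n. \<Sum>j<n. \<Sum>k<n. \<Sum>l<n. (a i * a k) * (b i * b k)) = (real n)\<^sup>2 * (?C * ?C)"
    unfolding power2_eq_square by (simp only: perm collect; simp only: mult_ac)
  have 2: "(\<Sum>i<n. \<Sum>j<n. \<Sum>k<n. \<Sum>l<n. (a i * a j) * (b i * b l)) = real n * (?C * ?A * ?B)"
    by (simp only: perm collect; simp only: mult_ac)
  have 3: "(\<Sum>i<n. \<Sum>j<n. \<Sum>k<n. \<Sum>l<n. (a i * a j) * (b k * b l)) = ?A * ?A * (?B * ?B)"
    by (simp only: collect)
  have "(\<Sum>i<n. \<Sum>j<n. \<Sum>k<n. \<Sum>l<n. (a i * a k) * (b i * b k) - 2 * (a i * a j) * (b i * b l) + (a i * a j) * (b k * b l))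
    = (real n)\<^sup>2 * (?C * ?C) - 2 * (real n * (?C * ?A * ?B)) + ?A * ?A * (?B * ?B)"
    unfolding 1[symmetric] 2[symmetric] 3[symmetric]
    by (simp only: sum.distrib sum_subtractf sum_distrib_left mult.assoc)
  also have "\<dots> = (real n * ?C - ?A * ?B)\<^sup>2" by (simp add: power2_eq_square algebra_simps)
  finally show ?thesis .
qed

text \<open>The sum is doubly centred. Constants cancel, and terms depending on only one kernel
  cancel after renaming summation indices, so \<open>1 - cos\<close> may be replaced by
  \<open>cos\<close>, the two signs multiplying to one.\<close>

lemma four_fold_one_minus:
  fixes \<alpha> \<beta> :: "nat \<Rightarrow> nat \<Rightarrow> real"
  shows "(\<Sum>i<n. \<Sum>j<n. \<Sum>k<n. \<Sum>l<n. (1 - \<alpha> i k) * (1 - \<beta> i k) - 2 * (1 - \<alpha> i j) * (1 - \<beta> i l) + (1 - \<alpha> i j) * (1 - \<beta> k l))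
    = (\<Sum>i<n. \<Sum>j<n. \<Sum>k<n. \<Sum>l<n. \<alpha> i k * \<beta> i k - 2 * \<alpha> i j * \<beta> i l + \<alpha> i j * \<beta> k l)"
proof -
  have "(\<Sum>i<n. \<Sum>j<n. \<Sum>k<n. \<Sum>l<n. (1 - \<alpha> i k) * (1 - \<beta> i k) - 2 * (1 - \<alpha> i j) * (1 - \<beta> i l) + (1 - \<alpha> i j) * (1 - \<beta> k l))
    = (\<Sum>i<n. \<Sum>j<n. \<Sum>k<n. \<Sum>l<n. (\<alpha> i k * \<beta> i k - 2 * \<alpha> i j * \<beta> i l + \<alpha> i j * \<beta> k l)
        + ((\<alpha> i j - \<alpha> i k) + (\<beta> i l - \<beta> i k) + (\<beta> i l - \<beta> k l)))"
    by (intro sum.cong refl) (simp add: algebra_simps)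
  also have "\<dots> = (\<Sum>i<n. \<Sum>j<n. \<Sum>k<n. \<Sum>l<n. \<alpha> i k * \<beta> i k - 2 * \<alpha> i j * \<beta> i l + \<alpha> i j * \<beta> k l)
      + (\<Sum>i<n. \<Sum>j<n. \<Sum>k<n. \<Sum>l<n. (\<alpha> i j - \<alpha> i k) + (\<beta> i l - \<beta> i k) + (\<beta> i l - \<beta> k l))"
    by (simp only: sum.distrib)
  also have "(\<Sum>i<n. \<Sum>j<n. \<Sum>k<n. \<Sum>l<n. (\<alpha> i j - \<alpha> i k) + (\<beta> i l - \<beta> i k) + (\<beta> i l - \<beta> k l)) = 0"
    by (simp add: sum.distrib sum_subtractf sum_negf flip: sum_distrib_left) (simp add: algebra_simps)
  finally show ?thesis by simp
qed

text \<open>The field Z of the overview: \<open>sqrt n\<close> times the joint empirical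
  characteristic function minus the product of the marginal ones, with the powers of
  \<open>n\<close> arranged so that only one quotient sits inside. At \<open>n = 0\<close> it is
  0.\<close>

definition centred_ecf :: "nat \<Rightarrow> (nat \<Rightarrow> 'a::euclidean_space) \<Rightarrow> (nat \<Rightarrow> 'b::euclidean_space) \<Rightarrow> 'a \<times> 'b \<Rightarrow> complex" where
  "centred_ecf n x y p = ((\<Sum>i<n. cis (fst p \<bullet> x i) * cis (snd p \<bullet> y i))
     - (\<Sum>i<n. cis (fst p \<bullet> x i)) * (\<Sum>i<n. cis (snd p \<bullet> y i)) / of_nat n) / of_real (sqrt n)"

text \<open>The estimator contains only products of cosines, whereas the squared modulus of one
  value also has mixed terms with sines. These are odd in \<open>s\<close>, so they disappear when
  the values at \<open>s\<close> and \<open>- s\<close> are added; a pointwise identity without this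
  step is false in general.\<close>

lemma centred_ecf_symmetrized:
  fixes x :: "nat \<Rightarrow> 'a::euclidean_space" and y :: "nat \<Rightarrow> 'b::euclidean_space"
  shows "(cmod (centred_ecf n x y (s, t)))\<^sup>2 + (cmod (centred_ecf n x y (- s, t)))\<^sup>2 =
    2 * (real n * ((1 / real n ^ 4) * (\<Sum>i<n. \<Sum>j<n. \<Sum>k<n. \<Sum>l<n.
      (1 - cos ((x i - x k) \<bullet> s)) * (1 - cos ((y i - y k) \<bullet> t))
      - 2 * (1 - cos ((x i - x j) \<bullet> s)) * (1 - cos ((y i - y l) \<bullet> t))
      + (1 - cos ((x i - x j) \<bullet> s)) * (1 - cos ((y k - y l) \<bullet> t)))))"
proof (cases "n = 0")
  case False
  define p q u v where "p i = cos (s \<bullet> x i)" and "q i = sin (s \<bullet> x i)"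
    and "u i = cos (t \<bullet> y i)" and "v i = sin (t \<bullet> y i)" for i
  \<comment> \<open>\<open>C\<close> is the unnormalized empirical covariance. The real and
    imaginary parts of the field are sums and differences of such covariances of cosines and
    sines.\<close>
  define C where "C a b = real n * (\<Sum>i<n. a i * b i) - (\<Sum>i<n. a i) * (\<Sum>i<n. b i)" for a b :: "nat \<Rightarrow> real"
  have \<alpha>: "cos ((x i - x j) \<bullet> s) = p i * p j + q i * q j" and \<beta>: "cos ((y i - y j) \<bullet> t) = u i * u j + v i * v j" for i j
    unfolding p_def q_def u_def v_def
    by (simp_all only: inner_diff_left cos_diff inner_commute[of s] inner_commute[of t])
  have "(real n * sqrt n)\<^sup>2 = real n ^ 3"
    by (simp add: power_mult_distrib power3_eq_cube power2_eq_square)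
  then have norm_eq: "(cmod (Complex (r / (n * sqrt n)) (r' / (n * sqrt n))))\<^sup>2 = (r\<^sup>2 + r'\<^sup>2) / real n ^ 3" for r r'
    by (simp only: cmod_power2 complex.sel power_divide add_divide_distrib)
  have fld: "(a - b / n) / sqrt n = (n * a - b) / (n * sqrt n)" for a b :: real
    using False by (simp add: field_simps)
  have parts: "Re (centred_ecf n x y (s, t)) = (((\<Sum>i<n. p i * u i) - (\<Sum>i<n. q i * v i)) - (sum p {..<n} * sum u {..<n} - sum q {..<n} * sum v {..<n}) / n) / sqrt n"
    "Im (centred_ecf n x y (s, t)) = (((\<Sum>i<n. p i * v i) + (\<Sum>i<n. q i * u i)) - (sum p {..<n} * sum v {..<n} + sum q {..<n} * sum u {..<n}) / n) / sqrt n"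
    "Re (centred_ecf n x y (- s, t)) = (((\<Sum>i<n. p i * u i) + (\<Sum>i<n. q i * v i)) - (sum p {..<n} * sum u {..<n} + sum q {..<n} * sum v {..<n}) / n) / sqrt n"
    "Im (centred_ecf n x y (- s, t)) = (((\<Sum>i<n. p i * v i) - (\<Sum>i<n. q i * u i)) - (sum p {..<n} * sum v {..<n} - sum q {..<n} * sum u {..<n}) / n) / sqrt n"
    unfolding centred_ecf_def p_def q_def u_def v_def
    by (simp_all add: sum.distrib sum_subtractf sum_negf)
  have Z1: "centred_ecf n x y (s, t) = Complex ((C p u - C q v) / (n * sqrt n)) ((C p v + C q u) / (n * sqrt n))"
    by (rule complex_eqI; unfold parts fld C_def complex.sel; simp add: algebra_simps)
  have Z2: "centred_ecf n x y (- s, t) = Complex ((C p u + C q v) / (n * sqrt n)) ((C p v - C q u) / (n * sqrt n))"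
    by (rule complex_eqI; unfold parts fld C_def complex.sel; simp add: algebra_simps)
  have "(\<Sum>i<n. \<Sum>j<n. \<Sum>k<n. \<Sum>l<n.
      (1 - cos ((x i - x k) \<bullet> s)) * (1 - cos ((y i - y k) \<bullet> t))
      - 2 * (1 - cos ((x i - x j) \<bullet> s)) * (1 - cos ((y i - y l) \<bullet> t))
      + (1 - cos ((x i - x j) \<bullet> s)) * (1 - cos ((y k - y l) \<bullet> t))) =
    (\<Sum>i<n. \<Sum>j<n. \<Sum>k<n. \<Sum>l<n. (p i * p k + q i * q k) * (u i * u k + v i * v k)
      - 2 * (p i * p j + q i * q j) * (u i * u l + v i * v l) + (p i * p j + q i * q j) * (u k * u l + v k * v l))"
    unfolding \<alpha> \<beta> by (rule four_fold_one_minus)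
  \<comment> \<open>By the addition theorem each kernel is a cosine part plus a sine part of rank
    one; the bilinear form splits into four forms, each a square.\<close>
  also have "\<dots> = (\<Sum>i<n. \<Sum>j<n. \<Sum>k<n. \<Sum>l<n.
      ((p i * p k) * (u i * u k) - 2 * (p i * p j) * (u i * u l) + (p i * p j) * (u k * u l)) +
      ((q i * q k) * (v i * v k) - 2 * (q i * q j) * (v i * v l) + (q i * q j) * (v k * v l)) +
      ((p i * p k) * (v i * v k) - 2 * (p i * p j) * (v i * v l) + (p i * p j) * (v k * v l)) +
      ((q i * q k) * (u i * u k) - 2 * (q i * q j) * (u i * u l) + (q i * q j) * (u k * u l)))"
    by (intro sum.cong refl) (simp add: algebra_simps)
  also have "\<dots> = (C p u)\<^sup>2 + (C q v)\<^sup>2 + (C p v)\<^sup>2 + (C q u)\<^sup>2"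
    unfolding C_def four_fold_rank_one[symmetric] by (simp only: sum.distrib)
  finally have S: "(\<Sum>i<n. \<Sum>j<n. \<Sum>k<n. \<Sum>l<n.
      (1 - cos ((x i - x k) \<bullet> s)) * (1 - cos ((y i - y k) \<bullet> t))
      - 2 * (1 - cos ((x i - x j) \<bullet> s)) * (1 - cos ((y i - y l) \<bullet> t))
      + (1 - cos ((x i - x j) \<bullet> s)) * (1 - cos ((y k - y l) \<bullet> t))) =
    (C p u)\<^sup>2 + (C q v)\<^sup>2 + (C p v)\<^sup>2 + (C q u)\<^sup>2" .
  have n4: "real n * (1 / real n ^ 4 * r) = r / real n ^ 3" for r
    using False by (simp add: power3_eq_cube power4_eq_xxxx)
  show ?thesis
    unfolding S n4 Z1 Z2 norm_eq by (simp add: power2_eq_square algebra_simps add_divide_distrib diff_divide_distrib)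
qed (simp add: centred_ecf_def)

lemma borel_measurable_centred_ecf: "centred_ecf n x y \<in> borel_measurable borel"
  unfolding centred_ecf_def by (simp flip: borel_prod)

text \<open>Integrating the symmetrized identity term by term turns each \<open>1 - cos\<close> into
  a value of \<open>levy_fun\<close>. Symmetry of \<open>\<mu>\<close> makes the two squared moduli
  contribute equally, so the factor 2 cancels.\<close>

lemma dcov_hat_eq_nn_integral:
  fixes \<mu> :: "'a::euclidean_space measure" and \<nu> :: "'b::euclidean_space measure"
  assumes \<mu>: "sym_levy_measure \<mu>" and \<nu>: "sym_levy_measure \<nu>"
  shows "0 \<le> real n * dcov_hat (levy_fun \<mu>) (levy_fun \<nu>) n x y"
    and "(\<integral>\<^sup>+p. ennreal ((cmod (centred_ecf n x y p))\<^sup>2) \<partial>(\<mu> \<Otimes>\<^sub>M \<nu>)) =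
      ennreal (real n * dcov_hat (levy_fun \<mu>) (levy_fun \<nu>) n x y)"
proof -
  interpret \<mu>: sigma_finite_measure \<mu> by (rule levy_sigma_finite[OF \<mu>])
  interpret \<nu>: sigma_finite_measure \<nu> by (rule levy_sigma_finite[OF \<nu>])
  interpret pair_sigma_finite \<mu> \<nu> ..
  note [measurable_cong] = levy_sets[OF \<mu>] levy_sets[OF \<nu>]
  let ?V = "real n * dcov_hat (levy_fun \<mu>) (levy_fun \<nu>) n x y"
  let ?a = "\<lambda>i j s. 1 - cos ((x i - x j) \<bullet> s)" and ?b = "\<lambda>i j t. 1 - cos ((y i - y j) \<bullet> t)"
  let ?Z = "centred_ecf n x y"
  define H where "H p = real n * ((1 / real n ^ 4) * (\<Sum>i<n. \<Sum>j<n. \<Sum>k<n. \<Sum>l<n.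
      ?a i k (fst p) * ?b i k (snd p) - 2 * ?a i j (fst p) * ?b i l (snd p) + ?a i j (fst p) * ?b k l (snd p)))" for p
  have prod: "integrable (\<mu> \<Otimes>\<^sub>M \<nu>) (\<lambda>p. ?a i j (fst p) * ?b k l (snd p))"
    "(\<integral>p. ?a i j (fst p) * ?b k l (snd p) \<partial>(\<mu> \<Otimes>\<^sub>M \<nu>)) = levy_fun \<mu> (x i - x j) * levy_fun \<nu> (y k - y l)" for i j k l
    unfolding levy_fun_def by (intro integral_product levy_integrable \<mu> \<nu>)+
  have H_int: "integrable (\<mu> \<Otimes>\<^sub>M \<nu>) H"
    unfolding H_def mult.assoc[of 2]
    by (intro integrable_mult_right Bochner_Integration.integrable_sum Bochner_Integration.integrable_add
        Bochner_Integration.integrable_diff prod)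
  have H_eq: "(\<integral>p. H p \<partial>(\<mu> \<Otimes>\<^sub>M \<nu>)) = ?V"
    unfolding H_def mult.assoc[of 2] dcov_hat_def by (simp add: prod)
  have Z_meas: "(\<lambda>p. ennreal ((cmod (?Z p))\<^sup>2)) \<in> borel_measurable (borel \<Otimes>\<^sub>M borel)"
    using borel_measurable_centred_ecf[of n x y] by (simp add: borel_prod)
  have sym: "(cmod (?Z p))\<^sup>2 + (cmod (?Z (- fst p, snd p)))\<^sup>2 = 2 * H p" for p
    using centred_ecf_symmetrized[of n x y "fst p" "snd p"] by (simp add: H_def)
  have H0: "0 \<le> H p" for p
    using sym[of p] zero_le_power2[of "cmod (?Z p)"] zero_le_power2[of "cmod (?Z (- fst p, snd p))"] by linarith
  show V0: "0 \<le> ?V"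
    unfolding H_eq[symmetric] using H0 by (intro Bochner_Integration.integral_nonneg) auto
  let ?I = "\<integral>\<^sup>+p. ennreal ((cmod (?Z p))\<^sup>2) \<partial>(\<mu> \<Otimes>\<^sub>M \<nu>)"
  have Z_meas' [measurable]: "(\<lambda>p. ennreal ((cmod (?Z p))\<^sup>2)) \<in> borel_measurable (\<mu> \<Otimes>\<^sub>M \<nu>)"
    using Z_meas by measurable
  have flip_meas: "(\<lambda>p. (- fst p, snd p)) \<in> \<mu> \<Otimes>\<^sub>M \<nu> \<rightarrow>\<^sub>M borel \<Otimes>\<^sub>M borel" by measurable
  note flip_Z = measurable_compose[OF flip_meas Z_meas]
  have "(\<integral>\<^sup>+p. ennreal ((cmod (?Z (- fst p, snd p)))\<^sup>2) \<partial>(\<mu> \<Otimes>\<^sub>M \<nu>)) =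
      (\<integral>\<^sup>+ t. \<integral>\<^sup>+ s. ennreal ((cmod (?Z (- s, t)))\<^sup>2) \<partial>\<mu> \<partial>\<nu>)"
    using nn_integral_snd[OF flip_Z] by simp
  also have "\<dots> = (\<integral>\<^sup>+ t. \<integral>\<^sup>+ s. ennreal ((cmod (?Z (s, t)))\<^sup>2) \<partial>\<mu> \<partial>\<nu>)"
  proof (rule nn_integral_cong)
    fix t :: 'b
    have "(\<lambda>s. ennreal ((cmod (?Z (s, t)))\<^sup>2)) \<in> borel_measurable borel"
      using measurable_Pair1[OF Z_meas, of t] by simp
    then show "(\<integral>\<^sup>+ s. ennreal ((cmod (?Z (- s, t)))\<^sup>2) \<partial>\<mu>) = (\<integral>\<^sup>+ s. ennreal ((cmod (?Z (s, t)))\<^sup>2) \<partial>\<mu>)"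
      by (rule nn_integral_levy_uminus[OF \<mu>])
  qed
  also have "\<dots> = ?I" by (rule nn_integral_snd) measurable
  finally have "?I + ?I = (\<integral>\<^sup>+p. ennreal ((cmod (?Z p))\<^sup>2) + ennreal ((cmod (?Z (- fst p, snd p)))\<^sup>2) \<partial>(\<mu> \<Otimes>\<^sub>M \<nu>))"
    using nn_integral_snd[OF flip_Z] nn_integral_add[OF Z_meas' flip_Z] by simp
  also have "\<dots> = (\<integral>\<^sup>+p. ennreal (2 * H p) \<partial>(\<mu> \<Otimes>\<^sub>M \<nu>))"
    unfolding sym[symmetric] by (simp add: ennreal_plus)
  also have "\<dots> = ennreal (\<integral>p. 2 * H p \<partial>(\<mu> \<Otimes>\<^sub>M \<nu>))"
    using H_int H0 by (intro nn_integral_eq_integral) auto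
  also have "\<dots> = ennreal ?V + ennreal ?V"
    using V0 by (simp add: H_eq flip: ennreal_plus)
  finally have *: "?I + ?I = ennreal ?V + ennreal ?V" .
  \<comment> \<open>The factor 2 is cancelled in the reals, for which \<open>?I\<close> must first
    be known to be finite.\<close>
  then have "?I + ?I < top" by simp
  then have "?I < top" by (rule le_less_trans[rotated]) (simp add: add_increasing)
  then obtain r where r: "?I = ennreal r" "0 \<le> r" by (cases ?I) auto
  with * V0 have "r + r = ?V + ?V" by (simp flip: ennreal_plus)
  then show "?I = ennreal ?V" using r by simp
qed

section \<open>The limit theorem\<close>

context iid_pairs
begin

lemma empirical_meas [measurable]: "empirical n p \<in> borel_measurable M"
  using measurable_Pair2[OF empirical_meas2, of p] by simp

text \<open>A linear combination of values of the empirical field is itself a normalized sum of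
  i.i.d. bounded centred variables. Its limit and the Gaussian side are both determined by a second
  moment, and the two second moments agree because both fields are Hermitian with the same
  kernel.\<close>

lemma empirical_fidi_char:
  fixes G :: "'a \<times> 'b \<Rightarrow> 'q \<Rightarrow> complex" and a b :: "'a \<times> 'b \<Rightarrow> real"
  assumes P: "prob_space P" and G: "hermitian_field P G kernel"
    and G_int: "\<And>p. integrable P (G p)" and G_mean: "\<And>p. (CLINT \<omega>|P. G p \<omega>) = 0"
    and S: "finite S"
    and gauss: "real_gaussian_rv P (\<lambda>\<omega>. \<Sum>p\<in>S. a p * Re (G p \<omega>) + b p * Im (G p \<omega>))"
  shows "(\<lambda>n. CLINT \<omega>|M. cis (\<Sum>p\<in>S. a p * Re (empirical n p \<omega>) + b p * Im (empirical n p \<omega>)))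
    \<longlonglongrightarrow> (CLINT \<omega>|P. cis (\<Sum>p\<in>S. a p * Re (G p \<omega>) + b p * Im (G p \<omega>)))"
proof -
  interpret G: hermitian_field P G kernel by fact
  define h where "h z = (\<Sum>p\<in>S. a p * Re (feature p z) + b p * Im (feature p z))" for z
  have h_meas [measurable]: "h \<in> borel_measurable borel" unfolding h_def by measurable
  have Z_meas [measurable]: "(\<lambda>\<omega>. h (Xs i \<omega>, Ys i \<omega>)) \<in> borel_measurable M" for i
    using measurable_compose[OF sample_meas h_meas] by simp
  have feature_int: "integrable M (\<lambda>\<omega>. feature p (X \<omega>, Y \<omega>))" for p
    by (rule integrable_const_bound[of _ 4]) (auto simp: cmod_feature_le)
  have "\<bar>h z\<bar> \<le> (\<Sum>p\<in>S. \<bar>a p\<bar> * 4 + \<bar>b p\<bar> * 4)" for z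
    unfolding h_def
  proof (rule order_trans[OF sum_abs sum_mono])
    fix p
    have "\<bar>Re (feature p z)\<bar> \<le> 4" "\<bar>Im (feature p z)\<bar> \<le> 4"
      using abs_Re_le_cmod[of "feature p z"] abs_Im_le_cmod[of "feature p z"] cmod_feature_le[of p z] by linarith+
    then show "\<bar>a p * Re (feature p z) + b p * Im (feature p z)\<bar> \<le> \<bar>a p\<bar> * 4 + \<bar>b p\<bar> * 4"
      by (intro order_trans[OF abs_triangle_ineq] add_mono) (auto simp: abs_mult intro: mult_left_mono)
  qed
  then obtain B where h_bnd: "\<And>z. \<bar>h z\<bar> \<le> B" by blast
  have "(\<lambda>n. CLINT \<omega>|M. cis ((\<Sum>i<n. h (Xs i \<omega>, Ys i \<omega>)) / sqrt n)) \<longlonglongrightarrow>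
      exp (- (\<integral>\<omega>. (h (Xs 0 \<omega>, Ys 0 \<omega>))\<^sup>2 \<partial>M) / 2)"
  proof (rule clt_char)
    show "indep_vars (\<lambda>_. borel) (\<lambda>i \<omega>. h (Xs i \<omega>, Ys i \<omega>)) UNIV"
      by (rule indep_vars_compose2[OF iid_indep]) simp
    show "distr M borel (\<lambda>\<omega>. h (Xs i \<omega>, Ys i \<omega>)) = distr M borel (\<lambda>\<omega>. h (Xs 0 \<omega>, Ys 0 \<omega>))" for i
      using distr_distr[OF h_meas sample_meas[of i]] distr_distr[OF h_meas sample_meas[of 0]]
      by (simp add: comp_def iid_distr)
    show "integrable M (\<lambda>\<omega>. (h (Xs 0 \<omega>, Ys 0 \<omega>))\<^sup>2)"
      using power_mono[OF h_bnd abs_ge_zero, where n = 2]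
      by (intro integrable_const_bound[of _ "B\<^sup>2"]) auto
    have "(\<integral>\<omega>. h (Xs 0 \<omega>, Ys 0 \<omega>) \<partial>M) = (\<integral>\<omega>. h (X \<omega>, Y \<omega>) \<partial>M)"
      by (rule integral_sample) simp
    also have "\<dots> = (\<Sum>p\<in>S. a p * Re (CLINT \<omega>|M. feature p (X \<omega>, Y \<omega>)) + b p * Im (CLINT \<omega>|M. feature p (X \<omega>, Y \<omega>)))"
      unfolding h_def using feature_int by simp
    finally show "(\<integral>\<omega>. h (Xs 0 \<omega>, Ys 0 \<omega>) \<partial>M) = 0" by (simp add: feature_mean)
  qed
  moreover have "(\<Sum>i<n. h (Xs i \<omega>, Ys i \<omega>)) / sqrt n =
      (\<Sum>p\<in>S. a p * Re (empirical n p \<omega>) + b p * Im (empirical n p \<omega>))" for n \<omega>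
  proof -
    have "(\<Sum>i<n. h (Xs i \<omega>, Ys i \<omega>)) =
      (\<Sum>p\<in>S. \<Sum>i<n. a p * Re (feature p (Xs i \<omega>, Ys i \<omega>)) + b p * Im (feature p (Xs i \<omega>, Ys i \<omega>)))"
      unfolding h_def by (rule sum.swap)
    then show ?thesis
      by (simp add: empirical_def sum_divide_distrib sum.distrib sum_distrib_left add_divide_distrib)
  qed
  moreover have "(\<integral>\<omega>. (h (Xs 0 \<omega>, Ys 0 \<omega>))\<^sup>2 \<partial>M) =
      (\<integral>\<omega>. (\<Sum>p\<in>S. a p * Re (G p \<omega>) + b p * Im (G p \<omega>))\<^sup>2 \<partial>P)"
  proof -
    have "(\<integral>\<omega>. (h (Xs 0 \<omega>, Ys 0 \<omega>))\<^sup>2 \<partial>M) = (\<integral>\<omega>. (h (X \<omega>, Y \<omega>))\<^sup>2 \<partial>M)"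
      by (rule integral_sample[where h = "\<lambda>z. (h z)\<^sup>2"]) simp
    then show ?thesis
      unfolding h_def feature.linear_combination_second_moment[OF S] G.linear_combination_second_moment[OF S] .
  qed
  moreover have "(\<integral>\<omega>. (\<Sum>p\<in>S. a p * Re (G p \<omega>) + b p * Im (G p \<omega>)) \<partial>P) = 0"
    using G_int by (simp add: G_mean)
  ultimately show ?thesis
    using char_centered_real_gaussian_rv[OF P gauss] by simp
qed

lemma empirical_fidi_laplace:
  fixes G :: "'a \<times> 'b \<Rightarrow> 'q \<Rightarrow> complex"
  assumes P: "prob_space P" and G: "hermitian_field P G kernel"
    and G_int: "\<And>p. integrable P (G p)" and G_mean: "\<And>p. (CLINT \<omega>|P. G p \<omega>) = 0"
    and gauss: "\<And>S a b. finite S \<Longrightarrow> real_gaussian_rv P (\<lambda>\<omega>. \<Sum>p\<in>S. a p * Re (G p \<omega>) + b p * Im (G p \<omega>))"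
    and S: "finite S" and c: "\<And>p. 0 \<le> c p"
  shows "(\<lambda>n. \<integral>\<omega>. exp (- (\<Sum>p\<in>S. c p * (cmod (empirical n p \<omega>))\<^sup>2)) \<partial>M) \<longlonglongrightarrow>
        (\<integral>\<omega>. exp (- (\<Sum>p\<in>S. c p * (cmod (G p \<omega>))\<^sup>2)) \<partial>P)"
proof -
  interpret G: hermitian_field P G kernel by fact
  \<comment> \<open>The index set is doubled to list real and imaginary parts separately, and the
    factor \<open>sqrt (2 * c p)\<close> is chosen so that half the sum of squares is exactly the
    wanted quadratic form.\<close>
  define part :: "bool \<Rightarrow> complex \<Rightarrow> real" where "part r z = (if r then Re z else Im z)" for r z
  define U where "U n i \<omega> = sqrt (2 * c (fst i)) * part (snd i) (empirical n (fst i) \<omega>)" for n i \<omega>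
  define V where "V i \<omega> = sqrt (2 * c (fst i)) * part (snd i) (G (fst i) \<omega>)" for i \<omega>
  have split: "(\<Sum>i\<in>S \<times> UNIV. f i) = (\<Sum>p\<in>S. f (p, True) + f (p, False))" for f :: "_ \<Rightarrow> real"
    by (simp add: sum.cartesian_product' UNIV_bool add.commute)
  have lin: "(\<Sum>i\<in>S \<times> UNIV. a i * (sqrt (2 * c (fst i)) * part (snd i) (z (fst i)))) =
      (\<Sum>p\<in>S. a (p, True) * sqrt (2 * c p) * Re (z p) + a (p, False) * sqrt (2 * c p) * Im (z p))" for a z
    unfolding split by (simp add: part_def mult.assoc)
  have quad: "(\<Sum>i\<in>S \<times> UNIV. (sqrt (2 * c (fst i)) * part (snd i) (z (fst i)))\<^sup>2 / 2) = (\<Sum>p\<in>S. c p * (cmod (z p))\<^sup>2)" for z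
    unfolding split using c by (simp add: part_def power_mult_distrib cmod_power2 distrib_left)
  have linU: "(\<Sum>i\<in>S \<times> UNIV. a i * U n i \<omega>) = (\<Sum>p\<in>S. a (p, True) * sqrt (2 * c p) * Re (empirical n p \<omega>)
      + a (p, False) * sqrt (2 * c p) * Im (empirical n p \<omega>))" for a n \<omega>
    unfolding U_def by (rule lin)
  have linV: "(\<Sum>i\<in>S \<times> UNIV. a i * V i \<omega>) = (\<Sum>p\<in>S. a (p, True) * sqrt (2 * c p) * Re (G p \<omega>)
      + a (p, False) * sqrt (2 * c p) * Im (G p \<omega>))" for a \<omega>
    unfolding V_def by (rule lin)
  have quadU: "(\<Sum>i\<in>S \<times> UNIV. (U n i \<omega>)\<^sup>2 / 2) = (\<Sum>p\<in>S. c p * (cmod (empirical n p \<omega>))\<^sup>2)" for n \<omega>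
    unfolding U_def by (rule quad)
  have quadV: "(\<Sum>i\<in>S \<times> UNIV. (V i \<omega>)\<^sup>2 / 2) = (\<Sum>p\<in>S. c p * (cmod (G p \<omega>))\<^sup>2)" for \<omega>
    unfolding V_def by (rule quad)
  have "(\<lambda>n. \<integral>\<omega>. exp (- (\<Sum>i\<in>S \<times> UNIV. (U n i \<omega>)\<^sup>2 / 2)) \<partial>M) \<longlonglongrightarrow>
      (\<integral>\<omega>. exp (- (\<Sum>i\<in>S \<times> UNIV. (V i \<omega>)\<^sup>2 / 2)) \<partial>P)"
  proof (rule gaussian_randomization)
    show "prob_space M" by (rule prob_space_axioms)
    show "U n i \<in> borel_measurable M" for n i unfolding U_def part_def by (cases "snd i") simp_all
    show "V i \<in> borel_measurable P" for i unfolding V_def part_def by (cases "snd i") simp_all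
    show "(\<lambda>n. CLINT \<omega>|M. cis (\<Sum>i\<in>S \<times> UNIV. a i * U n i \<omega>)) \<longlonglongrightarrow> (CLINT \<omega>|P. cis (\<Sum>i\<in>S \<times> UNIV. a i * V i \<omega>))" for a
      unfolding linU linV by (rule empirical_fidi_char[OF P G G_int G_mean S gauss[OF S]])
  qed (use P S in auto)
  then show ?thesis unfolding quadU quadV .
qed

text \<open>Expanding both fields, the terms linear in the marginal sums combine so that only a
  product of two centred sums remains. Each of these is of order \<open>sqrt n\<close>, hence the
  difference is of order \<open>1 / sqrt n\<close>.\<close>

lemma empirical_minus_centred_ecf:
  "empirical n p \<omega> - centred_ecf n (\<lambda>i. Xs i \<omega>) (\<lambda>i. Ys i \<omega>) p =
    ((\<Sum>i<n. cis (fst p \<bullet> Xs i \<omega>) - char_fun M X (fst p)) * (\<Sum>i<n. cis (snd p \<bullet> Ys i \<omega>) - char_fun M Y (snd p)))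
      / of_real (real n * sqrt n)"
proof (cases "n = 0")
  case False
  define A B AB c d where "A = (\<Sum>i<n. cis (fst p \<bullet> Xs i \<omega>))" and "B = (\<Sum>i<n. cis (snd p \<bullet> Ys i \<omega>))"
    and "AB = (\<Sum>i<n. cis (fst p \<bullet> Xs i \<omega>) * cis (snd p \<bullet> Ys i \<omega>))"
    and "c = char_fun M X (fst p)" and "d = char_fun M Y (snd p)"
  define w where "w = complex_of_real (sqrt n)"
  have n0: "complex_of_nat n \<noteq> 0" and w0: "w \<noteq> 0" using False by (auto simp: w_def)
  have e: "empirical n p \<omega> = (AB - A * d - c * B + of_nat n * (c * d)) / w"
    unfolding empirical_def feature_def A_def B_def AB_def w_def c_def[symmetric] d_def[symmetric]
    by (simp add: algebra_simps sum.distrib sum_subtractf sum_distrib_left sum_distrib_right)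
  have z: "centred_ecf n (\<lambda>i. Xs i \<omega>) (\<lambda>i. Ys i \<omega>) p = (AB - A * B / of_nat n) / w"
    unfolding centred_ecf_def A_def B_def AB_def w_def ..
  have r: "(\<Sum>i<n. cis (fst p \<bullet> Xs i \<omega>) - c) * (\<Sum>i<n. cis (snd p \<bullet> Ys i \<omega>) - d) / of_real (real n * sqrt n)
     = (A - of_nat n * c) * (B - of_nat n * d) / (of_nat n * w)"
    unfolding A_def B_def w_def by (simp add: sum_subtractf)
  show ?thesis
    unfolding e z c_def[symmetric] d_def[symmetric] r using n0 w0 by (simp add: field_simps)
qed (simp add: empirical_def centred_ecf_def)

text \<open>The bound is \<open>1 / n\<close> times the same variance that dominates the fields, so
  it stays integrable over the product of the Levy measures. At \<open>n = 0\<close> both sides are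
  0, since \<open>1 / 0 = 0\<close>.\<close>

lemma remainder_second_moment:
  "(\<integral>\<^sup>+\<omega>. ennreal ((cmod (empirical n p \<omega> - centred_ecf n (\<lambda>i. Xs i \<omega>) (\<lambda>i. Ys i \<omega>) p))\<^sup>2) \<partial>M)
    = ennreal (1 / n) * ennreal (Re (kernel p p))"
proof (cases "n = 0")
  case False
  define a where "a x = cis (fst p \<bullet> x) - char_fun M X (fst p)" for x
  define b where "b y = cis (snd p \<bullet> y) - char_fun M Y (snd p)" for y
  have [measurable]: "a \<in> borel_measurable borel" "b \<in> borel_measurable borel"
    unfolding a_def b_def by measurable
  have ab: "cmod (a x) \<le> 2" "cmod (b y) \<le> 2" for x y
    unfolding a_def b_def by (intro cmod_centred_character_le X Y)+
  have mean: "(CLINT \<omega>|M. a (X \<omega>)) = 0" "(CLINT \<omega>|M. b (Y \<omega>)) = 0"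
    unfolding a_def b_def by (intro centred_character_mean X Y)+
  let ?va = "\<integral>\<omega>. (cmod (a (X \<omega>)))\<^sup>2 \<partial>M" and ?vb = "\<integral>\<omega>. (cmod (b (Y \<omega>)))\<^sup>2 \<partial>M"
  have le: "cmod (char_fun M X s) \<le> 1" "cmod (char_fun M Y t) \<le> 1" for s t
    by (intro cmod_char_fun_le X Y)+
  have "integrable M (\<lambda>\<omega>. (cmod (a (X \<omega>)))\<^sup>2)" "integrable M (\<lambda>\<omega>. (cmod (b (Y \<omega>)))\<^sup>2)"
    using power_mono[OF ab(1) norm_ge_zero, where n = 2] power_mono[OF ab(2) norm_ge_zero, where n = 2]
    by (auto intro!: integrable_const_bound[of _ "2\<^sup>2"])
  from this[THEN nn_integral_eq_integral]
  have "ennreal ?va = ennreal (1 - (cmod (char_fun M X (fst p)))\<^sup>2)" "ennreal ?vb = ennreal (1 - (cmod (char_fun M Y (snd p)))\<^sup>2)"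
    unfolding a_def b_def centred_character_second_moment[OF X] centred_character_second_moment[OF Y] by simp_all
  then have v: "?va = 1 - (cmod (char_fun M X (fst p)))\<^sup>2" "?vb = 1 - (cmod (char_fun M Y (snd p)))\<^sup>2"
    using le by (simp_all add: power_le_one)
  have "(\<integral>\<^sup>+\<omega>. ennreal ((cmod (empirical n p \<omega> - centred_ecf n (\<lambda>i. Xs i \<omega>) (\<lambda>i. Ys i \<omega>) p))\<^sup>2) \<partial>M)
    = (\<integral>\<^sup>+\<omega>. ennreal (1 / real n ^ 3) * ennreal ((cmod ((\<Sum>i<n. a (Xs i \<omega>)) * (\<Sum>i<n. b (Ys i \<omega>))))\<^sup>2) \<partial>M)"
  proof (rule nn_integral_cong)
    fix \<omega>
    have "(real n * sqrt n)\<^sup>2 = real n ^ 3"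
      by (simp add: power_mult_distrib power3_eq_cube power2_eq_square)
    then show "ennreal ((cmod (empirical n p \<omega> - centred_ecf n (\<lambda>i. Xs i \<omega>) (\<lambda>i. Ys i \<omega>) p))\<^sup>2)
      = ennreal (1 / real n ^ 3) * ennreal ((cmod ((\<Sum>i<n. a (Xs i \<omega>)) * (\<Sum>i<n. b (Ys i \<omega>))))\<^sup>2)"
      unfolding empirical_minus_centred_ecf a_def[symmetric] b_def[symmetric] norm_divide power_divide norm_of_real power2_abs
      by (simp flip: ennreal_mult)
  qed
  also have "\<dots> = ennreal (1 / real n ^ 3) * (\<integral>\<^sup>+\<omega>. ennreal ((cmod ((\<Sum>i<n. a (Xs i \<omega>)) * (\<Sum>i<n. b (Ys i \<omega>))))\<^sup>2) \<partial>M)"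
    by (rule nn_integral_cmult) measurable
  also have "\<dots> = ennreal (1 / real n ^ 3) * ennreal (n * n * (?va * ?vb))"
    using product_sum_second_moment[OF _ _ ab _ mean, of n] by simp
  also have "\<dots> = ennreal (1 / real n ^ 3 * (n * n * (?va * ?vb)))"
    by (rule ennreal_mult[symmetric]) auto
  also have "1 / real n ^ 3 * (n * n * (?va * ?vb)) = 1 / n * (?va * ?vb)"
    using False by (simp add: power3_eq_cube)
  also have "ennreal \<dots> = ennreal (1 / n) * ennreal (Re (kernel p p))"
    unfolding kernel_diag v[symmetric] by (rule ennreal_mult) auto
  finally show ?thesis .
qed (simp add: empirical_def centred_ecf_def)

text \<open>The variance is a function of \<open>s\<close> times a function of \<open>t\<close>, so
  Tonelli reduces the claim to the two marginal deficits.\<close>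

lemma kernel_diag_finite:
  assumes \<mu>: "sym_levy_measure \<mu>" and \<nu>: "sym_levy_measure \<nu>"
    and fin: "(\<integral>\<^sup>+\<omega>. ennreal (levy_fun \<mu> (X \<omega>)) \<partial>M) < \<infinity>" "(\<integral>\<^sup>+\<omega>. ennreal (levy_fun \<nu> (Y \<omega>)) \<partial>M) < \<infinity>"
  shows "(\<integral>\<^sup>+p. ennreal (Re (kernel p p)) \<partial>(\<mu> \<Otimes>\<^sub>M \<nu>)) < \<infinity>"
proof -
  interpret \<mu>: sigma_finite_measure \<mu> by (rule levy_sigma_finite[OF \<mu>])
  interpret \<nu>: sigma_finite_measure \<nu> by (rule levy_sigma_finite[OF \<nu>])
  note [measurable_cong] = levy_sets[OF \<mu>] levy_sets[OF \<nu>]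
  let ?f = "\<lambda>s. ennreal (1 - (cmod (char_fun M X s))\<^sup>2)" and ?g = "\<lambda>t. ennreal (1 - (cmod (char_fun M Y t))\<^sup>2)"
  have "cmod (char_fun M X s) \<le> 1" "cmod (char_fun M Y t) \<le> 1" for s t
    by (intro cmod_char_fun_le X Y)+
  then have "(\<integral>\<^sup>+p. ennreal (Re (kernel p p)) \<partial>(\<mu> \<Otimes>\<^sub>M \<nu>)) = (\<integral>\<^sup>+p. ?f (fst p) * ?g (snd p) \<partial>(\<mu> \<Otimes>\<^sub>M \<nu>))"
    by (intro nn_integral_cong) (simp add: kernel_diag ennreal_mult power_le_one)
  also have "\<dots> = (\<integral>\<^sup>+s. \<integral>\<^sup>+t. ?f s * ?g t \<partial>\<nu> \<partial>\<mu>)"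
    by (subst \<nu>.nn_integral_fst[symmetric]) simp_all
  also have "\<dots> = (\<integral>\<^sup>+s. ?f s \<partial>\<mu>) * (\<integral>\<^sup>+t. ?g t \<partial>\<nu>)"
    by (simp add: nn_integral_cmult nn_integral_multc)
  also have "\<dots> < \<infinity>"
    using char_fun_deficit_integrable[OF \<mu> X fin(1)] char_fun_deficit_integrable[OF \<nu> Y fin(2)]
    by (simp add: ennreal_mult_less_top)
  finally show ?thesis .
qed

section \<open>Distance in mean between the estimator and the empirical integral\<close>

lemma centred_ecf_meas2:
  "(\<lambda>(p, \<omega>). centred_ecf n (\<lambda>i. Xs i \<omega>) (\<lambda>i. Ys i \<omega>) p) \<in> borel_measurable (borel \<Otimes>\<^sub>M M)"
  unfolding centred_ecf_def split_beta' borel_prod[symmetric] by measurable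

lemma dcov_hat_meas:
  assumes \<mu>: "sym_levy_measure \<mu>" and \<nu>: "sym_levy_measure \<nu>"
  shows "(\<lambda>\<omega>. real n * dcov_hat (levy_fun \<mu>) (levy_fun \<nu>) n (\<lambda>i. Xs i \<omega>) (\<lambda>i. Ys i \<omega>)) \<in> borel_measurable M"
proof -
  note [measurable] = borel_measurable_levy_fun[OF \<mu>] borel_measurable_levy_fun[OF \<nu>]
  show ?thesis unfolding dcov_hat_def by measurable
qed

lemma dcov_hat_empirical_distance:
  assumes \<mu>: "sym_levy_measure \<mu>" and \<nu>: "sym_levy_measure \<nu>" and n: "n > 0"
    and K: "(\<integral>\<^sup>+p. ennreal (Re (kernel p p)) \<partial>(\<mu> \<Otimes>\<^sub>M \<nu>)) = ennreal K" "0 \<le> K"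
  shows "(\<integral>\<^sup>+\<omega>. ennreal \<bar>enn2real (\<integral>\<^sup>+p. ennreal ((cmod (empirical n p \<omega>))\<^sup>2) \<partial>(\<mu> \<Otimes>\<^sub>M \<nu>))
      - real n * dcov_hat (levy_fun \<mu>) (levy_fun \<nu>) n (\<lambda>i. Xs i \<omega>) (\<lambda>i. Ys i \<omega>)\<bar> \<partial>M) \<le> ennreal (3 * K / sqrt n)"
proof -
  interpret \<mu>: sigma_finite_measure \<mu> by (rule levy_sigma_finite[OF \<mu>])
  interpret \<nu>: sigma_finite_measure \<nu> by (rule levy_sigma_finite[OF \<nu>])
  interpret m: pair_sigma_finite \<mu> \<nu> ..
  let ?m = "\<mu> \<Otimes>\<^sub>M \<nu>"
  have m_sigma: "sigma_finite_measure ?m" by (rule m.sigma_finite_measure_axioms)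
  interpret mM: pair_sigma_finite ?m M
    using m_sigma sigma_finite_measure_axioms by (simp add: pair_sigma_finite_def)
  have m_sets [measurable_cong]: "sets ?m = sets borel"
    unfolding borel_prod[symmetric] by (rule sets_pair_measure_cong[OF levy_sets[OF \<mu>] levy_sets[OF \<nu>]])
  let ?W = "\<lambda>p \<omega>. empirical n p \<omega>" and ?Z = "\<lambda>p \<omega>. centred_ecf n (\<lambda>i. Xs i \<omega>) (\<lambda>i. Ys i \<omega>) p"
  note [measurable] = empirical_meas2[of n] centred_ecf_meas2[of n]
  have Wp: "(\<lambda>p. ?W p \<omega>) \<in> borel_measurable borel" if "\<omega> \<in> space M" for \<omega>
    using measurable_Pair1[OF empirical_meas2 that] by simp
  have Zw [measurable]: "?Z p \<in> borel_measurable M" for p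
    using measurable_Pair2[OF centred_ecf_meas2, of p] by simp
  have kernel_meas [measurable]: "(\<lambda>p. ennreal (Re (kernel p p))) \<in> borel_measurable borel"
    unfolding kernel_diag borel_prod[symmetric] by measurable
  let ?h = "\<lambda>p \<omega>. ennreal \<bar>(cmod (?W p \<omega>))\<^sup>2 - (cmod (?Z p \<omega>))\<^sup>2\<bar>"
  \<comment> \<open>This choice balances the two error terms \<open>(1 + 1 / \<delta>) / n\<close>
    and \<open>\<delta>\<close>: both are of order \<open>1 / sqrt n\<close>. The constant 3 comes
    from \<open>1 + sqrt n \<le> 2 * sqrt n\<close> plus the second term.\<close>
  define \<delta> where "\<delta> = 1 / sqrt n"
  have \<delta>: "\<delta> > 0" using n by (simp add: \<delta>_def)
  have "(\<integral>\<^sup>+\<omega>. ennreal \<bar>enn2real (\<integral>\<^sup>+p. ennreal ((cmod (?W p \<omega>))\<^sup>2) \<partial>?m)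
      - real n * dcov_hat (levy_fun \<mu>) (levy_fun \<nu>) n (\<lambda>i. Xs i \<omega>) (\<lambda>i. Ys i \<omega>)\<bar> \<partial>M) \<le> (\<integral>\<^sup>+\<omega>. \<integral>\<^sup>+p. ?h p \<omega> \<partial>?m \<partial>M)"
  proof (rule nn_integral_mono)
    fix \<omega> assume \<omega>: "\<omega> \<in> space M"
    note [measurable] = Wp[OF \<omega>] borel_measurable_centred_ecf[of n "\<lambda>i. Xs i \<omega>" "\<lambda>i. Ys i \<omega>"]
    note V = dcov_hat_eq_nn_integral[OF \<mu> \<nu>, of n "\<lambda>i. Xs i \<omega>" "\<lambda>i. Ys i \<omega>"]
    have "ennreal \<bar>enn2real (\<integral>\<^sup>+p. ennreal ((cmod (?W p \<omega>))\<^sup>2) \<partial>?m) - enn2real (\<integral>\<^sup>+p. ennreal ((cmod (?Z p \<omega>))\<^sup>2) \<partial>?m)\<bar>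
      \<le> (\<integral>\<^sup>+p. ?h p \<omega> \<partial>?m)"
      by (rule abs_enn2real_nn_integral_diff_le)
        (use V(2) in simp_all)
    then show "ennreal \<bar>enn2real (\<integral>\<^sup>+p. ennreal ((cmod (?W p \<omega>))\<^sup>2) \<partial>?m)
      - real n * dcov_hat (levy_fun \<mu>) (levy_fun \<nu>) n (\<lambda>i. Xs i \<omega>) (\<lambda>i. Ys i \<omega>)\<bar> \<le> (\<integral>\<^sup>+p. ?h p \<omega> \<partial>?m)"
      unfolding V(2) using V(1) by simp
  qed
  also have "\<dots> = (\<integral>\<^sup>+p. \<integral>\<^sup>+\<omega>. ?h p \<omega> \<partial>M \<partial>?m)"
    by (rule mM.Fubini') measurable
  also have "\<dots> \<le> (\<integral>\<^sup>+p. ennreal (3 / sqrt n) * ennreal (Re (kernel p p)) \<partial>?m)"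
  proof (rule nn_integral_mono)
    fix p
    have "(\<integral>\<^sup>+\<omega>. ?h p \<omega> \<partial>M) \<le> (\<integral>\<^sup>+\<omega>. ennreal (1 + 1 / \<delta>) * ennreal ((cmod (?W p \<omega> - ?Z p \<omega>))\<^sup>2)
        + ennreal \<delta> * ennreal ((cmod (?W p \<omega>))\<^sup>2) \<partial>M)"
      using abs_cmod_square_diff_le[OF \<delta>] \<delta>
      by (intro nn_integral_mono) (simp flip: ennreal_mult ennreal_plus)
    also have "\<dots> = ennreal (1 + 1 / \<delta>) * (\<integral>\<^sup>+\<omega>. ennreal ((cmod (?W p \<omega> - ?Z p \<omega>))\<^sup>2) \<partial>M)
        + ennreal \<delta> * (\<integral>\<^sup>+\<omega>. ennreal ((cmod (?W p \<omega>))\<^sup>2) \<partial>M)"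
      by (subst nn_integral_add) (auto simp: nn_integral_cmult)
    also have "\<dots> \<le> ennreal (1 + 1 / \<delta>) * (ennreal (1 / n) * ennreal (Re (kernel p p))) + ennreal \<delta> * ennreal (Re (kernel p p))"
      unfolding remainder_second_moment by (intro add_mono mult_left_mono empirical_second_moment_le) auto
    also have "\<dots> = ennreal ((1 + 1 / \<delta>) * (1 / n) + \<delta>) * ennreal (Re (kernel p p))"
    proof -
      have "ennreal ((1 + 1 / \<delta>) * (1 / n) + \<delta>) = ennreal ((1 + 1 / \<delta>) * (1 / n)) + ennreal \<delta>"
        using \<delta> by (intro ennreal_plus) auto
      also have "ennreal ((1 + 1 / \<delta>) * (1 / n)) = ennreal (1 + 1 / \<delta>) * ennreal (1 / n)"
        using \<delta> by (intro ennreal_mult) auto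
      finally show ?thesis by (simp only: distrib_right mult.assoc)
    qed
    also have "\<dots> \<le> ennreal (3 / sqrt n) * ennreal (Re (kernel p p))"
    proof (intro mult_right_mono ennreal_leI)
      have s: "1 \<le> sqrt n" "sqrt n * sqrt n = n" using n by simp_all
      have "(1 + 1 / \<delta>) * (1 / n) + \<delta> = (1 + sqrt n) / (sqrt n * sqrt n) + 1 / sqrt n"
        unfolding \<delta>_def s(2) by simp
      also have "\<dots> \<le> (sqrt n + sqrt n) / (sqrt n * sqrt n) + 1 / sqrt n"
        using s(1) by (intro add_right_mono divide_right_mono) auto
      also have "\<dots> = 3 / sqrt n" using n by (simp add: field_simps)
      finally show "(1 + 1 / \<delta>) * (1 / n) + \<delta> \<le> 3 / sqrt n" .
    qed auto
    finally show "(\<integral>\<^sup>+\<omega>. ?h p \<omega> \<partial>M) \<le> ennreal (3 / sqrt n) * ennreal (Re (kernel p p))" .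
  qed
  also have "\<dots> = ennreal (3 / sqrt n) * ennreal K"
    unfolding K(1)[symmetric] by (rule nn_integral_cmult) measurable
  also have "\<dots> = ennreal (3 * K / sqrt n)"
    using K(2) by (simp flip: ennreal_mult)
  finally show ?thesis .
qed

end

section \<open>From Laplace transforms to the law of the estimator\<close>

theorem theorem4p5:
  fixes \<mu> :: "'a::euclidean_space measure" and \<nu> :: "'b::euclidean_space measure"
    and M :: "'w measure"
    and X :: "'w \<Rightarrow> 'a" and Y :: "'w \<Rightarrow> 'b"
    and Xs :: "nat \<Rightarrow> 'w \<Rightarrow> 'a" and Ys :: "nat \<Rightarrow> 'w \<Rightarrow> 'b"
    and \<epsilon> :: real
    and P :: "'q measure" and G :: "'a \<Rightarrow> 'b \<Rightarrow> 'q \<Rightarrow> complex"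
  assumes levy_mu: "sym_levy_measure \<mu>" and supp_mu: "full_support \<mu>"
    and levy_nu: "sym_levy_measure \<nu>" and supp_nu: "full_support \<nu>"
    and M: "prob_space M"
    and X: "X \<in> borel_measurable M" and Y: "Y \<in> borel_measurable M"
    and indep_XY: "indep_rvs M X Y"
    and eps: "\<epsilon> > 0"
    and mom1: "(\<integral>\<^sup>+ \<omega>. ennreal (levy_fun \<mu> (X \<omega>) + levy_fun \<nu> (Y \<omega>)) \<partial>M) < \<infinity>"
    and mom2: "(\<integral>\<^sup>+ \<omega>. ennreal (ln (1 + norm (X \<omega>) ^ 2) powr (1 + \<epsilon>)
                                  + ln (1 + norm (Y \<omega>) ^ 2) powr (1 + \<epsilon>)) \<partial>M) < \<infinity>"
    and iid_indep: "prob_space.indep_vars M (\<lambda>_. borel) (\<lambda>i \<omega>. (Xs i \<omega>, Ys i \<omega>)) UNIV"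
    and iid_distr: "\<And>i. distr M borel (\<lambda>\<omega>. (Xs i \<omega>, Ys i \<omega>)) = distr M borel (\<lambda>\<omega>. (X \<omega>, Y \<omega>))"
    and P: "prob_space P"
    and G_meas: "(\<lambda>(s, t, \<omega>). G s t \<omega>) \<in> borel_measurable (borel \<Otimes>\<^sub>M borel \<Otimes>\<^sub>M P)"
    and G_gauss: "complex_gaussian_field P G"
    and G_int: "\<And>s t. integrable P (G s t)"
    and G_mean: "\<And>s t. (CLINT \<omega>|P. G s t \<omega>) = 0"
    and G_cov: "\<And>s t s' t'.
        (CLINT \<omega>|P. (G s t \<omega> - (CLINT \<omega>'|P. G s t \<omega>')) * cnj (G s' t' \<omega> - (CLINT \<omega>'|P. G s' t' \<omega>')))
        = (char_fun M X (s - s') - char_fun M X s * cnj (char_fun M X s'))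
          * (char_fun M Y (t - t') - char_fun M Y t * cnj (char_fun M Y t'))"
    and G_sym: "\<And>s t. AE \<omega> in P. G (- s) (- t) \<omega> = cnj (G s t \<omega>)"
  shows "weak_conv_m
           (\<lambda>N. distr M borel (\<lambda>\<omega>. real N * dcov_hat (levy_fun \<mu>) (levy_fun \<nu>) N
                                          (\<lambda>i. Xs i \<omega>) (\<lambda>i. Ys i \<omega>)))
           (distr P borel (\<lambda>\<omega>. enn2real
              (\<integral>\<^sup>+ t. (\<integral>\<^sup>+ s. ennreal ((cmod (G s t \<omega>))\<^sup>2) \<partial>\<mu>) \<partial>\<nu>)))"
proof -
  interpret iid_pairs M X Y Xs Ys
    using M X Y indep_XY iid_indep iid_distr by (simp add: iid_pairs_def iid_pairs_axioms_def)
  interpret P: prob_space P by fact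
  interpret \<mu>: sigma_finite_measure \<mu> by (rule levy_sigma_finite[OF levy_mu])
  interpret \<nu>: sigma_finite_measure \<nu> by (rule levy_sigma_finite[OF levy_nu])
  interpret m: pair_sigma_finite \<mu> \<nu> ..
  let ?m = "\<mu> \<Otimes>\<^sub>M \<nu>"
  have m_sets [measurable_cong]: "sets ?m = sets borel"
    unfolding borel_prod[symmetric] by (rule sets_pair_measure_cong[OF levy_sets[OF levy_mu] levy_sets[OF levy_nu]])
  define g where "g p = G (fst p) (snd p)" for p
  let ?V = "\<lambda>n \<omega>. real n * dcov_hat (levy_fun \<mu>) (levy_fun \<nu>) n (\<lambda>i. Xs i \<omega>) (\<lambda>i. Ys i \<omega>)"
  let ?W = "\<lambda>n \<omega>. enn2real (\<integral>\<^sup>+p. ennreal ((cmod (empirical n p \<omega>))\<^sup>2) \<partial>?m)"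
  let ?U = "\<lambda>\<omega>. enn2real (\<integral>\<^sup>+p. ennreal ((cmod (g p \<omega>))\<^sup>2) \<partial>?m)"

  have "(\<lambda>z. (fst (fst z), (snd (fst z), snd z))) \<in> (borel \<Otimes>\<^sub>M borel) \<Otimes>\<^sub>M P \<rightarrow>\<^sub>M borel \<Otimes>\<^sub>M (borel \<Otimes>\<^sub>M P)"
    by measurable
  from measurable_compose[OF this G_meas]
  have g_meas2: "(\<lambda>(p, \<omega>). g p \<omega>) \<in> borel_measurable (borel \<Otimes>\<^sub>M P)"
    by (simp add: g_def split_beta' borel_prod)
  have g_meas [measurable]: "g p \<in> borel_measurable P" for p
    using measurable_Pair2[OF g_meas2, of p] by simp
  have gauss: "real_gaussian_rv P (\<lambda>\<omega>. \<Sum>p\<in>S. a p * Re (g p \<omega>) + b p * Im (g p \<omega>))" if "finite S" for S a b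
    using G_gauss that unfolding complex_gaussian_field_def g_def by blast
  have herm: "hermitian_field P g kernel"
  proof
    show "g p \<in> borel_measurable P" for p by (rule g_meas)
    \<comment> \<open>Square integrability comes from Gaussianity: the real and imaginary parts are
      linear combinations over a single point.\<close>
    show "integrable P (\<lambda>\<omega>. (cmod (g p \<omega>))\<^sup>2)" for p
      using real_gaussian_rv_square_integrable[OF P gauss[of "{p}" "\<lambda>_. 1" "\<lambda>_. 0"]]
        real_gaussian_rv_square_integrable[OF P gauss[of "{p}" "\<lambda>_. 0" "\<lambda>_. 1"]]
      by (simp add: cmod_power2)
    show "(CLINT \<omega>|P. g p \<omega> * cnj (g q \<omega>)) = kernel p q" for p q
      using G_cov[of "fst p" "snd p" "fst q" "snd q"] by (simp add: G_mean g_def kernel_def)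
    show "AE \<omega> in P. g (- p) \<omega> = cnj (g p \<omega>)" for p
      using G_sym[of "fst p" "snd p"] by (simp add: g_def)
  qed
  interpret g: hermitian_field P g kernel by (rule herm)

  have fin: "(\<integral>\<^sup>+\<omega>. ennreal (levy_fun \<mu> (X \<omega>)) \<partial>M) < \<infinity>" "(\<integral>\<^sup>+\<omega>. ennreal (levy_fun \<nu> (Y \<omega>)) \<partial>M) < \<infinity>"
    using levy_fun_nonneg[OF levy_mu] levy_fun_nonneg[OF levy_nu]
    by (intro le_less_trans[OF _ mom1] nn_integral_mono ennreal_leI; simp)+
  define K where "K = enn2real (\<integral>\<^sup>+p. ennreal (Re (kernel p p)) \<partial>?m)"
  have K: "(\<integral>\<^sup>+p. ennreal (Re (kernel p p)) \<partial>?m) = ennreal K" "0 \<le> K"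
    using kernel_diag_finite[OF levy_mu levy_nu fin] by (simp_all add: K_def)

  have W_meas [measurable]: "?W n \<in> borel_measurable M" for n
    using empirical_meas2[of n]
    by (intro borel_measurable_enn2real sigma_finite_measure.measurable_nn_integral_complex_square m.sigma_finite_measure_axioms)
      (simp add: m_sets cong: measurable_cong_sets)
  have U_meas [measurable]: "?U \<in> borel_measurable P"
    using g_meas2
    by (intro borel_measurable_enn2real sigma_finite_measure.measurable_nn_integral_complex_square m.sigma_finite_measure_axioms)
      (simp add: m_sets cong: measurable_cong_sets)
  have V0: "0 \<le> ?V n \<omega>" for n \<omega>
    by (rule dcov_hat_eq_nn_integral(1)[OF levy_mu levy_nu])
  have V_meas [measurable]: "?V n \<in> borel_measurable M" for n
    by (rule dcov_hat_meas[OF levy_mu levy_nu])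

  \<comment> \<open>The variance of an increment of the limit field. It also bounds that of the
    empirical field for every \<open>n\<close>, vanishes on the diagonal, and inherits continuity
    from the characteristic functions.\<close>
  define D where "D p q = Re (kernel p p - kernel p q - kernel q p + kernel q q)" for p q
  \<comment> \<open>The quadrature argument is applied to the i.i.d. field and not to the one in the
    estimator, since only the former has the moment bounds of the limit for every \<open>n\<close>.
    The constant 16 adds up four kernel values of modulus at most 4.\<close>
  have laplace_W: "(\<lambda>n. \<integral>\<omega>. exp (- \<theta> * ?W n \<omega>) \<partial>M) \<longlonglongrightarrow> (\<integral>\<omega>. exp (- \<theta> * ?U \<omega>) \<partial>P)" if "0 \<le> \<theta>" for \<theta>
  proof (rule field_laplace_convergence[where k = "\<lambda>p. ennreal (Re (kernel p p))" and D = D and B = 16])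
    show "sigma_finite_measure ?m" by (rule m.sigma_finite_measure_axioms)
    show "(\<lambda>p. ennreal (Re (kernel p p))) \<in> borel_measurable borel"
      unfolding kernel_diag borel_prod[symmetric] by measurable
    have kc: "continuous_on UNIV (\<lambda>z. kernel (f z) (h z))"
      if "continuous_on UNIV f" "continuous_on UNIV h" for f h :: "('a \<times> 'b) \<times> ('a \<times> 'b) \<Rightarrow> 'a \<times> 'b"
      using continuous_on_compose2[OF continuous_on_kernel[of UNIV] continuous_on_Pair[OF that]] by simp
    show "continuous_on UNIV (\<lambda>(p, q). D p q)"
      unfolding D_def split_beta' by (intro continuous_intros kc)
    show "D p q \<le> 16" for p q
    proof -
      have "cmod (kernel p p - kernel p q - kernel q p + kernel q q) \<le> cmod (kernel p p) + cmod (kernel p q) + cmod (kernel q p) + cmod (kernel q q)"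
        by (intro order_trans[OF norm_triangle_ineq] order_trans[OF norm_triangle_ineq4] add_mono order_refl)
      then show ?thesis
        unfolding D_def
        using complex_Re_le_cmod[of "kernel p p - kernel p q - kernel q p + kernel q q"]
          cmod_kernel_le[of p p] cmod_kernel_le[of p q] cmod_kernel_le[of q p] cmod_kernel_le[of q q] by linarith
    qed
    show "(\<integral>\<^sup>+\<omega>. ennreal ((cmod (g p \<omega>))\<^sup>2) \<partial>P) \<le> ennreal (Re (kernel p p))" for p
      using nn_integral_eq_integral[OF g.F_sq[of p]] by (simp add: g.second_moment)
    show "(\<integral>\<^sup>+\<omega>. ennreal ((cmod (g p \<omega> - g q \<omega>))\<^sup>2) \<partial>P) \<le> ennreal (D p q)" for p q
      using nn_integral_eq_integral[OF g.increment(1)[of p q]] by (simp add: g.increment(2) D_def)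
    show "(\<integral>\<^sup>+\<omega>. ennreal ((cmod (empirical n p \<omega> - empirical n q \<omega>))\<^sup>2) \<partial>M) \<le> ennreal (D p q)" for n p q
      unfolding D_def by (rule empirical_increment_le)
    show "(\<lambda>n. \<integral>\<omega>. exp (- (\<Sum>p\<in>S. c p * (cmod (empirical n p \<omega>))\<^sup>2)) \<partial>M) \<longlonglongrightarrow>
        (\<integral>\<omega>. exp (- (\<Sum>p\<in>S. c p * (cmod (g p \<omega>))\<^sup>2)) \<partial>P)" if "finite S" "\<And>p. 0 \<le> c p" for S c
      by (rule empirical_fidi_laplace[OF P herm _ _ gauss that]) (simp_all add: g_def G_int G_mean)
  qed (use that K M P m_sets empirical_meas2 g_meas2 empirical_second_moment_le in \<open>simp_all add: D_def\<close>)

  have laplace_V: "(\<lambda>n. \<integral>\<omega>. exp (- \<theta> * ?V n \<omega>) \<partial>M) \<longlonglongrightarrow> (\<integral>\<omega>. exp (- \<theta> * ?U \<omega>) \<partial>P)" if \<theta>: "0 \<le> \<theta>" for \<theta>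
  \<comment> \<open>Passing to the estimator costs \<open>\<theta>\<close> times the distance in
    mean, because \<open>exp (- \<theta> * z)\<close> is Lipschitz with constant
    \<open>\<theta>\<close> on nonnegative arguments.\<close>
  proof (rule Lim_transform[OF laplace_W[OF \<theta>]])
    have "\<forall>\<^sub>F n in sequentially. norm ((\<integral>\<omega>. exp (- \<theta> * ?V n \<omega>) \<partial>M) - (\<integral>\<omega>. exp (- \<theta> * ?W n \<omega>) \<partial>M)) \<le> \<theta> * (3 * K / sqrt n)"
      using eventually_gt_at_top[of 0]
    proof eventually_elim
      case (elim n)
      have "\<bar>(\<integral>\<omega>. exp (- \<theta> * ?W n \<omega>) \<partial>M) - (\<integral>\<omega>. exp (- \<theta> * ?V n \<omega>) \<partial>M)\<bar> \<le> \<theta> * (3 * K / sqrt n)"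
        using V0 K(2) \<theta>
        by (intro integral_exp_minus_diff_le[OF M W_meas V_meas _ _ dcov_hat_empirical_distance[OF levy_mu levy_nu elim K]]) auto
      then show ?case by (simp add: abs_minus_commute)
    qed
    moreover have "(\<lambda>n. \<theta> * (3 * K / sqrt (real n))) \<longlonglongrightarrow> 0"
      by real_asymp
    ultimately show "(\<lambda>n. (\<integral>\<omega>. exp (- \<theta> * ?V n \<omega>) \<partial>M) - (\<integral>\<omega>. exp (- \<theta> * ?W n \<omega>) \<partial>M)) \<longlonglongrightarrow> 0"
      by (rule Lim_null_comparison)
  qed

  have "weak_conv_m (\<lambda>n. distr M borel (?V n)) (distr P borel ?U)"
    by (rule laplace_convergence_imp_weak_conv[OF M P V_meas U_meas V0 _ laplace_V]) simp_all
  \<comment> \<open>For each \<open>\<omega>\<close> Tonelli identifies the integral over the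
    product measure with the iterated one, so the two variables coincide everywhere.\<close>
  moreover have "distr P borel ?U = distr P borel (\<lambda>\<omega>. enn2real (\<integral>\<^sup>+ t. (\<integral>\<^sup>+ s. ennreal ((cmod (G s t \<omega>))\<^sup>2) \<partial>\<mu>) \<partial>\<nu>))"
  proof (rule distr_cong)
    fix \<omega> assume "\<omega> \<in> space P"
    then have "(\<lambda>p. ennreal ((cmod (g p \<omega>))\<^sup>2)) \<in> borel_measurable ?m"
      using measurable_Pair1[OF g_meas2, of \<omega>] by simp
    from m.nn_integral_snd[OF this] show "?U \<omega> = enn2real (\<integral>\<^sup>+ t. (\<integral>\<^sup>+ s. ennreal ((cmod (G s t \<omega>))\<^sup>2) \<partial>\<mu>) \<partial>\<nu>)"
      by (simp add: g_def)
  qed simp_all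
  ultimately show ?thesis by simp
qed

end
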